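(* Let $m\in\mathbb{N}$ (with $m\ge1$), $0<s<1$ and $1\le p<\infty$ satisfy $$\frac{2}{p}\le s<\frac1m .$$ Then there is a constant $C=C(N,m,p,s)>0$ such that for every $u\in BMO(\mathbb{R}^N)\cap W^{m,sp}(\mathbb{R}^N)$, $$\|u\|_{W^{ms,p}(\mathbb{R}^N)}\le C\,\|u\|_{BMO(\mathbb{R}^N)}^{1-s}\,\|u\|_{W^{m,sp}(\mathbb{R}^N)}^{s}.$$
   Context: $\|u\|_{W^{ms,p}(\mathbb{R}^N)}$ (note $0<ms<1$) denotes the Gagliardo seminorm $$\|u\|_{W^{\sigma,p}(\mathbb{R}^N)}:=\left(\int_{\mathbb{R}^N}\int_{\mathbb{R}^N}\frac{|u(x)-u(z)|^p}{|x-z|^{\sigma p+N}}dx\,dz\right)^{1/p},\quad \sigma=ms,$$ whereas $\|u\|_{W^{m,sp}(\mathbb{R}^N)}$ denotes the homogeneous Sobolev seminorm $$\|u\|_{W^{m,sp}(\mathbb{R}^N)}:=\left(\sum_{|\alpha|=m}\|D^\alpha u\|_{L^{sp}(\mathbb{R}^N)}^{sp}\right)^{1/(sp)} .$$ The space $W^{m,sp}(\mathbb{R}^N)$ is the usual Sobolev space. A cube is a Cartesian product of $N$ non-empty closed bounded intervals of the same (positive) length. For real-valued $u\in L^1_{\mathrm{loc}}(\mathbb{R}^N)$, $u\in BMO(\mathbb{R}^N)$ means that $$\|u\|_{BMO(\mathbb{R}^N)}:=\sup\left\{\frac{1}{\mathcal{L}^N(C)^2}\int_C\int_C|u(z)-u(x)|\,dz\,dx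 : C\subset \mathbb{R}^N\text{ a cube}\right\}<\infty ,$$ $\mathcal{L}^N$ being Lebesgue measure. *)

theory Defs
  imports "HOL-Analysis.Analysis"
begin

text \<open>
  Functions on \<open>\<real>\<^sup>N\<close> are rendered as functions on \<^typ>\<open>real ^ 'n\<close>, with \<open>N = CARD('n)\<close>. All norms and
  seminorms take values in \<^typ>\<open>ennreal\<close>, so that an upper bound by a finite quantity includes
  the assertion that the seminorm is finite.
\<close>

text \<open>Real powers on \<open>[0, \<infinity>]\<close>; only positive exponents are intended, whence \<open>\<infinity>\<^sup>a = \<infinity>\<close>.\<close>

definition ennpowr :: "ennreal \<Rightarrow> real \<Rightarrow> ennreal" where
  "ennpowr x a = (if x = \<infinity> then \<infinity> else ennreal (enn2real x powr a))"

definition locally_integrable :: "(real ^ 'n \<Rightarrow> real) \<Rightarrow> bool" where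
  "locally_integrable u \<longleftrightarrow> (\<forall>K. compact K \<longrightarrow> set_integrable lebesgue K u)"

definition Lp_norm :: "real \<Rightarrow> (real ^ 'n \<Rightarrow> real) \<Rightarrow> ennreal" where
  "Lp_norm q u = ennpowr (\<integral>\<^sup>+x. ennreal (\<bar>u x\<bar> powr q) \<partial>lebesgue) (1 / q)"

definition Lp_space :: "real \<Rightarrow> (real ^ 'n \<Rightarrow> real) set" where
  "Lp_space q = {u. u \<in> borel_measurable lebesgue \<and> Lp_norm q u < \<infinity>}"


definition partial_deriv :: "'n \<Rightarrow> (real ^ 'n \<Rightarrow> real) \<Rightarrow> real ^ 'n \<Rightarrow> real" where
  "partial_deriv i f x = deriv (\<lambda>t. f (x + t *\<^sub>R axis i 1)) 0"

fun iter_partial_deriv :: "'n list \<Rightarrow> (real ^ 'n \<Rightarrow> real) \<Rightarrow> real ^ 'n \<Rightarrow> real" where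
  "iter_partial_deriv [] f = f"
| "iter_partial_deriv (i # is) f = partial_deriv i (iter_partial_deriv is f)"

text \<open>
  A function is \<open>C\<^sup>\<infinity>\<close> iff all its iterated partial derivatives exist and are continuous; requiring
  each of them to be (totally) differentiable provides both.
\<close>

definition smooth :: "(real ^ 'n \<Rightarrow> real) \<Rightarrow> bool" where
  "smooth f \<longleftrightarrow> (\<forall>is x. iter_partial_deriv is f differentiable (at x))"

definition test_function :: "(real ^ 'n \<Rightarrow> real) \<Rightarrow> bool" where
  "test_function \<phi> \<longleftrightarrow> smooth \<phi> \<and> compact (closure {x. \<phi> x \<noteq> 0})"

text \<open>
  A multi-index is a function \<open>\<alpha> :: 'n \<Rightarrow> nat\<close> of order \<open>\<Sum>i\<in>UNIV. \<alpha> i\<close>. For smooth \<open>\<phi>\<close>, \<open>D\<^sup>\<alpha> \<phi>\<close> is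
  the iterated partial derivative along any list of coordinates in which each \<open>i\<close> occurs \<open>\<alpha> i\<close> times;
  the order of differentiation is immaterial by the symmetry of higher derivatives.
\<close>

definition has_weak_deriv ::
    "(real ^ 'n \<Rightarrow> real) \<Rightarrow> ('n::finite \<Rightarrow> nat) \<Rightarrow> (real ^ 'n \<Rightarrow> real) \<Rightarrow> bool" where
  "has_weak_deriv u \<alpha> v \<longleftrightarrow>
     locally_integrable u \<and> locally_integrable v \<and>
     (\<forall>\<phi> is. test_function \<phi> \<longrightarrow> (\<forall>i. count_list is i = \<alpha> i) \<longrightarrow>
        (LINT x|lebesgue. u x * iter_partial_deriv is \<phi> x) =
        (-1) ^ (\<Sum>i\<in>UNIV. \<alpha> i) * (LINT x|lebesgue. v x * \<phi> x))"

text \<open>The weak derivative is unique up to null sets; this selects a representative.\<close>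

definition weak_deriv ::
    "('n::finite \<Rightarrow> nat) \<Rightarrow> (real ^ 'n \<Rightarrow> real) \<Rightarrow> real ^ 'n \<Rightarrow> real" where
  "weak_deriv \<alpha> u = (SOME v. has_weak_deriv u \<alpha> v)"

definition sobolev_space :: "nat \<Rightarrow> real \<Rightarrow> (real ^ 'n::finite \<Rightarrow> real) set" where
  "sobolev_space m q =
     {u. u \<in> Lp_space q \<and>
         (\<forall>\<alpha>. (\<Sum>i\<in>UNIV. \<alpha> i) \<le> m \<longrightarrow> (\<exists>v. has_weak_deriv u \<alpha> v \<and> v \<in> Lp_space q))}"

text \<open>The homogeneous seminorm, involving only the derivatives of order exactly \<open>m\<close>.\<close>

definition sobolev_seminorm :: "nat \<Rightarrow> real \<Rightarrow> (real ^ 'n::finite \<Rightarrow> real) \<Rightarrow> ennreal" where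
  "sobolev_seminorm m q u =
     ennpowr (\<Sum>\<alpha> | (\<Sum>i\<in>UNIV. \<alpha> i) = m. ennpowr (Lp_norm q (weak_deriv \<alpha> u)) q) (1 / q)"


text \<open>On the (null) diagonal \<open>x = z\<close> the integrand is \<open>0 / 0 = 0\<close>.\<close>

definition gagliardo_seminorm :: "real \<Rightarrow> real \<Rightarrow> (real ^ 'n::finite \<Rightarrow> real) \<Rightarrow> ennreal" where
  "gagliardo_seminorm \<sigma> p u =
     ennpowr (\<integral>\<^sup>+z. (\<integral>\<^sup>+x. ennreal (\<bar>u x - u z\<bar> powr p / norm (x - z) powr (\<sigma> * p + real CARD('n)))
                  \<partial>lebesgue) \<partial>lebesgue) (1 / p)"


definition is_cube :: "(real ^ 'n) set \<Rightarrow> bool" where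
  "is_cube Q \<longleftrightarrow> (\<exists>a l. l > 0 \<and> Q = cbox a (\<chi> i. a $ i + l))"

definition bmo_norm :: "(real ^ 'n \<Rightarrow> real) \<Rightarrow> ennreal" where
  "bmo_norm u =
     (SUP Q \<in> {Q. is_cube Q}.
        (\<integral>\<^sup>+x\<in>Q. (\<integral>\<^sup>+z\<in>Q. ennreal \<bar>u z - u x\<bar> \<partial>lebesgue) \<partial>lebesgue) / (emeasure lebesgue Q)\<^sup>2)"

definition bmo_space :: "(real ^ 'n \<Rightarrow> real) set" where
  "bmo_space = {u. locally_integrable u \<and> bmo_norm u < \<infinity>}"

end

theory Submission
  imports Defs
begin

text \<open>
  Pair \<open>u\<close> at every scale \<open>\<rho>\<close> with a smooth tensor kernel of mass one all of whose lower moments vanish.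
  Passing from scale \<open>\<rho>\<close> to \<open>2\<rho>\<close> changes the difference of the pairings at \<open>x\<close> and \<open>z\<close>, up to the factor
  \<open>min 1 (\<bar>x - z\<bar> / \<rho>)\<close>, by at most a multiple of the BMO norm \<open>B\<close>, and also by at most a multiple of
  \<open>\<rho>\<^sup>m (g x + g z)\<close>, where \<open>g\<close> is the Hardy-Littlewood maximal function of the pure derivatives of order \<open>m\<close>.
  Summing the geometric mean of both bounds over dyadic scales gives, for every \<open>0 < a < 1\<close>,
  \<open>\<bar>u x - u z\<bar> \<le> C \<bar>x - z\<bar>\<^sup>a B\<^bsup>1 - a/m\<^esup> (g x + g z)\<^bsup>a/m\<^esup>\<close> almost everywhere.
  Using one \<open>a > ms\<close> near the diagonal and one \<open>a < ms\<close> away from it, the Gagliardo integral is bounded by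
  a multiple of \<open>B\<^bsup>p - sp\<^esup> \<integral> g\<^bsup>sp\<^esup>\<close>, and the maximal theorem in \<open>L\<^bsup>sp\<^esup>\<close> concludes.
\<close>

section \<open>Smooth functions of one variable\<close>

text \<open>The moments are never computed. What is used is the equivalent fact that, in each
  variable, the profile minus its mass-preserving dilation by 2 is the \<open>m\<close>-th
  derivative of a compactly supported function. With a tensor kernel the coordinates can be dilated
  one after another, so passing from scale \<rho> to 2\<rho> is a sum of N pure \<open>m\<close>-th
  derivatives of test functions, and weak differentiability is invoked only against tensor products.
  All kernels share the same mass because BMO controls only pairings with mean-zero kernels. The
  factor min 1 (|x - z| / \<rho>) decides the range of exponents: the interpolated step has size
  \<rho>^a below |x - z| and |x - z| \<rho>^(a - 1) above it, summable on both sides exactly when 0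
  < a < 1. Since 0 < ms < 1 there is room on either side of ms; the exponent a = ms alone would
  leave a logarithmically divergent integral. The estimates are carried out for Borel functions and
  \<open>lborel\<close>, where Fubini and joint measurability are at hand; Lebesgue measurable data
  are replaced by Borel representatives only at the end.\<close>

definition flat_exp :: "nat \<Rightarrow> real \<Rightarrow> real" where
  "flat_exp n t = (if t > 0 then exp (- inverse t) * inverse t ^ n else 0)"

text \<open>Generating the class inductively makes its closure under differentiation a rule induction.\<close>

inductive smooth1 :: "(real \<Rightarrow> real) \<Rightarrow> bool" where
  smooth1_const: "smooth1 (\<lambda>t. c)"
| smooth1_ident: "smooth1 (\<lambda>t. t)"
| smooth1_add: "smooth1 f \<Longrightarrow> smooth1 g \<Longrightarrow> smooth1 (\<lambda>t. f t + g t)"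
| smooth1_mult: "smooth1 f \<Longrightarrow> smooth1 g \<Longrightarrow> smooth1 (\<lambda>t. f t * g t)"
| smooth1_affine: "smooth1 f \<Longrightarrow> smooth1 (\<lambda>t. f (a * t + b))"
| smooth1_inverse: "smooth1 f \<Longrightarrow> (\<And>t. f t \<noteq> 0) \<Longrightarrow> smooth1 (\<lambda>t. inverse (f t))"
| smooth1_flat_exp: "smooth1 (flat_exp n)"

lemma tendsto_flat_exp_0: "(flat_exp n \<longlongrightarrow> 0) (at 0)"
proof (rule filterlim_split_at)
  have "eventually (\<lambda>t. flat_exp n t = 0) (at_left (0::real))"
    by (auto simp: eventually_at_left_field flat_exp_def intro: exI[of _ "-1"])
  then show "(flat_exp n \<longlongrightarrow> 0) (at_left 0)"
    by (rule tendsto_eventually)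
  have "((\<lambda>t::real. inverse t ^ n / exp (inverse t)) \<longlongrightarrow> 0) (at_right 0)"
    by (rule filterlim_compose[OF tendsto_power_div_exp_0 filterlim_inverse_at_top_right])
  moreover have "eventually (\<lambda>t. inverse t ^ n / exp (inverse t) = flat_exp n t) (at_right (0::real))"
    by (auto simp: eventually_at_right_field flat_exp_def exp_minus field_simps intro: exI[of _ "1"])
  ultimately show "(flat_exp n \<longlongrightarrow> 0) (at_right 0)"
    using Lim_transform_eventually by blast
qed

text \<open>The parameter \<open>n\<close> in \<open>flat_exp\<close> exists for this formula: the
  powers of \<open>inverse t\<close> produced by differentiating stay inside the family.\<close>

lemma has_real_derivative_flat_exp:
  "(flat_exp n has_real_derivative (- real n * flat_exp (Suc n) t + flat_exp (Suc (Suc n)) t)) (at t)"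
proof -
  consider "t > 0" | "t < 0" | "t = 0" by linarith
  then show ?thesis
  proof cases
    case 1
    have "((\<lambda>t. exp (- inverse t) * inverse t ^ n) has_real_derivative
        (- real n * flat_exp (Suc n) t + flat_exp (Suc (Suc n)) t)) (at t)"
    proof (cases n)
      case 0
      then show ?thesis using 1
        by (auto intro!: derivative_eq_intros simp: flat_exp_def field_simps power2_eq_square)
    next
      case (Suc k)
      then show ?thesis using 1
        by (auto intro!: derivative_eq_intros simp: flat_exp_def algebra_simps power2_eq_square;
            cases k; simp)
    qed
    then show ?thesis
      by (rule has_field_derivative_transform_within_open[where S = "{0<..}"])
         (use 1 in \<open>auto simp: flat_exp_def\<close>)
  next
    case 2
    have "((\<lambda>t. 0) has_real_derivative
        (- real n * flat_exp (Suc n) t + flat_exp (Suc (Suc n)) t)) (at t)"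
      using 2 by (auto simp: flat_exp_def)
    then show ?thesis
      by (rule has_field_derivative_transform_within_open[where S = "{..<0}"])
         (use 2 in \<open>auto simp: flat_exp_def\<close>)
  next
    case 3
    \<comment> \<open>At the origin the difference quotient of one member is exactly the next
      member, so the limit at 0 already proved yields derivative 0.\<close>
    have "(\<lambda>h. (flat_exp n (0 + h) - flat_exp n 0) / h) = flat_exp (Suc n)"
      by (auto simp: flat_exp_def fun_eq_iff field_simps)
    then have "(flat_exp n has_real_derivative 0) (at 0)"
      using tendsto_flat_exp_0[of "Suc n"] by (simp add: DERIV_def)
    then show ?thesis using 3 by (simp add: flat_exp_def)
  qed
qed

lemma smooth1_derivative_exists:
  assumes "smooth1 f"
  shows "\<exists>f'. smooth1 f' \<and> (\<forall>t. (f has_real_derivative f' t) (at t))"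
  using assms
proof induction
  case (smooth1_const c)
  show ?case by (rule exI[of _ "\<lambda>t. 0"]) (auto intro: smooth1.intros)
next
  case smooth1_ident
  show ?case by (rule exI[of _ "\<lambda>t. 1"]) (auto intro: smooth1.intros)
next
  case (smooth1_add f g)
  then obtain f' g' where "smooth1 f'" "smooth1 g'"
    "\<And>t. (f has_real_derivative f' t) (at t)" "\<And>t. (g has_real_derivative g' t) (at t)"
    by blast
  then show ?case
    by (intro exI[of _ "\<lambda>t. f' t + g' t"]) (auto intro: smooth1.intros derivative_intros)
next
  case (smooth1_mult f g)
  then obtain f' g' where "smooth1 f'" "smooth1 g'"
    "\<And>t. (f has_real_derivative f' t) (at t)" "\<And>t. (g has_real_derivative g' t) (at t)"
    by blast
  then show ?case using smooth1_mult
    by (intro exI[of _ "\<lambda>t. f' t * g t + g' t * f t"])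
       (auto intro: smooth1.intros intro!: DERIV_mult)
next
  case (smooth1_affine f a b)
  then obtain f' where f': "smooth1 f'" "\<And>t. (f has_real_derivative f' t) (at t)"
    by blast
  have "((\<lambda>t. f (a * t + b)) has_real_derivative a * f' (a * t + b)) (at t)" for t
    by (rule DERIV_cong[OF DERIV_chain2[OF f'(2)]]) (auto intro!: derivative_eq_intros)
  with f'(1) show ?case
    by (intro exI[of _ "\<lambda>t. a * f' (a * t + b)"]) (auto intro: smooth1.intros)
next
  case (smooth1_inverse f)
  then obtain f' where f': "smooth1 f'" "\<And>t. (f has_real_derivative f' t) (at t)"
    by blast
  have "((\<lambda>t. inverse (f t)) has_real_derivative (-1) * (f' t * (inverse (f t) * inverse (f t)))) (at t)" for t
    using DERIV_inverse_fun[OF f'(2), of t] smooth1_inverse(2) by (simp add: field_simps)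
  moreover have "smooth1 (\<lambda>t. (-1) * (f' t * (inverse (f t) * inverse (f t))))"
    using f'(1) smooth1_inverse by (intro smooth1.intros) auto
  ultimately show ?case by blast
next
  case (smooth1_flat_exp n)
  have "smooth1 (\<lambda>t. - real n * flat_exp (Suc n) t + flat_exp (Suc (Suc n)) t)"
    by (intro smooth1.intros)
  then show ?case using has_real_derivative_flat_exp by blast
qed

lemma
  assumes "smooth1 f"
  shows smooth1_deriv: "smooth1 (deriv f)"
    and smooth1_has_deriv: "(f has_real_derivative deriv f t) (at t)"
proof -
  from smooth1_derivative_exists[OF assms] obtain f' where f': "smooth1 f'"
    "\<And>t. (f has_real_derivative f' t) (at t)" by blast
  then have "deriv f = f'" by (auto intro: DERIV_imp_deriv)
  with f' show "smooth1 (deriv f)" "(f has_real_derivative deriv f t) (at t)" by auto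
qed

lemma smooth1_higher_deriv: "smooth1 f \<Longrightarrow> smooth1 ((deriv ^^ n) f)"
  by (induction n) (auto intro: smooth1_deriv)

lemma smooth1_continuous_on: "smooth1 f \<Longrightarrow> continuous_on S f"
  by (meson smooth1_has_deriv DERIV_isCont continuous_at_imp_continuous_on)

lemma smooth1_diff: "smooth1 f \<Longrightarrow> smooth1 g \<Longrightarrow> smooth1 (\<lambda>t. f t - g t)"
  using smooth1_add[OF _ smooth1_mult[OF smooth1_const[of "-1"]], of f g] by simp

lemma smooth1_cmult: "smooth1 f \<Longrightarrow> smooth1 (\<lambda>t. c * f t)"
  by (intro smooth1_mult smooth1_const)

lemma smooth1_power: "smooth1 (\<lambda>t. t ^ n)"
  by (induction n) (auto intro: smooth1.intros)

section \<open>Iterated derivatives in one variable\<close>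

lemma higher_deriv_affine:
  assumes "smooth1 f"
  shows "(deriv ^^ n) (\<lambda>t. f (a * t + b)) = (\<lambda>t. a ^ n * (deriv ^^ n) f (a * t + b))"
proof (induction n)
  case (Suc n)
  have "((\<lambda>t. a ^ n * (deriv ^^ n) f (a * t + b)) has_real_derivative
      a ^ Suc n * (deriv ^^ Suc n) f (a * t + b)) (at t)" for t
  proof -
    have "((\<lambda>t. a * t + b) has_real_derivative a) (at t)"
      by (auto intro!: derivative_eq_intros)
    from DERIV_cmult[OF DERIV_chain2[OF smooth1_has_deriv[OF smooth1_higher_deriv[OF assms, of n]] this], of "a ^ n"]
    show ?thesis by (simp add: mult_ac)
  qed
  then show ?case using Suc by (auto intro!: DERIV_imp_deriv)
qed auto

lemma higher_deriv_diff_cmult: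
  assumes "smooth1 f" "smooth1 g"
  shows "(deriv ^^ n) (\<lambda>t. f t - c * g t) = (\<lambda>t. (deriv ^^ n) f t - c * (deriv ^^ n) g t)"
proof (induction n)
  case (Suc n)
  have "((\<lambda>t. (deriv ^^ n) f t - c * (deriv ^^ n) g t) has_real_derivative
     (deriv ^^ Suc n) f t - c * (deriv ^^ Suc n) g t) (at t)" for t
    using assms by (auto intro!: derivative_eq_intros smooth1_has_deriv smooth1_higher_deriv)
  then show ?case using Suc by (auto intro!: DERIV_imp_deriv)
qed auto

lemma higher_deriv_cong_open:
  fixes f g :: "real \<Rightarrow> real"
  assumes "open S" "\<And>t. t \<in> S \<Longrightarrow> f t = g t" "t \<in> S"
  shows "(deriv ^^ n) f t = (deriv ^^ n) g t"
  using assms(3)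
proof (induction n arbitrary: t)
  case (Suc n)
  have "deriv ((deriv ^^ n) f) t = deriv ((deriv ^^ n) g) t"
    by (rule deriv_cong_ev) (use Suc assms(1) in \<open>auto simp: eventually_nhds\<close>)
  then show ?case by simp
qed (use assms in auto)

lemma higher_deriv_zero: "(deriv ^^ n) (\<lambda>t. 0::real) = (\<lambda>t. 0)"
  by (induction n) auto

lemma higher_deriv_power:
  "k \<le> n \<Longrightarrow> (deriv ^^ k) (\<lambda>t. t ^ n :: real) = (\<lambda>t. fact n / fact (n - k) * t ^ (n - k))"
proof (induction k)
  case (Suc k)
  have "((\<lambda>t. fact n / fact (n - k) * t ^ (n - k)) has_real_derivative
     fact n / fact (n - Suc k) * t ^ (n - Suc k)) (at t)" for t :: real
  proof -
    obtain j where j: "n - k = Suc j" "n - Suc k = j" using Suc by (metis Suc_diff_Suc Suc_le_lessD)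
    have "((\<lambda>t. fact n / fact (Suc j) * t ^ Suc j) has_real_derivative
        fact n / fact (Suc j) * (real (Suc j) * t ^ j)) (at t)"
      using DERIV_cmult[OF DERIV_pow[of "Suc j" t UNIV], of "fact n / fact (Suc j)"] by simp
    then show ?thesis unfolding j by (simp del: power_Suc)
  qed
  then show ?case using Suc by (auto intro!: DERIV_imp_deriv)
qed auto

section \<open>Smooth cutoff and the profile with vanishing moments\<close>

definition smooth_step :: "real \<Rightarrow> real" where
  "smooth_step t = flat_exp 0 (t - 1) * inverse (flat_exp 0 (t - 1) + flat_exp 0 (2 - t))"

lemma smooth_step_le_1: "t \<le> 1 \<Longrightarrow> smooth_step t = 0"
  and smooth_step_ge_2: "t \<ge> 2 \<Longrightarrow> smooth_step t = 1"
  by (auto simp: smooth_step_def flat_exp_def)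

text \<open>The denominator never vanishes, since \<open>t - 1\<close> and \<open>2 - t\<close>
  cannot both be non-positive.\<close>

lemma smooth1_smooth_step: "smooth1 smooth_step"
proof -
  have 1: "smooth1 (\<lambda>t. flat_exp 0 (t - 1))"
    using smooth1_affine[OF smooth1_flat_exp, of 0 1 "-1"] by simp
  have 2: "smooth1 (\<lambda>t. flat_exp 0 (2 - t))"
    using smooth1_affine[OF smooth1_flat_exp, of 0 "-1" 2] by simp
  have "flat_exp 0 (t - 1) + flat_exp 0 (2 - t) \<noteq> 0" for t
  proof -
    have "flat_exp 0 (t - 1) \<ge> 0" "flat_exp 0 (2 - t) \<ge> 0" "flat_exp 0 (t - 1) > 0 \<or> flat_exp 0 (2 - t) > 0"
      by (auto simp: flat_exp_def)
    then show ?thesis by linarith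
  qed
  then have "smooth1 (\<lambda>t. flat_exp 0 (t - 1) * inverse (flat_exp 0 (t - 1) + flat_exp 0 (2 - t)))"
    by (intro smooth1_mult smooth1_inverse smooth1_add 1 2)
  then show ?thesis by (simp add: smooth_step_def[abs_def])
qed

text \<open>
  Beyond \<open>t = 2\<close> the primitive is the polynomial \<open>t\<^bsup>m-1\<^esup> / (m-1)!\<close>, so its \<open>m\<close>-th derivative is supported in
  \<open>[1, 2]\<close> and has integral one. Homogeneity of degree \<open>m - 1\<close> makes the difference of the profile and its
  dilation the \<open>m\<close>-th derivative of a function that still has compact support.
\<close>

definition profile_primitive :: "nat \<Rightarrow> real \<Rightarrow> real" where
  "profile_primitive m t = inverse (fact (m - 1)) * (t ^ (m - 1) * smooth_step t)"

definition profile :: "nat \<Rightarrow> real \<Rightarrow> real" where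
  "profile m = (deriv ^^ m) (profile_primitive m)"

definition profile_diff :: "nat \<Rightarrow> real \<Rightarrow> real" where
  "profile_diff m t = profile_primitive m t - 2 ^ (m - 1) * profile_primitive m (t / 2)"

lemma smooth1_profile_primitive: "smooth1 (profile_primitive m)"
  unfolding profile_primitive_def[abs_def]
  by (intro smooth1_cmult smooth1_mult smooth1_power smooth1_smooth_step)

lemma smooth1_profile: "smooth1 (profile m)"
  by (simp add: profile_def smooth1_higher_deriv smooth1_profile_primitive)

lemma smooth1_half: "smooth1 f \<Longrightarrow> smooth1 (\<lambda>t. f (t / 2))"
  using smooth1_affine[of f "1/2" 0] by simp

lemma smooth1_profile_diff: "smooth1 (profile_diff m)"
  unfolding profile_diff_def[abs_def]
  by (intro smooth1_cmult smooth1_diff smooth1_half smooth1_profile_primitive)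

text \<open>The homogeneity factor \<open>2 ^ (m - 1)\<close> times \<open>(1/2) ^ m\<close> from
  the chain rule leaves 1/2, precisely the normalisation under which a dilation by 2 preserves the
  integral.\<close>

lemma higher_deriv_profile_diff:
  assumes "m \<ge> 1"
  shows "(deriv ^^ m) (profile_diff m) t = profile m t - profile m (t / 2) / 2"
proof -
  have "2 ^ (m - 1) * (1 / 2) ^ m = (1 / 2 :: real)"
    using assms by (cases m) (auto simp: power_divide)
  then have *: "2 ^ (m - 1) * ((1 / 2) ^ m * y) = (y / 2 :: real)" for y
    by (metis mult.assoc mult.commute times_divide_eq_right mult.right_neutral)
  have "(deriv ^^ m) (profile_diff m) t
    = (deriv ^^ m) (profile_primitive m) t - 2 ^ (m - 1) * (deriv ^^ m) (\<lambda>t. profile_primitive m (t / 2)) t"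
    unfolding profile_diff_def[abs_def]
    by (subst higher_deriv_diff_cmult) (auto intro: smooth1_profile_primitive smooth1_half)
  also have "(\<lambda>t. profile_primitive m (t / 2)) = (\<lambda>t. profile_primitive m ((1 / 2) * t + 0))" by simp
  also have "(deriv ^^ m) \<dots> t = (1 / 2) ^ m * profile m (t / 2)"
    by (subst higher_deriv_affine[OF smooth1_profile_primitive]) (simp add: profile_def)
  finally show ?thesis unfolding * by (simp add: profile_def)
qed

text \<open>Below 1 the primitive vanishes, and above 2 it is a polynomial of degree
  \<open>m - 1\<close>, which \<open>m\<close> derivatives annihilate.\<close>

lemma profile_eq_0:
  assumes "m \<ge> 1" "t \<notin> {1..2}"
  shows "profile m t = 0"
proof (cases "t < 1")
  case True
  have "(deriv ^^ m) (profile_primitive m) t = (deriv ^^ m) (\<lambda>t. 0) t"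
    by (rule higher_deriv_cong_open[where S = "{..<1}"]) (use True in \<open>auto simp: profile_primitive_def smooth_step_le_1\<close>)
  then show ?thesis by (simp add: profile_def higher_deriv_zero)
next
  case False
  then have t: "t > 2" using assms by auto
  obtain k where k: "m = Suc k" using assms by (cases m) auto
  \<comment> \<open>The monomial is written as a difference with 0 so that
    \<open>higher_deriv_diff_cmult\<close> can extract its coefficient.\<close>
  have "(deriv ^^ m) (profile_primitive m) t = (deriv ^^ m) (\<lambda>t. 0 - (- inverse (fact k)) * t ^ k) t"
    by (rule higher_deriv_cong_open[where S = "{2<..}"]) (use t k in \<open>auto simp: profile_primitive_def smooth_step_ge_2\<close>)
  also have "\<dots> = inverse (fact k) * (deriv ^^ m) (\<lambda>t. t ^ k) t"
    by (subst higher_deriv_diff_cmult) (auto intro: smooth1.intros smooth1_power simp: higher_deriv_zero)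
  also have "(deriv ^^ m) (\<lambda>t. t ^ k) t = deriv ((deriv ^^ k) (\<lambda>t. t ^ k)) t"
    by (simp add: k)
  also have "\<dots> = 0"
    by (subst higher_deriv_power) auto
  finally show ?thesis by (simp add: profile_def)
qed

text \<open>Beyond 4 both \<open>t\<close> and \<open>t / 2\<close> lie where the primitive is
  homogeneous of degree \<open>m - 1\<close>, and the two terms cancel. The primitive itself has no
  compact support.\<close>

lemma profile_diff_eq_0:
  assumes "t \<notin> {1..4}"
  shows "profile_diff m t = 0"
proof (cases "t < 1")
  case True
  then show ?thesis by (auto simp: profile_diff_def profile_primitive_def smooth_step_le_1)
next
  case False
  then show ?thesis using assms by (auto simp: profile_diff_def profile_primitive_def smooth_step_ge_2 power_divide)
qed

text \<open>The fundamental theorem for the derivative of order \<open>m - 1\<close> of the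
  primitive: it is 0 to the left of the transition zone and 1 to the right. The end points 0 and 3
  lie inside open sets on which the primitive is explicit.\<close>

lemma integral_profile:
  assumes "m \<ge> 1"
  shows "integrable lborel (profile m)" "(LINT t|lborel. profile m t) = 1"
proof -
  obtain k where k: "m = Suc k" using assms by (cases m) auto
  let ?G = "(deriv ^^ k) (profile_primitive m)"
  have G: "(?G has_real_derivative profile m t) (at t)" for t
    using smooth1_has_deriv[OF smooth1_higher_deriv[OF smooth1_profile_primitive], of k m t]
    by (simp add: profile_def k)
  have G0: "?G 0 = 0"
  proof -
    have "?G 0 = (deriv ^^ k) (\<lambda>t. 0) 0"
      by (rule higher_deriv_cong_open[where S = "{..<1}"]) (auto simp: profile_primitive_def smooth_step_le_1)
    then show ?thesis by (simp add: higher_deriv_zero)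
  qed
  have G3: "?G 3 = 1"
  proof -
    have "?G 3 = (deriv ^^ k) (\<lambda>t. 0 - (- inverse (fact k)) * t ^ k) 3"
      by (rule higher_deriv_cong_open[where S = "{2<..}"]) (auto simp: profile_primitive_def smooth_step_ge_2 k)
    also have "\<dots> = inverse (fact k) * (deriv ^^ k) (\<lambda>t. t ^ k) 3"
      by (subst higher_deriv_diff_cmult) (auto intro: smooth1.intros smooth1_power simp: higher_deriv_zero)
    also have "\<dots> = 1" by (subst higher_deriv_power) auto
    finally show ?thesis .
  qed
  have "has_bochner_integral lborel (\<lambda>t. profile m t * indicator {0..3} t) (?G 3 - ?G 0)"
    by (rule has_bochner_integral_FTC_Icc_real)
       (auto intro: G DERIV_subset smooth1_continuous_on smooth1_profile
          simp: continuous_on_eq_continuous_at intro!: DERIV_isCont smooth1_has_deriv)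
  moreover have "(\<lambda>t. profile m t * indicator {0..3} t) = profile m"
  proof
    fix t show "profile m t * indicator {0..3} t = profile m t"
      using profile_eq_0[OF assms, of t] by (cases "t \<in> {1..2}") (auto simp: indicator_def)
  qed
  ultimately have "has_bochner_integral lborel (profile m) 1"
    using G0 G3 by simp
  then show "integrable lborel (profile m)" "(LINT t|lborel. profile m t) = 1"
    by (auto simp: has_bochner_integral_iff)
qed

section \<open>Tensor products as test functions\<close>

definition tensor :: "('n::finite \<Rightarrow> real \<Rightarrow> real) \<Rightarrow> real ^ 'n \<Rightarrow> real" where
  "tensor f w = (\<Prod>j\<in>UNIV. f j (w $ j))"

lemma tensor_fun_upd: "tensor (f(i := g)) w = g (w $ i) * (\<Prod>j\<in>UNIV - {i}. f j (w $ j))"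
  unfolding tensor_def by (subst prod.remove[of _ i]) auto

lemma partial_deriv_tensor:
  assumes "\<And>j. smooth1 (f j)"
  shows "partial_deriv i (tensor f) = tensor (f(i := deriv (f i)))"
proof
  fix x :: "real ^ 'a"
  let ?c = "\<Prod>j\<in>UNIV - {i}. f j (x $ j)"
  have "(\<lambda>t. tensor f (x + t *\<^sub>R axis i 1)) = (\<lambda>t. f i (t + x $ i) * ?c)"
  proof
    fix t
    \<comment> \<open>Reading \<open>f\<close> as \<open>f(i := f i)\<close> lets
      \<open>tensor_fun_upd\<close> split off the factor that depends on \<open>t\<close>.\<close>
    have "tensor f (x + t *\<^sub>R axis i 1) = tensor (f(i := f i)) (x + t *\<^sub>R axis i 1)" by simp
    also have "\<dots> = f i (t + x $ i) * ?c"
      unfolding tensor_fun_upd by (auto simp: axis_def add.commute intro!: prod.cong)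
    finally show "tensor f (x + t *\<^sub>R axis i 1) = f i (t + x $ i) * ?c" .
  qed
  moreover have "((\<lambda>t. f i (t + x $ i) * ?c) has_real_derivative deriv (f i) (x $ i) * ?c) (at 0)"
    by (intro DERIV_cmult_right)
       (use smooth1_has_deriv[OF assms[of i], of "x $ i"] DERIV_shift[of "f i" _ 0 "x $ i"] in simp)
  ultimately show "partial_deriv i (tensor f) x = tensor (f(i := deriv (f i))) x"
    unfolding partial_deriv_def tensor_fun_upd by (simp add: DERIV_imp_deriv)
qed

text \<open>Each differentiation acts on one factor only, so just the number of occurrences of each
  coordinate matters and symmetry of mixed derivatives is never invoked.\<close>

lemma iter_partial_deriv_tensor:
  assumes "\<And>j. smooth1 (f j)"
  shows "iter_partial_deriv is (tensor f) = tensor (\<lambda>j. (deriv ^^ count_list is j) (f j))"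
proof (induction "is")
  case (Cons i "is")
  have "(\<lambda>j. (deriv ^^ count_list (i # is) j) (f j)) =
     (\<lambda>j. (deriv ^^ count_list is j) (f j))(i := deriv ((deriv ^^ count_list is i) (f i)))"
    by (auto simp: fun_eq_iff)
  then show ?case
    using Cons assms by (simp add: partial_deriv_tensor smooth1_higher_deriv)
qed auto

lemma differentiable_tensor:
  assumes "\<And>j. smooth1 (f j)"
  shows "tensor f differentiable (at x)"
proof -
  have "((\<lambda>w. f j (w $ j)) has_derivative (\<lambda>h. deriv (f j) (x $ j) * h $ j)) (at x)" for j
    by (rule has_derivative_compose[of "\<lambda>w. w $ j" "\<lambda>h. h $ j", OF _
          smooth1_has_deriv[OF assms, unfolded has_field_derivative_def]])
       (auto intro: bounded_linear_imp_has_derivative bounded_linear_vec_nth)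
  then have "((\<lambda>w. \<Prod>j\<in>UNIV. f j (w $ j)) has_derivative
      (\<lambda>y. \<Sum>i\<in>UNIV. (deriv (f i) (x $ i) * y $ i) * (\<Prod>j\<in>UNIV - {i}. f j (x $ j)))) (at x)"
    by (rule has_derivative_prod)
  then show ?thesis
    unfolding tensor_def[abs_def] differentiable_def by blast
qed

lemma continuous_on_tensor:
  assumes "\<And>j. smooth1 (f j)"
  shows "continuous_on S (tensor f)"
  by (meson assms differentiable_tensor differentiable_imp_continuous_within continuous_at_imp_continuous_on)

lemma borel_measurable_tensor [measurable]:
  assumes "\<And>j. smooth1 (f j)"
  shows "tensor f \<in> borel_measurable borel"
  by (intro borel_measurable_continuous_onI continuous_on_tensor assms)

lemma test_function_tensor:
  assumes "\<And>j. smooth1 (f j)" and supp: "\<And>j t. t \<notin> {a $ j..b $ j} \<Longrightarrow> f j t = 0"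
  shows "test_function (tensor f)"
proof -
  have "{x. tensor f x \<noteq> 0} \<subseteq> cbox a b"
  proof
    fix x assume "x \<in> {x. tensor f x \<noteq> 0}"
    then have "f j (x $ j) \<noteq> 0" for j by (auto simp: tensor_def)
    then have "x $ j \<in> {a $ j..b $ j}" for j using supp by blast
    then show "x \<in> cbox a b" by (auto simp: mem_box_cart)
  qed
  then have "closure {x. tensor f x \<noteq> 0} \<subseteq> cbox a b"
    by (rule closure_minimal) (rule closed_cbox)
  then have "compact (closure {x. tensor f x \<noteq> 0})"
    by (meson bounded_cbox bounded_subset closed_closure compact_eq_bounded_closed)
  then show ?thesis
    unfolding test_function_def smooth_def
    by (auto simp: iter_partial_deriv_tensor assms intro!: differentiable_tensor smooth1_higher_deriv assms)
qed

text \<open>Compactness bounds \<open>f\<close> and its derivative, which vanishes off the same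
  interval; the mean value inequality turns the second bound into a Lipschitz constant. One
  \<open>M\<close> serves for both.\<close>

lemma smooth1_compact_support_bounds:
  assumes f: "smooth1 f" and supp: "\<And>t. t \<notin> {a..b} \<Longrightarrow> f t = 0"
  shows "\<exists>M\<ge>1. (\<forall>t. \<bar>f t\<bar> \<le> M) \<and> (\<forall>s t. \<bar>f s - f t\<bar> \<le> M * \<bar>s - t\<bar>)"
proof -
  have bd: "\<exists>M\<ge>0. \<forall>t. \<bar>h t\<bar> \<le> M"
    if "smooth1 h" "\<And>t. t \<notin> {a..b} \<Longrightarrow> h t = 0" for h
  proof -
    have "bounded (h ` {a..b})"
      by (intro compact_imp_bounded compact_continuous_image smooth1_continuous_on that) auto
    then obtain M where "\<And>t. t \<in> {a..b} \<Longrightarrow> \<bar>h t\<bar> \<le> M"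
      by (force simp: bounded_iff)
    then have "\<forall>t. \<bar>h t\<bar> \<le> max M 0"
      using that(2) by (metis abs_zero max.cobounded2 max.coboundedI1)
    then show ?thesis by (intro exI[of _ "max M 0"]) auto
  qed
  have "deriv f t = 0" if "t \<notin> {a..b}" for t
  proof -
    have "deriv f t = deriv (\<lambda>t. 0) t"
      using higher_deriv_cong_open[of "- {a..b}" f "\<lambda>t. 0" t 1] that supp
      by (auto simp: open_Compl)
    then show ?thesis by simp
  qed
  with bd[OF f supp] bd[OF smooth1_deriv[OF f]]
  obtain M1 M2 where M: "M1 \<ge> 0" "\<And>t. \<bar>f t\<bar> \<le> M1" "M2 \<ge> 0" "\<And>t. \<bar>deriv f t\<bar> \<le> M2"
    by metis
  have "\<bar>f s - f t\<bar> \<le> M2 * \<bar>s - t\<bar>" for s t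
    using field_differentiable_bound[of UNIV f "deriv f" M2 s t] smooth1_has_deriv[OF f] M(4)
    by auto
  then have "\<bar>f s - f t\<bar> \<le> (1 + M1 + M2) * \<bar>s - t\<bar>" for s t
    by (rule order_trans) (use M in \<open>auto intro!: mult_right_mono\<close>)
  moreover have "\<bar>f t\<bar> \<le> 1 + M1 + M2" for t
    using M(2)[of t] M(3) by linarith
  ultimately show ?thesis using M by (intro exI[of _ "1 + M1 + M2"]) auto
qed

text \<open>Size and Lipschitz constant share one bound. The radius comes from the supports of the
  factors: a point with all coordinates in \<open>[1, 4]\<close> has l1-norm, hence Euclidean norm,
  at most \<open>4 * CARD('n)\<close>.\<close>

definition bounded_kernel :: "real \<Rightarrow> (real ^ 'n::finite \<Rightarrow> real) \<Rightarrow> bool" where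
  "bounded_kernel M K \<longleftrightarrow> K \<in> borel_measurable borel \<and> (\<forall>w. \<bar>K w\<bar> \<le> M) \<and>
     (\<forall>w w'. \<bar>K w - K w'\<bar> \<le> M * norm (w - w')) \<and> (\<forall>w. norm w > 4 * real CARD('n) \<longrightarrow> K w = 0)"

lemma bounded_kernel_tensor:
  fixes f :: "'n::finite \<Rightarrow> real \<Rightarrow> real"
  assumes smooth: "\<And>j. smooth1 (f j)" and supp: "\<And>j t. t \<notin> {1..4} \<Longrightarrow> f j t = 0"
    and M: "M \<ge> 1" "\<And>j t. \<bar>f j t\<bar> \<le> M" "\<And>j s t. \<bar>f j s - f j t\<bar> \<le> M * \<bar>s - t\<bar>"
  shows "bounded_kernel (real CARD('n) * M ^ CARD('n)) (tensor f)"
  unfolding bounded_kernel_def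
proof (intro conjI allI impI)
  let ?N = "CARD('n)"
  have N: "real ?N \<ge> 1" by (simp add: Suc_leI)
  have pos: "M ^ ?N \<ge> 0" using M by simp
  show "tensor f \<in> borel_measurable borel" using smooth by measurable
  fix w
  have "\<bar>tensor f w\<bar> \<le> (\<Prod>j\<in>(UNIV::'n set). M)"
    unfolding tensor_def abs_prod by (intro prod_mono) (auto simp: M)
  then have "\<bar>tensor f w\<bar> \<le> 1 * M ^ ?N" by simp
  also have "\<dots> \<le> real ?N * M ^ ?N" using N pos by (intro mult_right_mono) auto
  finally show "\<bar>tensor f w\<bar> \<le> real ?N * M ^ ?N" .
  show "\<bar>tensor f w - tensor f w'\<bar> \<le> real ?N * M ^ ?N * norm (w - w')" for w'
  proof -
    \<comment> \<open>Division by \<open>M\<close> makes all factors bounded by 1, as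
      \<open>norm_prod_diff\<close> requires, and at the same time Lipschitz with constant
      1.\<close>
    have eq: "tensor f x = M ^ ?N * (\<Prod>j\<in>UNIV. f j (x $ j) / M)" for x
      using M(1) by (simp add: tensor_def prod_dividef)
    have "norm ((\<Prod>j\<in>UNIV. f j (w $ j) / M) - (\<Prod>j\<in>UNIV. f j (w' $ j) / M))
       \<le> (\<Sum>j\<in>UNIV. norm (f j (w $ j) / M - f j (w' $ j) / M))"
      using M(1,2) by (intro norm_prod_diff) auto
    also have "\<dots> \<le> (\<Sum>j\<in>(UNIV::'n set). norm (w - w'))"
    proof (intro sum_mono)
      fix j
      have "norm (f j (w $ j) / M - f j (w' $ j) / M) = \<bar>f j (w $ j) - f j (w' $ j)\<bar> / M"
        using M(1) by (simp add: diff_divide_distrib[symmetric])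
      also have "\<dots> \<le> \<bar>w $ j - w' $ j\<bar>"
        using M(3)[of j "w $ j" "w' $ j"] M(1) by (simp add: divide_le_eq mult.commute)
      also have "\<dots> \<le> norm (w - w')" using component_le_norm_cart[of "w - w'" j] by simp
      finally show "norm (f j (w $ j) / M - f j (w' $ j) / M) \<le> norm (w - w')" .
    qed
    finally have "M ^ ?N * norm ((\<Prod>j\<in>UNIV. f j (w $ j) / M) - (\<Prod>j\<in>UNIV. f j (w' $ j) / M))
        \<le> M ^ ?N * (real ?N * norm (w - w'))"
      using pos by (intro mult_left_mono) auto
    then show ?thesis
      unfolding eq right_diff_distrib[symmetric] abs_mult using pos by (simp add: mult_ac)
  qed
  assume w: "norm w > 4 * real ?N"
  have "\<exists>j. w $ j \<notin> {1..4}"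
  proof (rule ccontr)
    assume "\<not> ?thesis"
    then have "\<And>j. w $ j \<in> {1..4}" by blast
    then have "(\<Sum>j\<in>UNIV. \<bar>w $ j\<bar>) \<le> (\<Sum>j\<in>(UNIV::'n set). 4)"
      by (intro sum_mono) (metis abs_of_nonneg atLeastAtMost_iff order_trans zero_le_one)
    then show False using norm_le_l1_cart[of w] w by simp
  qed
  then show "tensor f w = 0"
    using supp by (auto simp: tensor_def)
qed

text \<open>The mass-preserving dilation of \<open>profile m\<close>, supported in
  \<open>[2, 4]\<close>.\<close>

definition profile2 :: "nat \<Rightarrow> real \<Rightarrow> real" where
  "profile2 m t = profile m (t / 2) / 2"

lemma smooth1_profile2: "smooth1 (profile2 m)"
  using smooth1_cmult[OF smooth1_half[OF smooth1_profile], of "1/2" m]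
  by (simp add: profile2_def[abs_def])

text \<open>Only three one-variable functions occur as factors, so the largest of their three
  constants serves every tensor product met when coordinates are dilated one by one.\<close>

lemma exists_kernel_bound:
  assumes m: "m \<ge> 1"
  shows "\<exists>M>0. \<forall>f :: 'n::finite \<Rightarrow> _. (\<forall>j. f j \<in> {profile m, profile2 m, profile_diff m}) \<longrightarrow>
     bounded_kernel M (tensor f)"
proof -
  let ?P = "{profile m, profile2 m, profile_diff m}"
  have sm: "smooth1 g" if "g \<in> ?P" for g
    using that smooth1_profile smooth1_profile2 smooth1_profile_diff by auto
  have su: "g t = 0" if "g \<in> ?P" "t \<notin> {1..4}" for g t
    using that profile_eq_0[OF m, of t] profile_eq_0[OF m, of "t / 2"] profile_diff_eq_0[of t m]
    by (auto simp: profile2_def)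
  have "\<exists>M\<ge>1. (\<forall>t. \<bar>g t\<bar> \<le> M) \<and> (\<forall>s t. \<bar>g s - g t\<bar> \<le> M * \<bar>s - t\<bar>)" if "g \<in> ?P" for g
    using smooth1_compact_support_bounds[OF sm[OF that], of 1 4] su[OF that] by blast
  then obtain M where M: "\<And>g. g \<in> ?P \<Longrightarrow> M g \<ge> (1::real)"
     "\<And>g t. g \<in> ?P \<Longrightarrow> \<bar>g t\<bar> \<le> M g" "\<And>g s t. g \<in> ?P \<Longrightarrow> \<bar>g s - g t\<bar> \<le> M g * \<bar>s - t\<bar>"
    by metis
  define M0 where "M0 = Max (M ` ?P)"
  have M0: "M g \<le> M0" if "g \<in> ?P" for g
    unfolding M0_def using that by (intro Max_ge) auto
  have "M0 \<ge> 1" using M0[of "profile m"] M(1)[of "profile m"] by simp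
  moreover have "\<bar>g t\<bar> \<le> M0" if "g \<in> ?P" for g t
    using M(2)[OF that] M0[OF that] by (meson order_trans)
  moreover have "\<bar>g s - g t\<bar> \<le> M0 * \<bar>s - t\<bar>" if "g \<in> ?P" for g s t
    using M(3)[OF that, of s t] mult_right_mono[OF M0[OF that], of "\<bar>s - t\<bar>"] by linarith
  ultimately have "bounded_kernel (real CARD('n) * M0 ^ CARD('n)) (tensor f)"
    if "\<forall>j. f j \<in> ?P" for f :: "'n \<Rightarrow> _"
    using that sm su by (intro bounded_kernel_tensor) blast+
  moreover have "real CARD('n) * M0 ^ CARD('n) > 0" using \<open>M0 \<ge> 1\<close> by simp
  ultimately show ?thesis by blast
qed

section \<open>Integrals of tensor products\<close>

lemma prod_Basis_vec: "(\<Prod>b\<in>(Basis :: (real ^ 'n) set). g b) = (\<Prod>j\<in>UNIV. g (axis j 1))"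
proof -
  have *: "(Basis :: (real ^ 'n) set) = (\<lambda>j. axis j 1) ` UNIV" by (auto simp: Basis_vec_def)
  show ?thesis unfolding * by (subst prod.reindex) (auto simp: inj_on_def axis_eq_axis)
qed

lemma integral_tensor:
  fixes f :: "'n::finite \<Rightarrow> real \<Rightarrow> real"
  assumes int: "\<And>j. integrable lborel (f j)"
  shows "integrable lborel (tensor f)" "(LINT w|lborel. tensor f w) = (\<Prod>j\<in>UNIV. LINT t|lborel. f j t)"
proof -
  let ?I = "interval_measure (\<lambda>x. x)"
  have lb: "lborel = distr (Pi\<^sub>M Basis (\<lambda>_::real^'n. ?I)) borel (\<lambda>x. \<Sum>b\<in>Basis. x b *\<^sub>R b)"
    by (simp add: lborel_def)
  interpret sigma_finite_measure ?I
    by (metis lborel_eq_real lborel.sigma_finite_measure_axioms)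
  interpret product_sigma_finite "\<lambda>_::real^'n. ?I" ..
  \<comment> \<open>The product measure behind \<open>lborel\<close> is indexed by basis vectors
    instead of coordinates; \<open>g\<close> transports the family of factors along
    \<open>axis j 1\<close>.\<close>
  define g where "g b = f (THE j. b = axis j (1::real))" for b :: "real ^ 'n"
  have g: "g (axis j 1) = f j" for j
    unfolding g_def by (rule arg_cong[of _ _ f]) (auto simp: axis_eq_axis)
  have gi: "integrable lborel (g b)" if "b \<in> Basis" for b
    using that int by (auto simp: Basis_vec_def g)
  have te: "tensor f w = (\<Prod>b\<in>Basis. g b (w \<bullet> b))" for w
    unfolding prod_Basis_vec tensor_def g by (simp add: inner_axis)
  have [measurable]: "g b \<in> borel_measurable borel" if "b \<in> Basis" for b
    using gi[OF that] by auto
  have me: "tensor f \<in> borel_measurable borel"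
    unfolding te[abs_def] by measurable
  have sub: "tensor f (\<Sum>b\<in>Basis. x b *\<^sub>R b) = (\<Prod>b\<in>Basis. g b (x b))" for x
    unfolding te by (intro prod.cong) (auto simp: inner_sum_left inner_Basis if_distrib cong: if_cong)
  have gi': "integrable ?I (g b)" if "b \<in> Basis" for b
    using gi[OF that] by (simp add: lborel_eq_real)
  have "integrable (Pi\<^sub>M Basis (\<lambda>_. ?I)) (\<lambda>x. \<Prod>b\<in>Basis. g b (x b))"
    by (intro product_integrable_prod gi') auto
  then show "integrable lborel (tensor f)"
    unfolding lb using me by (subst integrable_distr_eq) (auto simp: sub)
  have "(LINT w|lborel. tensor f w) = integral\<^sup>L (Pi\<^sub>M Basis (\<lambda>_. ?I)) (\<lambda>x. \<Prod>b\<in>Basis. g b (x b))"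
    unfolding lb using me by (subst integral_distr) (auto simp: sub)
  also have "\<dots> = (\<Prod>b\<in>Basis. integral\<^sup>L ?I (g b))"
    by (intro product_integral_prod gi') auto
  also have "\<dots> = (\<Prod>b\<in>Basis. LINT t|lborel. g b t)"
    by (simp add: lborel_eq_real)
  also have "\<dots> = (\<Prod>j\<in>UNIV. LINT t|lborel. f j t)"
    unfolding prod_Basis_vec g ..
  finally show "(LINT w|lborel. tensor f w) = (\<Prod>j\<in>UNIV. LINT t|lborel. f j t)" .
qed

section \<open>The Hardy-Littlewood maximal theorem\<close>

text \<open>Only countably many radii, so that measurability is immediate; the averages are not normalised by the volume of the unit ball.\<close>

definition maxfun :: "('a::euclidean_space \<Rightarrow> real) \<Rightarrow> 'a \<Rightarrow> ennreal" where
  "maxfun f x = (SUP k::int. ennreal ((2 powr - real_of_int k) ^ DIM('a)) *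
      (\<integral>\<^sup>+y. ennreal \<bar>f y\<bar> * indicator (cball x (2 powr real_of_int k)) y \<partial>lborel))"

lemma cball_in_sets_borel [measurable]: "cball (x :: 'a::metric_space) r \<in> sets borel"
  by (intro borel_closed closed_cball)

text \<open>Expressing the indicator of the ball through \<open>dist x y\<close> makes the integrand
  jointly measurable in centre and integration variable.\<close>

lemma borel_measurable_ball_integral [measurable]:
  fixes f :: "'a::euclidean_space \<Rightarrow> ennreal"
  assumes [measurable]: "f \<in> borel_measurable borel"
  shows "(\<lambda>x. \<integral>\<^sup>+y. f y * indicator (cball x R) y \<partial>lborel) \<in> borel_measurable borel"
proof -
  have "(\<lambda>x. \<integral>\<^sup>+y. f y * indicator {0..R} (dist x y) \<partial>lborel) \<in> borel_measurable borel"
    by measurable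
  moreover have "(\<lambda>y. f y * indicator {0..R} (dist x y)) = (\<lambda>y. f y * indicator (cball x R) y)" for x
    by (auto simp: indicator_def fun_eq_iff)
  ultimately show ?thesis by (simp only:)
qed

lemma borel_measurable_maxfun [measurable]:
  assumes [measurable]: "f \<in> borel_measurable borel"
  shows "maxfun f \<in> borel_measurable borel"
  unfolding maxfun_def[abs_def] by measurable

text \<open>Rounding the radius up to a power of two at most doubles it, which explains the factor 2
  inside the power.\<close>

lemma ball_integral_le_maxfun:
  fixes f :: "'a::euclidean_space \<Rightarrow> real"
  assumes "R > 0"
  shows "(\<integral>\<^sup>+y. ennreal \<bar>f y\<bar> * indicator (cball x R) y \<partial>lborel)
    \<le> ennreal ((2 * R) ^ DIM('a)) * maxfun f x"
proof -
  define k where "k = \<lceil>log 2 R\<rceil>"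
  let ?r = "2 powr real_of_int k"
  have r: "R \<le> ?r" "?r \<le> 2 * R"
  proof -
    have "log 2 R \<le> k" unfolding k_def by simp
    then show "R \<le> ?r" using assms by (simp add: log_le_iff)
    have "k \<le> log 2 R + 1" unfolding k_def by linarith
    then have "?r \<le> 2 powr (log 2 R + 1)" by simp
    also have "\<dots> = 2 * R" using assms by (simp add: powr_add)
    finally show "?r \<le> 2 * R" .
  qed
  let ?I = "\<integral>\<^sup>+y. ennreal \<bar>f y\<bar> * indicator (cball x ?r) y \<partial>lborel"
  have "(\<integral>\<^sup>+y. ennreal \<bar>f y\<bar> * indicator (cball x R) y \<partial>lborel) \<le> ?I"
    using r(1) by (intro nn_integral_mono mult_left_mono) (auto simp: indicator_def)
  also have "\<dots> = ennreal (?r ^ DIM('a)) * (ennreal ((2 powr - real_of_int k) ^ DIM('a)) * ?I)"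
    by (simp add: mult.assoc[symmetric] ennreal_mult[symmetric] power_mult_distrib[symmetric] powr_minus)
  also have "\<dots> \<le> ennreal ((2 * R) ^ DIM('a)) * maxfun f x"
    unfolding maxfun_def using r(2)
    by (intro mult_mono SUP_upper ennreal_leI power_mono) auto
  finally show ?thesis .
qed

text \<open>Vitali covering: a countable disjoint subfamily of the balls, enlarged five times, still
  covers \<open>S\<close>, while disjointness bounds the sum of the integrals of \<open>h\<close>
  over the subfamily by its total integral. A general \<open>h\<close> is allowed because the lemma
  is applied to a truncated function.\<close>

lemma weak_type_ball_cover:
  fixes h :: "'a::euclidean_space \<Rightarrow> ennreal"
  assumes [measurable]: "h \<in> borel_measurable borel" and "\<mu> > 0" and S: "S \<in> sets borel"
    and cov: "\<And>x. x \<in> S \<Longrightarrow>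
      \<exists>r>0. ennreal (\<mu> * r ^ DIM('a)) < (\<integral>\<^sup>+y. h y * indicator (cball x r) y \<partial>lborel)"
  shows "emeasure lborel S \<le> ennreal (5 ^ DIM('a) * unit_ball_vol (real DIM('a)) / \<mu>) * (\<integral>\<^sup>+y. h y \<partial>lborel)"
proof (cases "(\<integral>\<^sup>+y. h y \<partial>lborel) = \<infinity>")
  case True
  have "5 ^ DIM('a) * unit_ball_vol (real DIM('a)) / \<mu> > 0"
    using assms(2) unit_ball_vol_pos[of "real DIM('a)"] by simp
  then have "ennreal (5 ^ DIM('a) * unit_ball_vol (real DIM('a)) / \<mu>) \<noteq> 0"
    by (simp only: ennreal_eq_0_iff not_le)
  then show ?thesis using True by (simp only: ennreal_mult_top infinity_ennreal_def if_False top_greatest)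
next
  case False
  let ?N = "DIM('a)" and ?w = "unit_ball_vol (real DIM('a))"
  have w: "?w > 0" by simp
  define I where "I = enn2real (\<integral>\<^sup>+y. h y \<partial>lborel)"
  have I: "(\<integral>\<^sup>+y. h y \<partial>lborel) = ennreal I" "I \<ge> 0"
    using False by (auto simp: I_def less_top)
  from cov obtain r where r: "\<And>x. x \<in> S \<Longrightarrow> r x > 0"
    "\<And>x. x \<in> S \<Longrightarrow> ennreal (\<mu> * r x ^ ?N) < (\<integral>\<^sup>+y. h y * indicator (cball x (r x)) y \<partial>lborel)"
    by metis
  \<comment> \<open>Vitali's lemma requires bounded radii. The total integral \<open>I\<close>
    bounds \<open>r ^ N\<close> by \<open>I / \<mu>\<close>, and a radius above 1 is at most its
    N-th power.\<close>
  have rI: "r x \<le> 1 + I / \<mu>" if "x \<in> S" for x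
  proof -
    have "ennreal (\<mu> * r x ^ ?N) \<le> (\<integral>\<^sup>+y. h y * indicator (cball x (r x)) y \<partial>lborel)"
      using r(2)[OF that] by simp
    also have "\<dots> \<le> (\<integral>\<^sup>+y. h y \<partial>lborel)"
      by (intro nn_integral_mono) (auto simp: indicator_def)
    finally have "\<mu> * r x ^ ?N \<le> I" using I by simp
    then have le: "r x ^ ?N \<le> I / \<mu>" using \<open>\<mu> > 0\<close> by (simp add: field_simps)
    show ?thesis
    proof (cases "r x \<le> 1")
      case True
      then show ?thesis using I \<open>\<mu> > 0\<close> by (simp add: add_increasing2)
    next
      case False
      then have "r x \<le> r x ^ ?N" by (intro self_le_power) auto
      then show ?thesis using le by linarith
    qed
  qed
  have cover: "S \<subseteq> (\<Union>x\<in>S. cball x (r x))"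
  proof
    fix x assume "x \<in> S"
    then have "x \<in> cball x (r x)" using r(1)[of x] by simp
    then show "x \<in> (\<Union>x\<in>S. cball x (r x))" using \<open>x \<in> S\<close> by blast
  qed
  have "0 < r x \<and> r x \<le> 1 + I / \<mu>" if "x \<in> S" for x
    using r(1) rI that by blast
  from Vitali_covering_lemma_cballs[where a = "\<lambda>x. x" and r = r, OF cover this] obtain C where C: "countable C" "C \<subseteq> S"
     "pairwise (\<lambda>i j. disjnt (cball i (r i)) (cball j (r j))) C"
     "S \<subseteq> (\<Union>i\<in>C. cball i (5 * r i))"
    by blast
  let ?c = "ennreal (5 ^ ?N * ?w / \<mu>)"
  have "emeasure lborel S = (\<integral>\<^sup>+x. indicator S x \<partial>lborel)" using S by simp
  also have "\<dots> \<le> (\<integral>\<^sup>+x. (\<integral>\<^sup>+i. indicator (cball i (5 * r i)) x \<partial>count_space C) \<partial>lborel)"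
  proof (intro nn_integral_mono)
    fix x
    show "indicator S x \<le> (\<integral>\<^sup>+i. indicator (cball i (5 * r i)) x \<partial>count_space C)"
    proof (cases "x \<in> S")
      case True
      then obtain i where i: "i \<in> C" "x \<in> cball i (5 * r i)" using C(4) by blast
      then have "(1::ennreal) = indicator (cball i (5 * r i)) x" by simp
      also have "\<dots> \<le> (\<integral>\<^sup>+i. indicator (cball i (5 * r i)) x \<partial>count_space C)"
        by (rule nn_integral_ge_point) (use i in simp)
      finally show ?thesis using True by simp
    qed auto
  qed
  also have "\<dots> = (\<integral>\<^sup>+i. (\<integral>\<^sup>+x. indicator (cball i (5 * r i)) x \<partial>lborel) \<partial>count_space C)"
    using C(1) by (intro nn_integral_count_space_nn_integral) (simp_all add: borel_measurable_indicator)
  also have "\<dots> \<le> (\<integral>\<^sup>+i. ?c * emeasure (density lborel h) (cball i (r i)) \<partial>count_space C)"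
  proof (intro nn_integral_mono)
    fix i assume "i \<in> space (count_space C)"
    then have i: "i \<in> S" using C(2) by auto
    have "(\<integral>\<^sup>+x. indicator (cball i (5 * r i)) x \<partial>lborel) = ennreal (?w * (5 * r i) ^ ?N)"
      using r(1)[OF i] by (simp add: emeasure_cball)
    also have "\<dots> = ?c * ennreal (\<mu> * r i ^ ?N)"
      using \<open>\<mu> > 0\<close> r(1)[OF i] w
      by (simp add: ennreal_mult[symmetric] power_mult_distrib less_imp_le)
    also have "\<dots> \<le> ?c * (\<integral>\<^sup>+y. h y * indicator (cball i (r i)) y \<partial>lborel)"
      using r(2)[OF i] by (intro mult_left_mono) auto
    finally show "(\<integral>\<^sup>+x. indicator (cball i (5 * r i)) x \<partial>lborel) \<le> ?c * emeasure (density lborel h) (cball i (r i))"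
      by (simp add: emeasure_density)
  qed
  also have "\<dots> = ?c * (\<integral>\<^sup>+i. emeasure (density lborel h) (cball i (r i)) \<partial>count_space C)"
    by (rule nn_integral_cmult) auto
  also have "(\<integral>\<^sup>+i. emeasure (density lborel h) (cball i (r i)) \<partial>count_space C)
      = emeasure (density lborel h) (\<Union>i\<in>C. cball i (r i))"
    using C(1,3) by (intro emeasure_UN_countable[symmetric])
      (auto simp: disjoint_family_on_def pairwise_def disjnt_def)
  also have "\<dots> \<le> emeasure (density lborel h) UNIV"
    using C(1) by (intro emeasure_mono) auto
  also have "\<dots> = (\<integral>\<^sup>+y. h y \<partial>lborel)" by (simp add: emeasure_density)
  finally show ?thesis by (simp add: mult_left_mono)
qed

text \<open>Values with \<open>2 * w * \<bar>f y\<bar> \<le> l\<close> contribute at most half of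
  \<open>l * r ^ N\<close> to a ball of radius \<open>r\<close>, because its volume is
  \<open>w * r ^ N\<close>. The large values must supply the other half, so only they remain on the
  right; the interpolation in the strong-type bound relies on this truncation.\<close>

lemma weak_type_maxfun:
  fixes f :: "'a::euclidean_space \<Rightarrow> real"
  assumes [measurable]: "f \<in> borel_measurable borel" and l: "l > 0"
  defines "w \<equiv> unit_ball_vol (real DIM('a))"
  shows "emeasure lborel {x. maxfun f x > ennreal l}
    \<le> ennreal (2 * 5 ^ DIM('a) * w / l) * (\<integral>\<^sup>+y. ennreal \<bar>f y\<bar> * indicator {l<..} (2 * w * \<bar>f y\<bar>) \<partial>lborel)"
proof -
  let ?N = "DIM('a)"
  have w: "w > 0" by (simp add: w_def)
  let ?h = "\<lambda>y. ennreal \<bar>f y\<bar> * indicator {l<..} (2 * w * \<bar>f y\<bar>)"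
  have "emeasure lborel {x. maxfun f x > ennreal l} \<le> ennreal (5 ^ ?N * w / (l / 2)) * (\<integral>\<^sup>+y. ?h y \<partial>lborel)"
    unfolding w_def
  proof (rule weak_type_ball_cover)
    show "{x. maxfun f x > ennreal l} \<in> sets borel" by measurable
    fix x assume "x \<in> {x. maxfun f x > ennreal l}"
    then obtain k where k: "ennreal l < ennreal ((2 powr - real_of_int k) ^ ?N) *
      (\<integral>\<^sup>+y. ennreal \<bar>f y\<bar> * indicator (cball x (2 powr real_of_int k)) y \<partial>lborel)"
      by (auto simp: maxfun_def less_SUP_iff)
    define r where "r = 2 powr real_of_int k"
    have r: "r > 0" by (simp add: r_def)
    have k': "ennreal l < ennreal (inverse r ^ ?N) * (\<integral>\<^sup>+y. ennreal \<bar>f y\<bar> * indicator (cball x r) y \<partial>lborel)"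
      using k by (simp add: r_def powr_minus)
    have "ennreal (l * r ^ ?N) < (\<integral>\<^sup>+y. ennreal \<bar>f y\<bar> * indicator (cball x r) y \<partial>lborel)" (is "_ < ?X")
    proof (rule ccontr)
      assume "\<not> ?thesis"
      then have "ennreal (inverse r ^ ?N) * ?X \<le> ennreal (inverse r ^ ?N) * ennreal (l * r ^ ?N)"
        by (intro mult_left_mono) auto
      also have "\<dots> = ennreal l"
        using r l by (simp add: ennreal_mult[symmetric] power_inverse)
      finally show False using k' by simp
    qed
    also have "?X \<le> (\<integral>\<^sup>+y. ?h y * indicator (cball x r) y + ennreal (l / (2 * w)) * indicator (cball x r) y \<partial>lborel)"
      using w l by (intro nn_integral_mono) (auto simp: indicator_def field_simps ennreal_leI)
    also have "\<dots> = (\<integral>\<^sup>+y. ?h y * indicator (cball x r) y \<partial>lborel) + ennreal (l / (2 * w)) * emeasure lborel (cball x r)"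
      by (subst nn_integral_add) (measurable, measurable, simp add: nn_integral_cmult_indicator)
    also have "ennreal (l / (2 * w)) * emeasure lborel (cball x r) = ennreal (l / 2 * r ^ ?N)"
      using r w l by (simp add: emeasure_cball w_def[symmetric] ennreal_mult[symmetric] less_imp_le)
    finally have 1: "ennreal (l * r ^ ?N) < (\<integral>\<^sup>+y. ?h y * indicator (cball x r) y \<partial>lborel) + ennreal (l / 2 * r ^ ?N)" .
    have "ennreal (l / 2 * r ^ ?N) < (\<integral>\<^sup>+y. ?h y * indicator (cball x r) y \<partial>lborel)"
    proof (rule ccontr)
      assume "\<not> ?thesis"
      then have "(\<integral>\<^sup>+y. ?h y * indicator (cball x r) y \<partial>lborel) + ennreal (l / 2 * r ^ ?N)
         \<le> ennreal (l / 2 * r ^ ?N) + ennreal (l / 2 * r ^ ?N)"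
        by (intro add_mono) auto
      also have "\<dots> = ennreal (l * r ^ ?N)" using l r by (simp add: ennreal_plus[symmetric] del: ennreal_plus)
      finally show False using 1 by simp
    qed
    then show "\<exists>r>0. ennreal (l / 2 * r ^ ?N) < (\<integral>\<^sup>+y. ennreal \<bar>f y\<bar> *
          indicator {l<..} (2 * unit_ball_vol (real ?N) * \<bar>f y\<bar>) * indicator (cball x r) y \<partial>lborel)"
      using r unfolding w_def by blast
  qed (use l in auto)
  then show ?thesis using l by (simp add: mult_ac)
qed

lemma nn_integral_powr_Ioo:
  assumes "a > -1" "c \<ge> 0"
  shows "(\<integral>\<^sup>+t. ennreal (t powr a) * indicator {0<..<c} t \<partial>lborel) = ennreal (c powr (a + 1) / (a + 1))"
proof -
  have "((\<lambda>x. x powr a) has_integral (c powr (a + 1) / (a + 1))) {0..c}"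
    by (rule has_integral_powr_from_0) (use assms in auto)
  then have "((\<lambda>x. x powr a) has_integral (c powr (a + 1) / (a + 1))) {0<..<c}"
    by (simp add: has_integral_Icc_iff_Ioo)
  from nn_integral_has_integral_lebesgue[OF _ this]
  show ?thesis by (simp add: ennreal_mult'' mult.commute ennreal_indicator)
qed

text \<open>Marcinkiewicz interpolation by hand: a layer-cake integral over levels \<open>l\<close>,
  the truncated weak-type bound at each level, and Fubini to integrate over \<open>l\<close> before
  \<open>x\<close>. Since \<open>enn2real\<close> sends infinity to 0, nothing is claimed about
  points where the maximal function is infinite; \<open>maxfun_finite_AE\<close> deals with
  those.\<close>

theorem maxfun_strong_type:
  fixes f :: "'a::euclidean_space \<Rightarrow> real"
  assumes [measurable]: "f \<in> borel_measurable borel" and q: "q > 1"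
  defines "w \<equiv> unit_ball_vol (real DIM('a))"
  shows "(\<integral>\<^sup>+x. ennreal (enn2real (maxfun f x) powr q) \<partial>lborel)
     \<le> ennreal (2 * 5 ^ DIM('a) * w * q * (2 * w) powr (q - 1) / (q - 1)) * (\<integral>\<^sup>+x. ennreal (\<bar>f x\<bar> powr q) \<partial>lborel)"
proof -
  let ?g = "\<lambda>x. enn2real (maxfun f x)"
  let ?A = "2 * 5 ^ DIM('a) * w"
  have w: "w > 0" by (simp add: w_def)
  have "(\<integral>\<^sup>+x. ennreal (?g x powr q) \<partial>lborel)
      = (\<integral>\<^sup>+x. (\<integral>\<^sup>+l. ennreal q * (ennreal (l powr (q - 1)) * indicator {0<..<?g x} l) \<partial>lborel) \<partial>lborel)"
    using q by (subst nn_integral_cmult) (auto simp: nn_integral_powr_Ioo ennreal_mult[symmetric])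
  \<comment> \<open>The condition linking \<open>l\<close> and \<open>x\<close> is turned into a
    fixed half-line applied to a difference, which makes joint measurability for Fubini
    immediate.\<close>
  also have "\<dots> = (\<integral>\<^sup>+x. (\<integral>\<^sup>+l. ennreal q * (ennreal (l powr (q - 1)) *
       (indicator {0<..} l * indicator {0<..} (?g x - l))) \<partial>lborel) \<partial>lborel)"
    by (intro nn_integral_cong) (auto simp: indicator_def)
  also have "\<dots> = (\<integral>\<^sup>+l. (\<integral>\<^sup>+x. ennreal q * (ennreal (l powr (q - 1)) *
       (indicator {0<..} l * indicator {0<..} (?g x - l))) \<partial>lborel) \<partial>lborel)"
    by (rule lborel_pair.Fubini') measurable
  also have "\<dots> \<le> (\<integral>\<^sup>+l. (\<integral>\<^sup>+x. ennreal (?A * q) * (ennreal \<bar>f x\<bar> *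
        (ennreal (l powr (q - 2)) * (indicator {0<..} l * indicator {l<..} (2 * w * \<bar>f x\<bar>)))) \<partial>lborel) \<partial>lborel)"
  proof (rule nn_integral_mono)
    fix l :: real
    show "(\<integral>\<^sup>+x. ennreal q * (ennreal (l powr (q - 1)) *
       (indicator {0<..} l * indicator {0<..} (?g x - l))) \<partial>lborel) \<le>
       (\<integral>\<^sup>+x. ennreal (?A * q) * (ennreal \<bar>f x\<bar> *
        (ennreal (l powr (q - 2)) * (indicator {0<..} l * indicator {l<..} (2 * w * \<bar>f x\<bar>)))) \<partial>lborel)"
    proof (cases "l > 0")
      case False
      then show ?thesis by simp
    next
      case l: True
      have "(\<integral>\<^sup>+x. ennreal q * (ennreal (l powr (q - 1)) *
         (indicator {0<..} l * indicator {0<..} (?g x - l))) \<partial>lborel)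
        = (\<integral>\<^sup>+x. ennreal (q * l powr (q - 1)) * indicator {x. ?g x > l} x \<partial>lborel)"
        using l q by (intro nn_integral_cong) (auto simp: indicator_def ennreal_mult)
      also have "\<dots> = ennreal (q * l powr (q - 1)) * emeasure lborel {x. ?g x > l}"
        by (rule nn_integral_cmult_indicator) measurable
      also have "\<dots> \<le> ennreal (q * l powr (q - 1)) * emeasure lborel {x. maxfun f x > ennreal l}"
      proof (intro mult_left_mono emeasure_mono subsetI)
        fix x assume "x \<in> {x. ?g x > l}"
        then have "ennreal l < ennreal (?g x)" using l by (simp add: ennreal_lessI)
        also have "\<dots> \<le> maxfun f x" by (simp add: ennreal_enn2real_if)
        finally show "x \<in> {x. maxfun f x > ennreal l}" by simp
      qed auto
      also have "\<dots> \<le> ennreal (q * l powr (q - 1)) * (ennreal (?A / l) *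
         (\<integral>\<^sup>+y. ennreal \<bar>f y\<bar> * indicator {l<..} (2 * w * \<bar>f y\<bar>) \<partial>lborel))"
        unfolding w_def by (intro mult_left_mono weak_type_maxfun l) auto
      also have "\<dots> = ennreal (?A * q * l powr (q - 2)) *
         (\<integral>\<^sup>+y. ennreal \<bar>f y\<bar> * indicator {l<..} (2 * w * \<bar>f y\<bar>) \<partial>lborel)"
      proof -
        have "l powr (q - 1) = l powr (q - 2) * l"
          using l powr_add[of l "q - 2" 1] by simp
        then have "ennreal (q * l powr (q - 1)) * ennreal (?A / l) = ennreal (?A * q * l powr (q - 2))"
          using l q w by (simp add: ennreal_mult[symmetric] mult_ac)
        then show ?thesis by (simp add: mult.assoc[symmetric])
      qed
      also have "\<dots> = (\<integral>\<^sup>+x. ennreal (?A * q * l powr (q - 2)) *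
          (ennreal \<bar>f x\<bar> * indicator {l<..} (2 * w * \<bar>f x\<bar>)) \<partial>lborel)"
        by (rule nn_integral_cmult[symmetric]) measurable
      also have "\<dots> = (\<integral>\<^sup>+x. ennreal (?A * q) * (ennreal \<bar>f x\<bar> *
        (ennreal (l powr (q - 2)) * (indicator {0<..} l * indicator {l<..} (2 * w * \<bar>f x\<bar>)))) \<partial>lborel)"
        using l q w by (intro nn_integral_cong) (auto simp: ennreal_mult mult_ac)
      finally show ?thesis .
    qed
  qed
  also have "\<dots> = (\<integral>\<^sup>+x. (\<integral>\<^sup>+l. ennreal (?A * q) * (ennreal \<bar>f x\<bar> *
        (ennreal (l powr (q - 2)) * (indicator {0<..} l * indicator {0<..} (2 * w * \<bar>f x\<bar> - l)))) \<partial>lborel) \<partial>lborel)"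
    (is "_ = (\<integral>\<^sup>+x. (\<integral>\<^sup>+l. ?F x l \<partial>lborel) \<partial>lborel)")
  proof -
    have "(\<integral>\<^sup>+l. (\<integral>\<^sup>+x. ?F x l \<partial>lborel) \<partial>lborel) = (\<integral>\<^sup>+x. (\<integral>\<^sup>+l. ?F x l \<partial>lborel) \<partial>lborel)"
      by (rule lborel_pair.Fubini') measurable
    then show ?thesis by (simp add: indicator_def cong: if_cong)
  qed
  also have "\<dots> = (\<integral>\<^sup>+x. ennreal (?A * q * (2 * w) powr (q - 1) / (q - 1)) * ennreal (\<bar>f x\<bar> powr q) \<partial>lborel)"
  proof (rule nn_integral_cong)
    fix x
    have "(\<integral>\<^sup>+l. ?F x l \<partial>lborel) = (\<integral>\<^sup>+l. ennreal (?A * q * \<bar>f x\<bar>) *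
        (ennreal (l powr (q - 2)) * indicator {0<..<2 * w * \<bar>f x\<bar>} l) \<partial>lborel)"
      using w q by (intro nn_integral_cong) (auto simp: indicator_def ennreal_mult mult.assoc)
    \<comment> \<open>Here \<open>q > 1\<close> makes \<open>l powr (q - 2)\<close> integrable at
      0.\<close>
    also have "\<dots> = ennreal (?A * q * \<bar>f x\<bar>) * ennreal ((2 * w * \<bar>f x\<bar>) powr (q - 2 + 1) / (q - 2 + 1))"
      using q w by (subst nn_integral_cmult) (auto simp: nn_integral_powr_Ioo)
    also have "\<dots> = ennreal (?A * q * \<bar>f x\<bar> * ((2 * w) powr (q - 1) * \<bar>f x\<bar> powr (q - 1) / (q - 1)))"
      using q w by (simp add: ennreal_mult[symmetric] powr_mult)
    also have "?A * q * \<bar>f x\<bar> * ((2 * w) powr (q - 1) * \<bar>f x\<bar> powr (q - 1) / (q - 1))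
      = ?A * q * (2 * w) powr (q - 1) / (q - 1) * (\<bar>f x\<bar> powr (q - 1) * \<bar>f x\<bar>)"
      by simp
    also have "\<bar>f x\<bar> powr (q - 1) * \<bar>f x\<bar> = \<bar>f x\<bar> powr q"
      using powr_add[of "\<bar>f x\<bar>" "q - 1" 1] by (cases "f x = 0") auto
    also have "ennreal (?A * q * (2 * w) powr (q - 1) / (q - 1) * \<bar>f x\<bar> powr q) =
        ennreal (?A * q * (2 * w) powr (q - 1) / (q - 1)) * ennreal (\<bar>f x\<bar> powr q)"
      using q w by (intro ennreal_mult) auto
    finally show "(\<integral>\<^sup>+l. ?F x l \<partial>lborel) = ennreal (?A * q * (2 * w) powr (q - 1) / (q - 1)) * ennreal (\<bar>f x\<bar> powr q)" .
  qed
  also have "\<dots> = ennreal (?A * q * (2 * w) powr (q - 1) / (q - 1)) * (\<integral>\<^sup>+x. ennreal (\<bar>f x\<bar> powr q) \<partial>lborel)"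
    by (rule nn_integral_cmult) measurable
  finally show ?thesis .
qed

text \<open>For levels \<open>l \<ge> 1\<close> the truncation forces
  \<open>2 * w * \<bar>f y\<bar> \<ge> 1\<close>, so there \<open>\<bar>f y\<bar>\<close> is
  dominated by a multiple of its \<open>q\<close>-th power. The weak-type bound then decays like
  \<open>1 / l\<close>.\<close>

lemma maxfun_finite_AE:
  fixes f :: "'a::euclidean_space \<Rightarrow> real"
  assumes [measurable]: "f \<in> borel_measurable borel" and q: "q > 1"
    and fin: "(\<integral>\<^sup>+x. ennreal (\<bar>f x\<bar> powr q) \<partial>lborel) < \<infinity>"
  shows "AE x in lborel. maxfun f x < \<infinity>"
proof -
  define w where "w = unit_ball_vol (real DIM('a))"
  have w: "w > 0" by (simp add: w_def)
  define J where "J = enn2real (\<integral>\<^sup>+x. ennreal (\<bar>f x\<bar> powr q) \<partial>lborel)"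
  have J: "(\<integral>\<^sup>+x. ennreal (\<bar>f x\<bar> powr q) \<partial>lborel) = ennreal J" "J \<ge> 0"
    using fin by (auto simp: J_def less_top)
  define c where "c = 2 * 5 ^ DIM('a) * w * ((2 * w) powr (q - 1) * J)"
  have c: "c \<ge> 0" using J w by (simp add: c_def)
  have bound: "emeasure lborel {x. maxfun f x = \<infinity>} \<le> ennreal (c * (1 / real (Suc n)))" for n
  proof -
    define l where "l = real (Suc n)"
    have l: "l \<ge> 1" by (simp add: l_def)
    have "emeasure lborel {x. maxfun f x = \<infinity>} \<le> emeasure lborel {x. maxfun f x > ennreal l}"
      by (intro emeasure_mono) auto
    also have "\<dots> \<le> ennreal (2 * 5 ^ DIM('a) * w / l) *
        (\<integral>\<^sup>+y. ennreal \<bar>f y\<bar> * indicator {l<..} (2 * w * \<bar>f y\<bar>) \<partial>lborel)"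
      unfolding w_def using l by (intro weak_type_maxfun) auto
    also have "\<dots> \<le> ennreal (2 * 5 ^ DIM('a) * w / l) *
        (\<integral>\<^sup>+y. ennreal ((2 * w) powr (q - 1)) * ennreal (\<bar>f y\<bar> powr q) \<partial>lborel)"
    proof (intro mult_left_mono nn_integral_mono)
      fix y
      show "ennreal \<bar>f y\<bar> * indicator {l<..} (2 * w * \<bar>f y\<bar>) \<le> ennreal ((2 * w) powr (q - 1)) * ennreal (\<bar>f y\<bar> powr q)"
      proof (cases "l < 2 * w * \<bar>f y\<bar>")
        case True
        then have ge: "1 \<le> 2 * w * \<bar>f y\<bar>" using l by linarith
        then have "1 \<le> (2 * w * \<bar>f y\<bar>) powr (q - 1)" using q by (intro ge_one_powr_ge_zero) auto
        then have "\<bar>f y\<bar> * 1 \<le> \<bar>f y\<bar> * ((2 * w * \<bar>f y\<bar>) powr (q - 1))"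
          by (intro mult_left_mono) auto
        also have "\<dots> = (2 * w) powr (q - 1) * (\<bar>f y\<bar> powr (q - 1) * \<bar>f y\<bar>)"
          using w by (simp add: powr_mult)
        also have "\<bar>f y\<bar> powr (q - 1) * \<bar>f y\<bar> = \<bar>f y\<bar> powr q"
          using powr_add[of "\<bar>f y\<bar>" "q - 1" 1] by (cases "f y = 0") auto
        finally show ?thesis using True by (simp add: ennreal_mult[symmetric] ennreal_leI)
      qed auto
    qed auto
    also have "\<dots> = ennreal (2 * 5 ^ DIM('a) * w / l) * (ennreal ((2 * w) powr (q - 1)) * ennreal J)"
      using J by (simp add: nn_integral_cmult)
    also have "\<dots> = ennreal (c * (1 / l))"
      using w l J by (simp add: ennreal_mult[symmetric] c_def)
    finally show ?thesis by (simp add: l_def)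
  qed
  have "(\<lambda>n. ennreal (c * (1 / real (Suc n)))) \<longlonglongrightarrow> ennreal (c * 0)"
    by (intro tendsto_ennrealI tendsto_mult tendsto_const LIMSEQ_Suc[OF lim_1_over_n])
  then have "emeasure lborel {x. maxfun f x = \<infinity>} \<le> ennreal (c * 0)"
    by (rule LIMSEQ_le_const) (use bound in auto)
  then have "emeasure lborel {x. maxfun f x = \<infinity>} = 0" by simp
  then have "{x. maxfun f x = \<infinity>} \<in> null_sets lborel" by (auto intro!: null_setsI)
  then show ?thesis by (rule AE_I') (auto simp: not_less top_unique)
qed

section \<open>Pairing with rescaled kernels\<close>

definition rescale :: "real \<Rightarrow> real ^ 'n \<Rightarrow> real ^ 'n \<Rightarrow> real ^ 'n" where
  "rescale \<rho> x y = (1 / \<rho>) *\<^sub>R (y - x)"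

lemma borel_measurable_rescale [measurable]: "rescale \<rho> x \<in> borel_measurable borel"
  unfolding rescale_def[abs_def] by measurable

lemma norm_rescale: "\<rho> > 0 \<Longrightarrow> norm (rescale \<rho> x y) = dist x y / \<rho>"
  by (simp add: rescale_def dist_norm norm_minus_commute)

definition pairing :: "(real ^ 'n::finite \<Rightarrow> real) \<Rightarrow> real \<Rightarrow> (real ^ 'n \<Rightarrow> real) \<Rightarrow> real ^ 'n \<Rightarrow> real" where
  "pairing K \<rho> f x = (LINT y|lborel. f y * K (rescale \<rho> x y)) / \<rho> ^ CARD('n)"

text \<open>The Borel counterpart of \<open>locally_integrable\<close>, with measurability built in
  and balls as the compact sets.\<close>

definition ball_integrable :: "(real ^ 'n::finite \<Rightarrow> real) \<Rightarrow> bool" where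
  "ball_integrable f \<longleftrightarrow> f \<in> borel_measurable borel \<and> (\<forall>x R. set_integrable lborel (cball x R) f)"

lemma integrable_indicator_cball: "integrable lborel (indicat_real (cball (x :: real ^ 'n::finite) R))"
  by (intro integrable_real_indicator emeasure_bounded_finite) auto

lemma integrable_mult_bounded_support:
  assumes f: "ball_integrable f" and [measurable]: "k \<in> borel_measurable borel"
    and k: "\<And>y. \<bar>k y\<bar> \<le> c * indicator S y" and S: "bounded S"
  shows "integrable lborel (\<lambda>y. f y * k y)"
proof -
  have [measurable]: "f \<in> borel_measurable borel" using f by (simp add: ball_integrable_def)
  obtain R where "S \<subseteq> ball 0 R"
    using bounded_subset_ballD[OF S, of 0] by auto
  then have R: "S \<subseteq> cball 0 R"
    by (rule subset_trans) (rule ball_subset_cball)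
  have "integrable lborel (\<lambda>y. \<bar>c\<bar> * \<bar>indicator (cball 0 R) y *\<^sub>R f y\<bar>)"
    using f by (intro integrable_mult_right integrable_abs) (simp add: ball_integrable_def set_integrable_def)
  then show ?thesis
  proof (rule Bochner_Integration.integrable_bound)
    show "AE y in lborel. norm (f y * k y) \<le> norm (\<bar>c\<bar> * \<bar>indicator (cball 0 R) y *\<^sub>R f y\<bar>)"
    proof (rule AE_I2)
      fix y
      have "\<bar>k y\<bar> \<le> \<bar>c\<bar> * indicator (cball 0 R) y"
      proof (cases "y \<in> S")
        case True
        then have "y \<in> cball 0 R" using R by blast
        then show ?thesis using k[of y] True by simp
      next
        case False
        then show ?thesis using k[of y] by simp
      qed
      then have "\<bar>f y\<bar> * \<bar>k y\<bar> \<le> \<bar>f y\<bar> * (\<bar>c\<bar> * indicator (cball 0 R) y)"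
        by (intro mult_left_mono) auto
      then show "norm (f y * k y) \<le> norm (\<bar>c\<bar> * \<bar>indicator (cball 0 R) y *\<^sub>R f y\<bar>)"
        by (simp add: abs_mult mult_ac)
    qed
  qed measurable
qed

lemma integrable_bounded_support:
  fixes k :: "real ^ 'n::finite \<Rightarrow> real"
  assumes "k \<in> borel_measurable borel" "\<And>y. \<bar>k y\<bar> \<le> c * indicator S y" "bounded S"
  shows "integrable lborel k"
proof -
  have "ball_integrable (\<lambda>_::real ^ 'n. 1)"
    by (simp add: ball_integrable_def set_integrable_def integrable_indicator_cball)
  from integrable_mult_bounded_support[OF this assms] show ?thesis by simp
qed

lemma integral_mult_bound:
  assumes f: "ball_integrable f" and k: "k \<in> borel_measurable borel" "\<And>y. \<bar>k y\<bar> \<le> c * indicator S y"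
    and S: "bounded S" "S \<in> sets borel" and c: "c \<ge> 0"
  shows "ennreal \<bar>LINT y|lborel. f y * k y\<bar> \<le> ennreal c * (\<integral>\<^sup>+y. ennreal \<bar>f y\<bar> * indicator S y \<partial>lborel)"
proof -
  have [measurable]: "f \<in> borel_measurable borel" using f by (simp add: ball_integrable_def)
  have "ennreal \<bar>LINT y|lborel. f y * k y\<bar> \<le> (\<integral>\<^sup>+y. ennreal \<bar>f y * k y\<bar> \<partial>lborel)"
    using integral_norm_bound_ennreal[OF integrable_mult_bounded_support[OF f k S(1)]] by simp
  also have "\<dots> \<le> (\<integral>\<^sup>+y. ennreal c * (ennreal \<bar>f y\<bar> * indicator S y) \<partial>lborel)"
  proof (rule nn_integral_mono)
    fix y
    have "\<bar>f y * k y\<bar> \<le> \<bar>f y\<bar> * (c * indicator S y)"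
      using k(2)[of y] by (simp add: abs_mult mult_left_mono)
    then show "ennreal \<bar>f y * k y\<bar> \<le> ennreal c * (ennreal \<bar>f y\<bar> * indicator S y)"
      using c by (auto simp: indicator_def ennreal_mult[symmetric] mult.commute intro!: ennreal_leI split: if_splits)
  qed
  also have "\<dots> = ennreal c * (\<integral>\<^sup>+y. ennreal \<bar>f y\<bar> * indicator S y \<partial>lborel)"
    using S(2) by (intro nn_integral_cmult borel_measurable_times_ennreal borel_measurable_indicator) auto
  finally show ?thesis .
qed

text \<open>The upper corner repeats the lower corner inside, so that the set has literally the form
  demanded by \<open>is_cube\<close>.\<close>

definition centered_cube :: "real ^ 'n::finite \<Rightarrow> real \<Rightarrow> (real ^ 'n) set" where
  "centered_cube x R = cbox (\<chi> i. x $ i - R) (\<chi> i. (\<chi> i. x $ i - R) $ i + 2 * R)"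

lemma is_cube_centered_cube: "R > 0 \<Longrightarrow> is_cube (centered_cube x R)"
  unfolding is_cube_def centered_cube_def
  by (rule exI[of _ "\<chi> i. x $ i - R"], rule exI[of _ "2 * R"]) simp

lemma emeasure_centered_cube:
  fixes x :: "real ^ 'n::finite"
  assumes "R > 0"
  shows "emeasure lborel (centered_cube x R) = ennreal ((2 * R) ^ CARD('n))"
proof -
  have "emeasure lborel (centered_cube x R) = ennreal (measure lborel (centered_cube x R))"
    unfolding centered_cube_def
    using emeasure_lborel_cbox_finite by (intro emeasure_eq_ennreal_measure) (simp add: less_top)
  also have "measure lborel (centered_cube x R) = (2 * R) ^ CARD('n)"
  proof -
    let ?a = "\<chi> i. x $ i - R" and ?b = "\<chi> i. (\<chi> i. x $ i - R) $ i + 2 * R"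
    have "x \<in> cbox ?a ?b" using assms by (simp add: mem_box_cart)
    then have "cbox ?a ?b \<noteq> {}" by blast
    from content_cbox_cart[OF this] show ?thesis by (simp add: centered_cube_def)
  qed
  finally show ?thesis .
qed

lemma cball_subset_centered_cube: "cball x R \<subseteq> centered_cube x R"
proof
  fix y assume "y \<in> cball x R"
  then have "\<bar>(y - x) $ i\<bar> \<le> R" for i
    using component_le_norm_cart[of "y - x" i] by (simp add: dist_norm norm_minus_commute)
  then have "\<bar>y $ i - x $ i\<bar> \<le> R" for i by simp
  then show "y \<in> centered_cube x R"
    by (simp add: centered_cube_def mem_box_cart abs_le_iff algebra_simps)
qed

text \<open>At scale \<rho> a kernel lives within \<open>4 * N * \<rho>\<close> of its base point.
  If \<open>dist x z \<le> \<rho> \<le> N * \<rho>\<close>, the ball of that radius around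
  \<open>z\<close> lies in the ball of radius \<open>5 * N * \<rho>\<close> around \<open>x\<close>,
  which therefore contains both supports.\<close>

lemma
  assumes K: "bounded_kernel M (K :: real ^ 'n::finite \<Rightarrow> real)" and \<rho>: "\<rho> > 0"
  shows bounded_kernel_rescale:
      "\<bar>K (rescale \<rho> x y)\<bar> \<le> M * indicator (cball x (5 * real CARD('n) * \<rho>)) y"
    and bounded_kernel_rescale_diff: "dist x z \<le> \<rho> \<Longrightarrow>
      \<bar>K (rescale \<rho> x y) - K (rescale \<rho> z y)\<bar>
        \<le> M * (dist x z / \<rho>) * indicator (cball x (5 * real CARD('n) * \<rho>)) y"
proof -
  let ?N = "real CARD('n)"
  have N: "?N \<ge> 1" by (simp add: Suc_leI)
  have M: "\<And>w. \<bar>K w\<bar> \<le> M" "\<And>w w'. \<bar>K w - K w'\<bar> \<le> M * norm (w - w')" "\<And>w. norm w > 4 * ?N \<Longrightarrow> K w = 0"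
    using K by (auto simp: bounded_kernel_def)
  have zero: "K (rescale \<rho> a y) = 0" if "dist a y > 4 * ?N * \<rho>" for a
    using that \<rho> by (intro M(3)) (simp add: norm_rescale pos_less_divide_eq)
  have N\<rho>: "\<rho> \<le> ?N * \<rho>" using N \<rho> by simp
  show "\<bar>K (rescale \<rho> x y)\<bar> \<le> M * indicator (cball x (5 * ?N * \<rho>)) y"
  proof (cases "y \<in> cball x (5 * ?N * \<rho>)")
    case True
    then show ?thesis using M(1) by simp
  next
    case False
    then have "dist x y > 5 * ?N * \<rho>" by (simp add: not_le)
    then have "dist x y > 4 * ?N * \<rho>" using N\<rho> \<rho> by linarith
    then show ?thesis using False zero by simp
  qed
  assume xz: "dist x z \<le> \<rho>"
  show "\<bar>K (rescale \<rho> x y) - K (rescale \<rho> z y)\<bar>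
        \<le> M * (dist x z / \<rho>) * indicator (cball x (5 * ?N * \<rho>)) y"
  proof (cases "y \<in> cball x (5 * ?N * \<rho>)")
    case True
    have "rescale \<rho> x y - rescale \<rho> z y = (1 / \<rho>) *\<^sub>R (z - x)"
      by (simp add: rescale_def algebra_simps)
    then have "norm (rescale \<rho> x y - rescale \<rho> z y) = dist x z / \<rho>"
      using \<rho> by (simp add: dist_norm norm_minus_commute)
    then show ?thesis using M(2)[of "rescale \<rho> x y" "rescale \<rho> z y"] True by simp
  next
    case False
    then have 1: "dist x y > 5 * ?N * \<rho>" by simp
    moreover have "dist x y \<le> dist x z + dist z y" by (rule dist_triangle)
    ultimately have "dist z y > 4 * ?N * \<rho>" using xz N\<rho> by linarith
    moreover have "dist x y > 4 * ?N * \<rho>" using 1 N\<rho> \<rho> by linarith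
    ultimately show ?thesis using zero False by simp
  qed
qed

lemma bounded_kernel_measurable: "bounded_kernel M K \<Longrightarrow> K \<in> borel_measurable borel"
  by (simp add: bounded_kernel_def)

lemma bounded_kernel_nonneg:
  assumes "bounded_kernel M K" shows "M \<ge> 0"
proof -
  have "\<bar>K 0\<bar> \<le> M" using assms by (simp add: bounded_kernel_def)
  then show ?thesis by linarith
qed

lemma integrable_pairing:
  assumes f: "ball_integrable f" and K: "bounded_kernel M K" and \<rho>: "\<rho> > 0"
  shows "integrable lborel (\<lambda>y. f y * K (rescale \<rho> x y))"
proof -
  have [measurable]: "K \<in> borel_measurable borel" using K by (rule bounded_kernel_measurable)
  show ?thesis
    by (rule integrable_mult_bounded_support[OF f _ bounded_kernel_rescale[OF K \<rho>]]) auto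
qed

lemma pairing_diff_eq:
  fixes f :: "real ^ 'n::finite \<Rightarrow> real"
  assumes f: "ball_integrable f" and K: "bounded_kernel M K" "bounded_kernel M' K'" and \<rho>: "\<rho> > 0"
  shows "pairing K \<rho> f x - pairing K' \<rho> f z =
    (LINT y|lborel. f y * (K (rescale \<rho> x y) - K' (rescale \<rho> z y))) / \<rho> ^ CARD('n)"
  unfolding pairing_def
  using integrable_pairing[OF f K(1) \<rho>, of x] integrable_pairing[OF f K(2) \<rho>, of z]
  by (simp add: right_diff_distrib Bochner_Integration.integral_diff diff_divide_distrib)

text \<open>Nearby points use the Lipschitz bound of the kernel and one ball around
  \<open>x\<close>; distant points are estimated separately, whence the sum \<open>gx + gz\<close>.
  The numbers \<open>gx\<close> and \<open>gz\<close> stand for finite values of a maximal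
  function.\<close>

lemma pairing_oscillation_le:
  fixes f :: "real ^ 'n::finite \<Rightarrow> real"
  assumes f: "ball_integrable f" and K: "bounded_kernel M K" and \<rho>: "\<rho> > 0"
    and gx: "\<And>R. R > 0 \<Longrightarrow> (\<integral>\<^sup>+y. ennreal \<bar>f y\<bar> * indicator (cball x R) y \<partial>lborel) \<le> ennreal (R ^ CARD('n) * gx)"
    and gz: "\<And>R. R > 0 \<Longrightarrow> (\<integral>\<^sup>+y. ennreal \<bar>f y\<bar> * indicator (cball z R) y \<partial>lborel) \<le> ennreal (R ^ CARD('n) * gz)"
    and nonneg: "gx \<ge> 0" "gz \<ge> 0"
  shows "\<bar>pairing K \<rho> f x - pairing K \<rho> f z\<bar>
    \<le> M * (5 * real CARD('n)) ^ CARD('n) * min 1 (dist x z / \<rho>) * (gx + gz)"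
proof -
  let ?N = "CARD('n)"
  let ?R = "5 * real ?N * \<rho>"
  have R: "?R > 0" using \<rho> by simp
  have M: "M \<ge> 0" using K by (rule bounded_kernel_nonneg)
  have [measurable]: "K \<in> borel_measurable borel" using K by (rule bounded_kernel_measurable)
  have one: "\<bar>pairing K \<rho> f a\<bar> \<le> M * (5 * real ?N) ^ ?N * ga"
    if ga: "\<And>R. R > 0 \<Longrightarrow> (\<integral>\<^sup>+y. ennreal \<bar>f y\<bar> * indicator (cball a R) y \<partial>lborel) \<le> ennreal (R ^ ?N * ga)"
      "ga \<ge> 0" for a ga
  proof -
    have "ennreal \<bar>LINT y|lborel. f y * K (rescale \<rho> a y)\<bar>
        \<le> ennreal M * (\<integral>\<^sup>+y. ennreal \<bar>f y\<bar> * indicator (cball a ?R) y \<partial>lborel)"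
      by (intro integral_mult_bound f bounded_kernel_rescale[OF K \<rho>] M) auto
    also have "\<dots> \<le> ennreal M * ennreal (?R ^ ?N * ga)"
      by (intro mult_left_mono ga R) auto
    also have "\<dots> = ennreal (M * (?R ^ ?N * ga))" using M ga(2) R by (simp add: ennreal_mult)
    finally have "\<bar>LINT y|lborel. f y * K (rescale \<rho> a y)\<bar> \<le> M * (?R ^ ?N * ga)"
      using M ga(2) R by (subst (asm) ennreal_le_iff) auto
    also have "\<dots> = M * (5 * real ?N) ^ ?N * ga * \<rho> ^ ?N" by (simp add: power_mult_distrib)
    finally show ?thesis using \<rho> by (simp add: pairing_def pos_divide_le_eq)
  qed
  show ?thesis
  proof (cases "dist x z \<le> \<rho>")
    case True
    then have t: "dist x z / \<rho> \<ge> 0" "dist x z / \<rho> \<le> 1" using \<rho> by auto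
    then have Mt: "M * (dist x z / \<rho>) \<ge> 0" using M by (intro mult_nonneg_nonneg)
    have "ennreal \<bar>LINT y|lborel. f y * (K (rescale \<rho> x y) - K (rescale \<rho> z y))\<bar>
        \<le> ennreal (M * (dist x z / \<rho>)) * (\<integral>\<^sup>+y. ennreal \<bar>f y\<bar> * indicator (cball x ?R) y \<partial>lborel)"
      by (intro integral_mult_bound f bounded_kernel_rescale_diff[OF K \<rho> True] Mt) auto
    also have "\<dots> \<le> ennreal (M * (dist x z / \<rho>)) * ennreal (?R ^ ?N * gx)"
      by (intro mult_left_mono gx R) auto
    also have "\<dots> = ennreal (M * (dist x z / \<rho>) * (?R ^ ?N * gx))"
      using Mt nonneg R by (intro ennreal_mult[symmetric]) auto
    finally have "\<bar>LINT y|lborel. f y * (K (rescale \<rho> x y) - K (rescale \<rho> z y))\<bar>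
        \<le> M * (dist x z / \<rho>) * (?R ^ ?N * gx)"
      using Mt nonneg R by (subst (asm) ennreal_le_iff) (auto intro!: mult_nonneg_nonneg simp del: times_divide_eq_right)
    also have "\<dots> = M * (dist x z / \<rho>) * (5 * real ?N) ^ ?N * gx * \<rho> ^ ?N"
      by (simp add: power_mult_distrib mult_ac)
    finally have "\<bar>pairing K \<rho> f x - pairing K \<rho> f z\<bar> \<le> M * (dist x z / \<rho>) * (5 * real ?N) ^ ?N * gx"
      unfolding pairing_diff_eq[OF f K K \<rho>] using \<rho> by (simp add: pos_divide_le_eq)
    also have "\<dots> \<le> M * (dist x z / \<rho>) * (5 * real ?N) ^ ?N * (gx + gz)"
      using Mt nonneg by (intro mult_left_mono mult_nonneg_nonneg[OF Mt]) auto
    also have "\<dots> = M * (5 * real ?N) ^ ?N * min 1 (dist x z / \<rho>) * (gx + gz)"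
      unfolding min_absorb2[OF t(2)] by simp
    finally show ?thesis .
  next
    case False
    then have "1 \<le> dist x z / \<rho>" using \<rho> by (simp add: pos_le_divide_eq)
    then have "min 1 (dist x z / \<rho>) = 1" by (rule min_absorb1)
    moreover have "\<bar>pairing K \<rho> f x - pairing K \<rho> f z\<bar> \<le> M * (5 * real ?N) ^ ?N * gx + M * (5 * real ?N) ^ ?N * gz"
      using one[OF gx nonneg(1)] one[OF gz nonneg(2)] by linarith
    ultimately show ?thesis by (simp only: distrib_left mult_1_right)
  qed
qed

text \<open>A real bound on the BMO norm with the division by the squared volume cleared and all
  integrals over \<open>lborel\<close>.\<close>

definition bmo_bounded :: "real \<Rightarrow> (real ^ 'n::finite \<Rightarrow> real) \<Rightarrow> bool" where
  "bmo_bounded B u \<longleftrightarrow> B \<ge> 0 \<and> (\<forall>Q. is_cube Q \<longrightarrow>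
     (\<integral>\<^sup>+x\<in>Q. (\<integral>\<^sup>+z\<in>Q. ennreal \<bar>u z - u x\<bar> \<partial>lborel) \<partial>lborel) \<le> ennreal B * (emeasure lborel Q)\<^sup>2)"

lemma ball_integrable_diff_const:
  assumes "ball_integrable f"
  shows "ball_integrable (\<lambda>y::real ^ 'n::finite. f y - c)"
proof -
  have "set_integrable lborel (cball x R) (\<lambda>y::real ^ 'n. c)" for x R
    unfolding set_integrable_def by (simp add: integrable_indicator_cball)
  then show ?thesis
    using assms by (auto simp: ball_integrable_def intro: set_integral_diff)
qed

text \<open>A mean-zero kernel allows any constant to be subtracted from \<open>u\<close>.
  Subtracting \<open>u z\<close> and averaging over all \<open>z\<close> in the cube, in place of
  subtracting the mean of \<open>u\<close>, produces exactly the double integral that defines the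
  BMO norm.\<close>

lemma integral_mult_bmo_bound:
  fixes u k :: "real ^ 'n::finite \<Rightarrow> real"
  assumes u: "ball_integrable u" and bmo: "bmo_bounded B u"
    and k: "k \<in> borel_measurable borel" "\<And>y. \<bar>k y\<bar> \<le> c * indicator (cball x R) y"
    and k0: "(LINT y|lborel. k y) = 0" and c: "c \<ge> 0" and R: "R > 0"
  shows "\<bar>LINT y|lborel. u y * k y\<bar> \<le> c * (2 * R) ^ CARD('n) * B"
proof -
  have [measurable]: "u \<in> borel_measurable borel" using u by (simp add: ball_integrable_def)
  note [measurable] = k(1)
  define Q where "Q = centered_cube x R"
  have Q: "is_cube Q" "Q \<in> sets borel" "bounded Q" "emeasure lborel Q = ennreal ((2 * R) ^ CARD('n))" "cball x R \<subseteq> Q"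
    using R by (auto simp: Q_def is_cube_centered_cube emeasure_centered_cube cball_subset_centered_cube[THEN subsetD])
      (auto simp: centered_cube_def)
  note [measurable] = Q(2)
  have B: "B \<ge> 0" using bmo by (simp add: bmo_bounded_def)
  have kQ: "\<bar>k y\<bar> \<le> c * indicator Q y" for y
  proof (cases "y \<in> cball x R")
    case True
    then have "y \<in> Q" using Q(5) by blast
    then show ?thesis using k(2)[of y] True by simp
  next
    case False
    then show ?thesis using k(2)[of y] c by simp
  qed
  have ki: "integrable lborel k" by (rule integrable_bounded_support[OF k(1) kQ Q(3)])
  have uk: "integrable lborel (\<lambda>y. u y * k y)" by (rule integrable_mult_bounded_support[OF u k(1) kQ Q(3)])
  define I where "I = \<bar>LINT y|lborel. u y * k y\<bar>"
  define q where "q = (2 * R) ^ CARD('n)"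
  have q: "q > 0" using R by (simp add: q_def)
  have le: "ennreal I \<le> ennreal c * (\<integral>\<^sup>+y\<in>Q. ennreal \<bar>u y - u z\<bar> \<partial>lborel)" for z
  proof -
    have "(LINT y|lborel. (u y - u z) * k y) = (LINT y|lborel. u y * k y) - u z * (LINT y|lborel. k y)"
      using uk ki by (simp add: left_diff_distrib)
    then have "I = \<bar>LINT y|lborel. (u y - u z) * k y\<bar>" by (simp add: k0 I_def)
    then show ?thesis
      using integral_mult_bound[OF ball_integrable_diff_const[OF u] k(1) kQ Q(3) Q(2) c, of "u z"] by simp
  qed
  have "ennreal I * ennreal q = (\<integral>\<^sup>+z. ennreal I * indicator Q z \<partial>lborel)"
    by (simp add: nn_integral_cmult_indicator Q(4) q_def)
  also have "\<dots> \<le> (\<integral>\<^sup>+z. ennreal c * ((\<integral>\<^sup>+y\<in>Q. ennreal \<bar>u y - u z\<bar> \<partial>lborel) * indicator Q z) \<partial>lborel)"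
    using le by (intro nn_integral_mono) (auto simp: indicator_def)
  also have "\<dots> = ennreal c * (\<integral>\<^sup>+z\<in>Q. (\<integral>\<^sup>+y\<in>Q. ennreal \<bar>u y - u z\<bar> \<partial>lborel) \<partial>lborel)"
    by (rule nn_integral_cmult) measurable
  also have "\<dots> \<le> ennreal c * (ennreal B * (ennreal q)\<^sup>2)"
  proof (rule mult_left_mono)
    show "(\<integral>\<^sup>+z\<in>Q. (\<integral>\<^sup>+y\<in>Q. ennreal \<bar>u y - u z\<bar> \<partial>lborel) \<partial>lborel) \<le> ennreal B * (ennreal q)\<^sup>2"
      using bmo Q(1) unfolding bmo_bounded_def q_def Q(4)[symmetric] by blast
  qed simp
  also have "\<dots> = ennreal (c * (B * q\<^sup>2))"
    using c B q by (simp add: ennreal_mult ennreal_power)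
  finally have "I * q \<le> c * (B * q\<^sup>2)"
    using c B q by (simp add: ennreal_mult[symmetric] I_def)
  then have "I * q \<le> c * q * B * q" by (simp add: power2_eq_square mult_ac)
  then have "I \<le> c * q * B" using q mult_le_cancel_right_pos by blast
  then show ?thesis by (simp add: I_def q_def)
qed

lemma integral_rescale:
  fixes K :: "real ^ 'n::finite \<Rightarrow> real"
  assumes [measurable]: "K \<in> borel_measurable borel" and \<rho>: "\<rho> > 0"
  shows "(LINT y|lborel. K (rescale \<rho> x y)) = \<rho> ^ CARD('n) * (LINT w|lborel. K w)"
proof -
  have "(LINT y|lborel. K (rescale \<rho> x y)) =
      (LINT y|density (distr lborel borel (\<lambda>w. x + \<rho> *\<^sub>R w)) (\<lambda>_. ennreal (\<bar>\<rho>\<bar> ^ CARD('n))). K (rescale \<rho> x y))"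
    using \<rho> by (subst lborel_affine[of \<rho> x]) auto
  also have "\<dots> = (LINT y|distr lborel borel (\<lambda>w. x + \<rho> *\<^sub>R w). \<bar>\<rho>\<bar> ^ CARD('n) *\<^sub>R K (rescale \<rho> x y))"
    by (subst integral_density) auto
  also have "\<dots> = (LINT w|lborel. \<bar>\<rho>\<bar> ^ CARD('n) *\<^sub>R K (rescale \<rho> x (x + \<rho> *\<^sub>R w)))"
    by (subst integral_distr) auto
  also have "\<dots> = \<rho> ^ CARD('n) * (LINT w|lborel. K w)"
    using \<rho> by (simp add: rescale_def)
  finally show ?thesis .
qed

section \<open>Lebesgue points\<close>

text \<open>One-sided cubes suffice, since the profile is supported in \<open>[1, 2]\<close>.\<close>

definition lebesgue_point :: "(real ^ 'n::finite \<Rightarrow> real) \<Rightarrow> real ^ 'n \<Rightarrow> bool" where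
  "lebesgue_point u x \<longleftrightarrow> (\<forall>e>0. \<exists>d>0. \<forall>h. 0 < h \<and> h < d \<longrightarrow>
     (\<integral>\<^sup>+y. ennreal \<bar>u y - u x\<bar> * indicator (cbox x (x + h *\<^sub>R One)) y \<partial>lborel) \<le> ennreal (e * h ^ CARD('n)))"

text \<open>A bridge to gauge integrals over boxes, the setting of the differentiation theorem used
  in \<open>AE_lebesgue_point\<close>.\<close>

lemma
  assumes f: "ball_integrable f"
  shows ball_integrable_integrable_on_cbox: "(\<lambda>y. \<bar>f y\<bar>) integrable_on cbox a b"
    and nn_integral_cbox_eq_integral:
      "(\<integral>\<^sup>+y. ennreal \<bar>f y\<bar> * indicator (cbox a b) y \<partial>lborel) = ennreal (integral (cbox a b) (\<lambda>y. \<bar>f y\<bar>))"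
proof -
  have "integrable lborel (\<lambda>y. f y * indicator (cbox a b) y)"
    by (rule integrable_mult_bounded_support[OF f _ _ bounded_cbox[of a b], where c = 1]) auto
  then have i: "integrable lborel (\<lambda>y. \<bar>f y * indicator (cbox a b) y\<bar>)" by (rule integrable_abs)
  have eq: "\<bar>f y * indicator (cbox a b) y\<bar> = indicator (cbox a b) y *\<^sub>R \<bar>f y\<bar>" for y
    by (auto simp: indicator_def)
  have s: "set_integrable lborel (cbox a b) (\<lambda>y. \<bar>f y\<bar>)"
    using i unfolding set_integrable_def eq .
  then show "(\<lambda>y. \<bar>f y\<bar>) integrable_on cbox a b"
    by (rule set_borel_integral_eq_integral)
  have "(\<integral>\<^sup>+y. ennreal \<bar>f y\<bar> * indicator (cbox a b) y \<partial>lborel) =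
     (\<integral>\<^sup>+y. ennreal \<bar>f y * indicator (cbox a b) y\<bar> \<partial>lborel)"
    by (intro nn_integral_cong) (auto simp: indicator_def)
  also have "\<dots> = ennreal (LINT y|lborel. \<bar>f y * indicator (cbox a b) y\<bar>)"
    by (rule nn_integral_eq_integral[OF i]) auto
  also have "(LINT y|lborel. \<bar>f y * indicator (cbox a b) y\<bar>) = integral (cbox a b) (\<lambda>y. \<bar>f y\<bar>)"
    using set_borel_integral_eq_integral(2)[OF s] unfolding set_lebesgue_integral_def eq .
  finally show "(\<integral>\<^sup>+y. ennreal \<bar>f y\<bar> * indicator (cbox a b) y \<partial>lborel) = ennreal (integral (cbox a b) (\<lambda>y. \<bar>f y\<bar>))" .
qed

lemma emeasure_corner_cube:
  fixes x :: "real ^ 'n::finite"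
  assumes "h > 0"
  shows "emeasure lborel (cbox x (x + h *\<^sub>R One)) = ennreal (h ^ CARD('n))"
  using assms by (subst emeasure_lborel_cbox) (auto simp: inner_add_left)

text \<open>Differentiation is applied to \<open>\<bar>u y - c\<bar>\<close> for every rational
  \<open>c\<close>, so that one null set works for all of them. A rational within
  \<open>e / 3\<close> of \<open>u x\<close> then replaces \<open>u x\<close>: twice for this
  replacement and once for the average, \<open>e / 3\<close> is spent three times.\<close>

lemma AE_lebesgue_point:
  fixes u :: "real ^ 'n::finite \<Rightarrow> real"
  assumes u: "ball_integrable u"
  shows "AE x in lborel. lebesgue_point u x"
proof -
  have [measurable]: "u \<in> borel_measurable borel" using u by (simp add: ball_integrable_def)
  define P where "P c x e \<longleftrightarrow> (\<exists>d>0. \<forall>h. 0 < h \<and> h < d \<longrightarrow>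
      norm (integral (cbox x (x + h *\<^sub>R One)) (\<lambda>y. \<bar>u y - c\<bar>) /\<^sub>R h ^ CARD('n) - \<bar>u x - c\<bar>) < e)" for c x e
  have dim: "DIM(real ^ 'n) = CARD('n)" by simp
  have "\<exists>N. negligible N \<and> (\<forall>x e. x \<notin> N \<longrightarrow> 0 < e \<longrightarrow> P c x e)" for c
  proof (rule integrable_ccontinuous_explicit[where f = "\<lambda>y. \<bar>u y - c\<bar>"])
    show "(\<lambda>y. \<bar>u y - c\<bar>) integrable_on cbox a b" for a b
      by (rule ball_integrable_integrable_on_cbox[OF ball_integrable_diff_const[OF u]])
    fix N assume "negligible N" and N: "\<And>x e. x \<notin> N \<Longrightarrow> 0 < e \<Longrightarrow> \<exists>d>0. \<forall>h. 0 < h \<and> h < d \<longrightarrow>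
      norm (integral (cbox x (x + h *\<^sub>R One)) (\<lambda>y. \<bar>u y - c\<bar>) /\<^sub>R h ^ DIM(real ^ 'n) - \<bar>u x - c\<bar>) < e"
    have "P c x e" if "x \<notin> N" "0 < e" for x e
      using N[OF that] unfolding P_def dim .
    with \<open>negligible N\<close> show "\<exists>N. negligible N \<and> (\<forall>x e. x \<notin> N \<longrightarrow> 0 < e \<longrightarrow> P c x e)"
      by blast
  qed
  then obtain N where N: "\<And>c. negligible (N c)" "\<And>c x e. x \<notin> N c \<Longrightarrow> 0 < e \<Longrightarrow> P c x e"
    by metis
  have "negligible (\<Union>c\<in>\<rat>. N c)"
    by (intro negligible_countable_Union countable_image countable_rat) (use N(1) in auto)
  then have null: "(\<Union>c\<in>\<rat>. N c) \<in> null_sets lebesgue"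
    by (simp add: negligible_iff_null_sets)
  \<comment> \<open>The exceptional set is known to be null only for the completed measure; the
    result returns to \<open>lborel\<close> at the very end.\<close>
  have "AE x in lebesgue. lebesgue_point u x"
  proof (rule AE_I'[OF null], rule subsetI, rule ccontr)
    fix x assume "x \<in> {x \<in> space lebesgue. \<not> lebesgue_point u x}" and x: "x \<notin> (\<Union>c\<in>\<rat>. N c)"
    then have "\<not> lebesgue_point u x" by simp
    moreover have "lebesgue_point u x"
      unfolding lebesgue_point_def
    proof (intro allI impI)
      fix e :: real assume e: "e > 0"
      obtain c where c: "c \<in> \<rat>" "u x - e / 3 < c" "c < u x + e / 3"
        using Rats_dense_in_real[of "u x - e / 3" "u x + e / 3"] e by auto
      have cu: "\<bar>u x - c\<bar> < e / 3" using c by linarith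
      obtain d where d: "d > 0" "\<And>h. 0 < h \<and> h < d \<Longrightarrow>
          norm (integral (cbox x (x + h *\<^sub>R One)) (\<lambda>y. \<bar>u y - c\<bar>) /\<^sub>R h ^ CARD('n) - \<bar>u x - c\<bar>) < e / 3"
      proof -
        have "x \<notin> N c" using x c(1) by blast
        from N(2)[OF this, of "e / 3"] e have "P c x (e / 3)" by simp
        then show ?thesis using that unfolding P_def by blast
      qed
      show "\<exists>d>0. \<forall>h. 0 < h \<and> h < d \<longrightarrow>
         (\<integral>\<^sup>+y. ennreal \<bar>u y - u x\<bar> * indicator (cbox x (x + h *\<^sub>R One)) y \<partial>lborel) \<le> ennreal (e * h ^ CARD('n))"
      proof (intro exI[of _ d] conjI d(1) allI impI)
        fix h assume h: "0 < h \<and> h < d"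
        let ?Q = "cbox x (x + h *\<^sub>R One)" and ?J = "integral (cbox x (x + h *\<^sub>R One)) (\<lambda>y. \<bar>u y - c\<bar>)"
        have hp: "h ^ CARD('n) > 0" using h by simp
        have "\<bar>?J / h ^ CARD('n) - \<bar>u x - c\<bar>\<bar> < e / 3"
          using d(2)[OF h] by (simp only: real_norm_def divide_inverse mult.commute real_scaleR_def)
        then have "?J / h ^ CARD('n) < 2 * e / 3" using cu by linarith
        then have J: "?J < 2 * e / 3 * h ^ CARD('n)" using hp by (simp add: pos_divide_less_eq)
        have J0: "?J \<ge> 0"
          by (intro Henstock_Kurzweil_Integration.integral_nonneg
              ball_integrable_integrable_on_cbox[OF ball_integrable_diff_const[OF u]]) auto
        have "(\<integral>\<^sup>+y. ennreal \<bar>u y - u x\<bar> * indicator ?Q y \<partial>lborel)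
            \<le> (\<integral>\<^sup>+y. ennreal \<bar>u y - c\<bar> * indicator ?Q y + ennreal (e / 3) * indicator ?Q y \<partial>lborel)"
        proof (intro nn_integral_mono)
          fix y
          have "ennreal \<bar>u y - u x\<bar> \<le> ennreal (\<bar>u y - c\<bar> + e / 3)" using cu by (intro ennreal_leI) linarith
          also have "\<dots> = ennreal \<bar>u y - c\<bar> + ennreal (e / 3)" using e by (intro ennreal_plus) auto
          finally show "ennreal \<bar>u y - u x\<bar> * indicator ?Q y \<le>
              ennreal \<bar>u y - c\<bar> * indicator ?Q y + ennreal (e / 3) * indicator ?Q y"
            by (auto simp: indicator_def)
        qed
        also have "\<dots> = (\<integral>\<^sup>+y. ennreal \<bar>u y - c\<bar> * indicator ?Q y \<partial>lborel) + (\<integral>\<^sup>+y. ennreal (e / 3) * indicator ?Q y \<partial>lborel)"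
          by (rule nn_integral_add) measurable
        also have "(\<integral>\<^sup>+y. ennreal \<bar>u y - c\<bar> * indicator ?Q y \<partial>lborel) = ennreal ?J"
          by (rule nn_integral_cbox_eq_integral[OF ball_integrable_diff_const[OF u]])
        also have "(\<integral>\<^sup>+y. ennreal (e / 3) * indicator ?Q y \<partial>lborel) = ennreal (e / 3 * h ^ CARD('n))"
          using h e by (subst nn_integral_cmult_indicator) (auto simp: emeasure_corner_cube ennreal_mult[symmetric])
        also have "ennreal ?J + ennreal (e / 3 * h ^ CARD('n)) = ennreal (?J + e / 3 * h ^ CARD('n))"
          using J0 e hp by (intro ennreal_plus[symmetric]) auto
        also have "\<dots> \<le> ennreal (e * h ^ CARD('n))"
          using J by (intro ennreal_leI) (simp add: field_simps)
        finally show "(\<integral>\<^sup>+y. ennreal \<bar>u y - u x\<bar> * indicator ?Q y \<partial>lborel) \<le> ennreal (e * h ^ CARD('n))" .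
      qed
    qed
    ultimately show False by simp
  qed
  then show ?thesis by (simp add: AE_completion_iff)
qed

text \<open>Mass one turns the error into the pairing with \<open>u - u x\<close>, and the support
  of the rescaled kernel lies in a corner cube of side \<open>2 * \<rho>\<close> at
  \<open>x\<close>, where the Lebesgue point property applies.\<close>

lemma pairing_tendsto:
  fixes u :: "real ^ 'n::finite \<Rightarrow> real"
  assumes u: "ball_integrable u" and x: "lebesgue_point u x" and K: "bounded_kernel M K" and M: "M > 0"
    and K1: "(LINT w|lborel. K w) = 1" and supp: "\<And>w. K w \<noteq> 0 \<Longrightarrow> w \<in> cbox 0 (2 *\<^sub>R One)"
  shows "((\<lambda>\<rho>. pairing K \<rho> u x) \<longlongrightarrow> u x) (at_right 0)"
proof (rule tendstoI)
  fix e :: real assume e: "e > 0"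
  let ?N = "CARD('n)"
  have [measurable]: "K \<in> borel_measurable borel" by (rule bounded_kernel_measurable[OF K])
  \<comment> \<open>Chosen so that \<open>M * (e' * (2 * \<rho>) ^ N)\<close> equals
    \<open>e / 2 * \<rho> ^ N\<close>.\<close>
  define e' where "e' = e / (2 * (M * 2 ^ ?N))"
  have e': "e' > 0" using e M by (simp add: e'_def)
  obtain d where d: "d > 0" "\<And>h. 0 < h \<and> h < d \<Longrightarrow>
     (\<integral>\<^sup>+y. ennreal \<bar>u y - u x\<bar> * indicator (cbox x (x + h *\<^sub>R One)) y \<partial>lborel) \<le> ennreal (e' * h ^ ?N)"
    using x e' unfolding lebesgue_point_def by blast
  have "dist (pairing K \<rho> u x) (u x) < e" if \<rho>: "0 < \<rho>" "\<rho> < d / 2" for \<rho>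
  proof -
    let ?k = "\<lambda>y. K (rescale \<rho> x y)" and ?Q = "cbox x (x + (2 * \<rho>) *\<^sub>R One)"
    have kQ: "\<bar>?k y\<bar> \<le> M * indicator ?Q y" for y
    proof (cases "?k y = 0")
      case True
      then show ?thesis using M by (simp add: indicator_def)
    next
      case False
      then have "rescale \<rho> x y \<in> cbox 0 (2 *\<^sub>R One)" by (rule supp)
      then have "y \<in> ?Q"
        using \<rho> by (auto simp: mem_box rescale_def inner_diff_left inner_add_left field_simps)
      then show ?thesis using K by (simp add: bounded_kernel_def)
    qed
    have int: "(LINT y|lborel. ?k y) = \<rho> ^ ?N" using integral_rescale[of K \<rho> x] \<rho> K1 by simp
    have ki: "integrable lborel ?k" by (rule integrable_bounded_support[OF _ kQ bounded_cbox]) auto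
    have "(LINT y|lborel. (u y - u x) * ?k y) = (LINT y|lborel. u y * ?k y) - u x * (LINT y|lborel. ?k y)"
      using ki integrable_pairing[OF u K \<rho>(1), of x] by (simp add: left_diff_distrib)
    then have eq: "pairing K \<rho> u x - u x = (LINT y|lborel. (u y - u x) * ?k y) / \<rho> ^ ?N"
      using \<rho> by (simp add: pairing_def int diff_divide_distrib)
    have "ennreal \<bar>LINT y|lborel. (u y - u x) * ?k y\<bar>
        \<le> ennreal M * (\<integral>\<^sup>+y. ennreal \<bar>u y - u x\<bar> * indicator ?Q y \<partial>lborel)"
      using M by (intro integral_mult_bound ball_integrable_diff_const u kQ) auto
    also have "\<dots> \<le> ennreal M * ennreal (e' * (2 * \<rho>) ^ ?N)"
      using \<rho> by (intro mult_left_mono d(2)) auto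
    also have "\<dots> = ennreal (M * (e' * (2 * \<rho>) ^ ?N))"
      using M e' \<rho> by (simp add: ennreal_mult)
    finally have "\<bar>LINT y|lborel. (u y - u x) * ?k y\<bar> \<le> M * (e' * (2 * \<rho>) ^ ?N)"
      using M e' \<rho> by (subst (asm) ennreal_le_iff) auto
    also have "\<dots> = e / 2 * \<rho> ^ ?N"
      using M by (simp add: e'_def power_mult_distrib)
    finally have "\<bar>pairing K \<rho> u x - u x\<bar> \<le> e / 2"
      unfolding eq using \<rho> by (simp add: pos_divide_le_eq)
    then show ?thesis using e by (simp add: dist_real_def)
  qed
  then show "eventually (\<lambda>\<rho>. dist (pairing K \<rho> u x) (u x) < e) (at_right 0)"
    unfolding eventually_at_right_field using d(1) by (intro exI[of _ "d / 2"]) auto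
qed

section \<open>Summation over scales and interpolation between two bounds\<close>

lemma geometric_telescope:
  fixes d :: "nat \<Rightarrow> real"
  assumes step: "\<And>n. \<bar>d (Suc n) - d n\<bar> \<le> c * q ^ n" and q: "0 < q" "q < 1" and lim: "d \<longlonglongrightarrow> L"
  shows "\<bar>d 0 - L\<bar> \<le> c / (1 - q)"
proof -
  have c: "c \<ge> 0" using step[of 0] by simp
  have "\<bar>d n - d 0\<bar> \<le> (\<Sum>i<n. c * q ^ i)" for n
  proof (induction n)
    case (Suc n)
    then show ?case using step[of n] by simp
  qed simp
  also have "(\<Sum>i<n. c * q ^ i) \<le> c / (1 - q)" for n
  proof -
    have "(\<Sum>i<n. c * q ^ i) = c * ((1 - q ^ n) / (1 - q))"
      using q by (simp add: sum_distrib_left[symmetric] sum_gp_strict)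
    also have "\<dots> \<le> c * (1 / (1 - q))"
      using c q by (intro mult_left_mono divide_right_mono) auto
    finally show ?thesis by simp
  qed
  finally have le: "\<bar>d n - d 0\<bar> \<le> c / (1 - q)" for n .
  have "(\<lambda>n. \<bar>d n - d 0\<bar>) \<longlonglongrightarrow> \<bar>L - d 0\<bar>"
    by (intro tendsto_rabs tendsto_diff lim tendsto_const)
  then have "\<bar>L - d 0\<bar> \<le> c / (1 - q)"
    by (rule LIMSEQ_le_const2) (use le in auto)
  then show ?thesis by (simp add: abs_minus_commute)
qed

text \<open>A number below both bounds is the geometric mean of two copies of itself, so it lies
  below every weighted geometric mean of the bounds.\<close>

lemma interpolate_bounds:
  fixes t c X Y \<theta> :: real
  assumes "0 \<le> t" "t \<le> c * X" "t \<le> c * Y" "c > 0" "0 < \<theta>" "\<theta> < 1"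
  shows "t \<le> c * (X powr (1 - \<theta>) * Y powr \<theta>)"
proof -
  define s where "s = t / c"
  have s: "s \<ge> 0" "s \<le> X" "s \<le> Y" using assms by (auto simp: s_def field_simps)
  have "s = s powr (1 - \<theta>) * s powr \<theta>"
    using s by (simp add: powr_add[symmetric])
  also have "\<dots> \<le> X powr (1 - \<theta>) * Y powr \<theta>"
    using s assms by (intro mult_mono powr_mono2) auto
  finally show ?thesis using assms by (simp add: s_def pos_divide_le_eq mult.commute)
qed

section \<open>The pointwise interpolation inequality\<close>

lemma abs_diff_diff_le:
  fixes p q p' q' c c' :: real
  assumes "\<bar>p - q\<bar> \<le> c" "\<bar>p' - q'\<bar> \<le> c'"
  shows "\<bar>(p - p') - (q - q')\<bar> \<le> c + c'"
  using assms by linarith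

lemma two_powr_le_one: "(2::real) powr b \<le> 1" if "b \<le> 0"
  using powr_mono[OF that, of "2::real"] by simp

lemma two_powr_less_one: "(2::real) powr b < 1" if "b < 0"
  using powr_less_mono[OF that, of "2::real"] by simp

text \<open>The function \<open>v i\<close> stands for the pure weak derivative of order
  \<open>m\<close> in direction \<open>i\<close>. Integration by parts is demanded against tensor
  products only, and \<open>kernels\<close> records one bound for all kernels that occur.\<close>

locale smoothing =
  fixes m :: nat and M B :: real and u :: "real ^ 'n::finite \<Rightarrow> real" and v :: "'n \<Rightarrow> real ^ 'n \<Rightarrow> real"
  assumes m: "m \<ge> 1" and M: "M > 0"
    and kernels: "\<And>f :: 'n \<Rightarrow> real \<Rightarrow> real. (\<And>j. f j \<in> {profile m, profile2 m, profile_diff m}) \<Longrightarrow>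
        bounded_kernel M (tensor f)"
    and u: "ball_integrable u" and v: "\<And>i. ball_integrable (v i)"
    and bmo: "bmo_bounded B u"
    and weak: "\<And>i f a b. (\<And>j. smooth1 (f j)) \<Longrightarrow> (\<And>j t. t \<notin> {a $ j..b $ j} \<Longrightarrow> f j t = 0) \<Longrightarrow>
      (LINT y|lborel. u y * tensor (f(i := (deriv ^^ m) (f i))) y) = (-1) ^ m * (LINT y|lborel. v i y * tensor f y)"
begin

text \<open>Replacing the profile by its dilation one coordinate at a time, each step produces a pure derivative of order \<open>m\<close>.\<close>

definition mixed :: "'n set \<Rightarrow> real ^ 'n \<Rightarrow> real" where
  "mixed S = tensor (\<lambda>j. if j \<in> S then profile2 m else profile m)"

definition mixed_diff :: "'n \<Rightarrow> 'n set \<Rightarrow> real ^ 'n \<Rightarrow> real" where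
  "mixed_diff i S = tensor (\<lambda>j. if j = i then profile_diff m else if j \<in> S then profile2 m else profile m)"

lemma bounded_kernel_mixed: "bounded_kernel M (mixed S)"
  and bounded_kernel_mixed_diff: "bounded_kernel M (mixed_diff i S)"
  unfolding mixed_def mixed_diff_def by (rule kernels; simp)+

lemma integral_profile2: "integrable lborel (profile2 m)" "(LINT t|lborel. profile2 m t) = 1"
proof -
  have "has_bochner_integral lborel (profile m) 1"
    using integral_profile[OF m] by (simp add: has_bochner_integral_iff)
  then have "has_bochner_integral lborel (\<lambda>t. profile m (0 + (1 / 2) * t)) (1 /\<^sub>R \<bar>1 / 2\<bar>)"
    by (subst (asm) lborel_has_bochner_integral_real_affine_iff[where c = "1 / 2" and t = 0]) auto
  from has_bochner_integral_mult_left[OF this, of "1 / 2"]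
  have "has_bochner_integral lborel (profile2 m) 1"
    by (simp add: profile2_def[abs_def] mult.commute)
  then show "integrable lborel (profile2 m)" "(LINT t|lborel. profile2 m t) = 1"
    by (auto simp: has_bochner_integral_iff)
qed

lemma integral_mixed: "(LINT w|lborel. mixed S w) = 1"
  unfolding mixed_def
  by (subst integral_tensor(2)) (auto simp: integral_profile[OF m] integral_profile2 intro!: prod.neutral)

text \<open>Dilating every coordinate by 2 is the same as doubling the scale; the N factors 1/2 in
  \<open>profile2\<close> account for the changed normalisation. This closes the chain of
  coordinatewise dilations.\<close>

lemma pairing_double_scale:
  assumes "\<rho> > 0"
  shows "pairing (mixed {}) (2 * \<rho>) f x = pairing (mixed UNIV) \<rho> f x"
proof -
  have eq: "mixed UNIV (rescale \<rho> x y) = mixed {} (rescale (2 * \<rho>) x y) / 2 ^ CARD('n)" for y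
  proof -
    have "rescale (2 * \<rho>) x y $ j = rescale \<rho> x y $ j / 2" for j
      using assms by (simp add: rescale_def)
    then have "mixed {} (rescale (2 * \<rho>) x y) = (\<Prod>j\<in>UNIV. profile m (rescale \<rho> x y $ j / 2))"
      by (simp only: mixed_def tensor_def empty_iff if_False)
    then show ?thesis
      by (simp add: mixed_def tensor_def profile2_def prod_dividef)
  qed
  show ?thesis
    unfolding pairing_def eq by (simp add: power_mult_distrib)
qed

text \<open>Dilating the single coordinate \<open>i\<close> changes the kernel by a pure
  \<open>m\<close>-th derivative of \<open>mixed_diff i S\<close>. Moving it to \<open>u\<close>
  yields \<open>(-1) ^ m\<close> from the weak derivative and \<open>\<rho> ^ m\<close> from the
  chain rule.\<close>

lemma pairing_mixed_step:
  assumes i: "i \<notin> S" and \<rho>: "\<rho> > 0"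
  shows "pairing (mixed S) \<rho> u x - pairing (mixed (insert i S)) \<rho> u x = (- \<rho>) ^ m * pairing (mixed_diff i S) \<rho> (v i) x"
proof -
  define F where "F = (\<lambda>j. if j = i then profile_diff m else if j \<in> S then profile2 m else profile m)"
  \<comment> \<open>Translation by \<open>x\<close> and dilation by \<rho> are absorbed into the
    one-variable factors, so the rescaled kernel is itself a tensor product and can serve as test
    function.\<close>
  define f where "f = (\<lambda>j t. F j ((1 / \<rho>) * t + (- x $ j / \<rho>)))"
  have F: "smooth1 (F j)" for j
    by (simp add: F_def smooth1_profile smooth1_profile2 smooth1_profile_diff)
  then have f: "smooth1 (f j)" for j unfolding f_def by (rule smooth1_affine)
  have F0: "F j t = 0" if "t \<notin> {1..4}" for j t
    using that profile_eq_0[OF m, of t] profile_eq_0[OF m, of "t / 2"] profile_diff_eq_0[of t m]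
    by (auto simp: F_def profile2_def)
  have f0: "f j t = 0" if "t \<notin> {(\<chi> j. x $ j + \<rho>) $ j..(\<chi> j. x $ j + 4 * \<rho>) $ j}" for j t
    unfolding f_def using that \<rho> by (intro F0) (auto simp: field_simps)
  have arg: "(1 / \<rho>) * y $ j + (- x $ j / \<rho>) = rescale \<rho> x y $ j" for y j
    by (simp add: rescale_def diff_divide_distrib)
  have tf: "tensor f y = mixed_diff i S (rescale \<rho> x y)" for y
    unfolding tensor_def f_def arg mixed_diff_def F_def ..
  have tf': "tensor (f(i := (deriv ^^ m) (f i))) y =
      (1 / \<rho>) ^ m * (mixed S (rescale \<rho> x y) - mixed (insert i S) (rescale \<rho> x y))" for y
  proof -
    let ?w = "rescale \<rho> x y"
    let ?P = "\<Prod>j\<in>UNIV - {i}. F j (?w $ j)"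
    have 1: "mixed S ?w = profile m (?w $ i) * ?P" "mixed (insert i S) ?w = profile2 m (?w $ i) * ?P"
      unfolding mixed_def tensor_def F_def using i
      by (subst prod.remove[of UNIV i]; auto intro!: prod.cong)+
    have "(deriv ^^ m) (f i) (y $ i) = (1 / \<rho>) ^ m * (deriv ^^ m) (profile_diff m) (?w $ i)"
      unfolding f_def higher_deriv_affine[OF F] arg by (simp add: F_def)
    also have "\<dots> = (1 / \<rho>) ^ m * (profile m (?w $ i) - profile2 m (?w $ i))"
      by (simp add: higher_deriv_profile_diff[OF m] profile2_def)
    finally have 2: "(deriv ^^ m) (f i) (y $ i) = (1 / \<rho>) ^ m * (profile m (?w $ i) - profile2 m (?w $ i))" .
    have "tensor (f(i := (deriv ^^ m) (f i))) y = (deriv ^^ m) (f i) (y $ i) * ?P"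
      unfolding tensor_fun_upd f_def arg ..
    then show ?thesis unfolding 1 2 by (simp add: algebra_simps)
  qed
  have "(1 / \<rho>) ^ m * (LINT y|lborel. u y * (mixed S (rescale \<rho> x y) - mixed (insert i S) (rescale \<rho> x y)))
     = (-1) ^ m * (LINT y|lborel. v i y * mixed_diff i S (rescale \<rho> x y))"
  proof -
    have "(LINT y|lborel. u y * tensor (f(i := (deriv ^^ m) (f i))) y) = (-1) ^ m * (LINT y|lborel. v i y * tensor f y)"
      by (rule weak[of f, OF f f0])
    then show ?thesis
      unfolding tf tf' mult.left_commute[of "u _"] integral_mult_right_zero .
  qed
  then have "(LINT y|lborel. u y * (mixed S (rescale \<rho> x y) - mixed (insert i S) (rescale \<rho> x y)))
     = \<rho> ^ m * ((-1) ^ m * (LINT y|lborel. v i y * mixed_diff i S (rescale \<rho> x y)))"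
    using \<rho> by (simp add: power_divide field_simps)
  then show ?thesis
    by (subst pairing_diff_eq[OF u bounded_kernel_mixed bounded_kernel_mixed \<rho>])
       (simp add: pairing_def power_mult_distrib[symmetric] mult.assoc[symmetric])
qed

text \<open>Induction over the set of dilated coordinates, each contributing one
  \<open>pairing_mixed_step\<close>. The difference between \<open>x\<close> and \<open>z\<close> is
  kept throughout, since the factor \<open>min 1 (dist x z / \<rho>)\<close> inside \<open>c\<close>
  would be lost otherwise.\<close>

lemma mixed_oscillation_sobolev:
  assumes \<rho>: "\<rho> > 0"
    and c: "\<And>i S. \<bar>pairing (mixed_diff i S) \<rho> (v i) x - pairing (mixed_diff i S) \<rho> (v i) z\<bar> \<le> c"
  shows "\<bar>(pairing (mixed {}) \<rho> u x - pairing (mixed UNIV) \<rho> u x)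
      - (pairing (mixed {}) \<rho> u z - pairing (mixed UNIV) \<rho> u z)\<bar> \<le> real CARD('n) * (\<rho> ^ m * c)"
proof -
  have "\<bar>(pairing (mixed {}) \<rho> u x - pairing (mixed S) \<rho> u x)
      - (pairing (mixed {}) \<rho> u z - pairing (mixed S) \<rho> u z)\<bar> \<le> real (card S) * (\<rho> ^ m * c)" if "finite S" for S
    using that
  proof (induction S)
    case (insert i S)
    let ?d = "pairing (mixed_diff i S) \<rho> (v i) x - pairing (mixed_diff i S) \<rho> (v i) z"
    have "\<bar>(- \<rho>) ^ m * ?d\<bar> = \<rho> ^ m * \<bar>?d\<bar>" using \<rho> by (simp add: abs_mult power_abs)
    also have "\<dots> \<le> \<rho> ^ m * c" using \<rho> c by (intro mult_left_mono) auto
    finally have 1: "\<bar>(- \<rho>) ^ m * ?d\<bar> \<le> \<rho> ^ m * c" .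
    have 2: "(pairing (mixed S) \<rho> u x - pairing (mixed (insert i S)) \<rho> u x)
        - (pairing (mixed S) \<rho> u z - pairing (mixed (insert i S)) \<rho> u z) = (- \<rho>) ^ m * ?d"
      unfolding pairing_mixed_step[OF insert(2) \<rho>] by (simp add: right_diff_distrib)
    have "real (card (insert i S)) * (\<rho> ^ m * c) = real (card S) * (\<rho> ^ m * c) + \<rho> ^ m * c"
      using insert by (simp add: algebra_simps)
    then show ?case using insert(3) 1 2 by linarith
  qed simp
  from this[of UNIV] show ?thesis by simp
qed

lemma B_nonneg: "B \<ge> 0" using bmo by (simp add: bmo_bounded_def)

text \<open>Translates of a kernel have equal mass, so their difference has mean zero; it lives in a
  cube of side \<open>10 * N * \<rho>\<close>. Besides the nearby case of
  \<open>osc_step_bmo\<close>, this bound shows that oscillations vanish at large scales.\<close>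

lemma mixed_oscillation_bmo:
  assumes \<rho>: "\<rho> > 0" and xz: "dist x z \<le> \<rho>"
  shows "\<bar>pairing (mixed S) \<rho> u x - pairing (mixed S) \<rho> u z\<bar>
     \<le> M * (10 * real CARD('n)) ^ CARD('n) * (dist x z / \<rho>) * B"
proof -
  let ?N = "CARD('n)"
  let ?R = "5 * real ?N * \<rho>"
  have [measurable]: "mixed S \<in> borel_measurable borel" by (rule bounded_kernel_measurable[OF bounded_kernel_mixed])
  have i: "integrable lborel (\<lambda>y. mixed S (rescale \<rho> a y))" for a
    by (rule integrable_bounded_support[OF _ bounded_kernel_rescale[OF bounded_kernel_mixed \<rho>]]) auto
  have "(LINT y|lborel. mixed S (rescale \<rho> x y) - mixed S (rescale \<rho> z y)) = 0"
    using i by (simp add: integral_rescale \<rho>)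
  then have "\<bar>LINT y|lborel. u y * (mixed S (rescale \<rho> x y) - mixed S (rescale \<rho> z y))\<bar>
      \<le> M * (dist x z / \<rho>) * (2 * ?R) ^ ?N * B"
    using M \<rho> by (intro integral_mult_bmo_bound[OF u bmo _ bounded_kernel_rescale_diff[OF bounded_kernel_mixed \<rho> xz]]) auto
  also have "\<dots> = M * (10 * real ?N) ^ ?N * (dist x z / \<rho>) * B * \<rho> ^ ?N"
  proof -
    have "2 * ?R = 10 * real ?N * \<rho>" by simp
    then show ?thesis by (simp only: power_mult_distrib mult_ac)
  qed
  finally show ?thesis
    unfolding pairing_diff_eq[OF u bounded_kernel_mixed bounded_kernel_mixed \<rho>]
    using \<rho> by (simp add: pos_divide_le_eq del: times_divide_eq_right)
qed

text \<open>All mixed kernels have mass one, so two of them at the same base point differ by a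
  mean-zero kernel.\<close>

lemma mixed_scale_bmo:
  assumes \<rho>: "\<rho> > 0"
  shows "\<bar>pairing (mixed S) \<rho> u x - pairing (mixed T) \<rho> u x\<bar>
     \<le> 2 * M * (10 * real CARD('n)) ^ CARD('n) * B"
proof -
  let ?N = "CARD('n)"
  let ?R = "5 * real ?N * \<rho>"
  have [measurable]: "mixed S \<in> borel_measurable borel" for S by (rule bounded_kernel_measurable[OF bounded_kernel_mixed])
  have i: "integrable lborel (\<lambda>y. mixed S (rescale \<rho> a y))" for a S
    by (rule integrable_bounded_support[OF _ bounded_kernel_rescale[OF bounded_kernel_mixed \<rho>]]) auto
  have "(LINT y|lborel. mixed S (rescale \<rho> x y) - mixed T (rescale \<rho> x y)) = 0"
    using i by (simp add: integral_rescale \<rho> integral_mixed)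
  moreover have "\<bar>mixed S (rescale \<rho> x y) - mixed T (rescale \<rho> x y)\<bar> \<le> 2 * M * indicator (cball x ?R) y" for y
    using bounded_kernel_rescale[OF bounded_kernel_mixed \<rho>, of S x y]
      bounded_kernel_rescale[OF bounded_kernel_mixed \<rho>, of T x y] by linarith
  ultimately have "\<bar>LINT y|lborel. u y * (mixed S (rescale \<rho> x y) - mixed T (rescale \<rho> x y))\<bar>
      \<le> 2 * M * (2 * ?R) ^ ?N * B"
    using M \<rho> by (intro integral_mult_bmo_bound[OF u bmo]) auto
  also have "\<dots> = 2 * M * (10 * real ?N) ^ ?N * B * \<rho> ^ ?N"
  proof -
    have "2 * ?R = 10 * real ?N * \<rho>" by simp
    then show ?thesis by (simp only: power_mult_distrib mult_ac)
  qed
  finally show ?thesis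
    unfolding pairing_diff_eq[OF u bounded_kernel_mixed bounded_kernel_mixed \<rho>]
    using \<rho> by (simp add: pos_divide_le_eq)
qed

definition osc :: "real ^ 'n \<Rightarrow> real ^ 'n \<Rightarrow> real \<Rightarrow> real" where
  "osc x z \<rho> = pairing (mixed {}) \<rho> u x - pairing (mixed {}) \<rho> u z"

text \<open>A common constant for both step bounds: 4 comes from two points with kernels of size
  \<open>2 * M\<close>, the factor \<open>CARD('n)\<close> from the coordinatewise dilations, and
  the power from the volume of a cube of side \<open>10 * N * \<rho>\<close> relative to
  \<open>\<rho> ^ N\<close>.\<close>

definition osc_const :: real where
  "osc_const = 4 * real CARD('n) * M * (10 * real CARD('n)) ^ CARD('n)"

lemma osc_const_pos: "osc_const > 0" using M by (simp add: osc_const_def)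

lemma osc_step:
  assumes \<rho>: "\<rho> > 0"
  shows "osc x z \<rho> - osc x z (2 * \<rho>) = (pairing (mixed {}) \<rho> u x - pairing (mixed UNIV) \<rho> u x)
      - (pairing (mixed {}) \<rho> u z - pairing (mixed UNIV) \<rho> u z)"
  unfolding osc_def pairing_double_scale[OF \<rho>] by simp

text \<open>The step is a combination of four pairings that can be grouped in two ways: the same
  kernel at \<open>x\<close> and \<open>z\<close>, which gains \<open>dist x z / \<rho>\<close> for
  nearby points, or two kernels at the same point, which is bounded uniformly.\<close>

lemma osc_step_bmo:
  assumes \<rho>: "\<rho> > 0"
  shows "\<bar>osc x z \<rho> - osc x z (2 * \<rho>)\<bar> \<le> osc_const * min 1 (dist x z / \<rho>) * B"
proof -
  let ?N = "CARD('n)"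
  let ?K = "M * (10 * real ?N) ^ ?N"
  have K: "?K \<ge> 0" using M by simp
  have le: "4 * ?K \<le> osc_const"
  proof -
    have "real ?N \<ge> 1" by (simp add: Suc_leI)
    then have "1 * (4 * ?K) \<le> real ?N * (4 * ?K)" using K by (intro mult_right_mono) auto
    then show ?thesis by (simp add: osc_const_def mult_ac)
  qed
  show ?thesis
  proof (cases "dist x z \<le> \<rho>")
    case True
    then have t: "dist x z / \<rho> \<le> 1" "0 \<le> dist x z / \<rho>" using \<rho> by auto
    have "\<bar>osc x z \<rho> - osc x z (2 * \<rho>)\<bar> \<le> ?K * (dist x z / \<rho>) * B + ?K * (dist x z / \<rho>) * B"
      unfolding osc_step[OF \<rho>]
      by (rule abs_diff_diff_le; rule mixed_oscillation_bmo[OF \<rho> True])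
    also have "\<dots> = 2 * ?K * ((dist x z / \<rho>) * B)" by (simp add: algebra_simps)
    also have "\<dots> \<le> osc_const * ((dist x z / \<rho>) * B)"
      using le K t B_nonneg by (intro mult_right_mono mult_nonneg_nonneg) auto
    also have "\<dots> = osc_const * min 1 (dist x z / \<rho>) * B" unfolding min_absorb2[OF t(1)] by simp
    finally show ?thesis .
  next
    case False
    then have t: "1 \<le> dist x z / \<rho>" using \<rho> by (simp add: pos_le_divide_eq)
    have "\<bar>osc x z \<rho> - osc x z (2 * \<rho>)\<bar> \<le> 2 * M * (10 * real ?N) ^ ?N * B + 2 * M * (10 * real ?N) ^ ?N * B"
      unfolding osc_step[OF \<rho>]
      using mixed_scale_bmo[OF \<rho>, of "{}" x UNIV] mixed_scale_bmo[OF \<rho>, of "{}" z UNIV] by linarith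
    also have "\<dots> = 4 * ?K * B" by (simp add: algebra_simps)
    also have "\<dots> \<le> osc_const * B" using le B_nonneg by (rule mult_right_mono)
    finally show ?thesis unfolding min_absorb1[OF t] by simp
  qed
qed

lemma osc_step_sobolev:
  assumes \<rho>: "\<rho> > 0"
    and gx: "\<And>i R. R > 0 \<Longrightarrow> (\<integral>\<^sup>+y. ennreal \<bar>v i y\<bar> * indicator (cball x R) y \<partial>lborel) \<le> ennreal (R ^ CARD('n) * gx)"
    and gz: "\<And>i R. R > 0 \<Longrightarrow> (\<integral>\<^sup>+y. ennreal \<bar>v i y\<bar> * indicator (cball z R) y \<partial>lborel) \<le> ennreal (R ^ CARD('n) * gz)"
    and nonneg: "gx \<ge> 0" "gz \<ge> 0"
  shows "\<bar>osc x z \<rho> - osc x z (2 * \<rho>)\<bar> \<le> osc_const * min 1 (dist x z / \<rho>) * (\<rho> ^ m * (gx + gz))"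
proof -
  let ?N = "CARD('n)"
  have mn: "min 1 (dist x z / \<rho>) \<ge> 0" using \<rho> by simp
  have "\<bar>osc x z \<rho> - osc x z (2 * \<rho>)\<bar> \<le>
      real ?N * (\<rho> ^ m * (M * (5 * real ?N) ^ ?N * min 1 (dist x z / \<rho>) * (gx + gz)))"
    unfolding osc_step[OF \<rho>]
    by (intro mixed_oscillation_sobolev[OF \<rho>] pairing_oscillation_le[OF v bounded_kernel_mixed_diff \<rho>] gx gz nonneg)
  also have "\<dots> = (real ?N * M * (5 * real ?N) ^ ?N) * (min 1 (dist x z / \<rho>) * (\<rho> ^ m * (gx + gz)))"
    by (simp only: mult_ac)
  also have "\<dots> \<le> osc_const * (min 1 (dist x z / \<rho>) * (\<rho> ^ m * (gx + gz)))"
  proof (rule mult_right_mono)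
    have "(5 * real ?N) ^ ?N \<le> (10 * real ?N) ^ ?N" by (intro power_mono) auto
    then have "real ?N * M * (5 * real ?N) ^ ?N \<le> real ?N * M * (10 * real ?N) ^ ?N"
      using M by (intro mult_left_mono) auto
    also have "\<dots> \<le> 4 * (real ?N * M * (10 * real ?N) ^ ?N)" using M by simp
    finally show "real ?N * M * (5 * real ?N) ^ ?N \<le> osc_const" by (simp add: osc_const_def mult_ac)
    show "0 \<le> min 1 (dist x z / \<rho>) * (\<rho> ^ m * (gx + gz))"
      using mn \<rho> nonneg by (intro mult_nonneg_nonneg) auto
  qed
  finally show ?thesis by (simp only: mult.assoc)
qed

text \<open>The weight \<open>a / m\<close> on the Sobolev bound turns \<open>\<rho> ^ m\<close>
  into \<open>\<rho> powr a\<close>. The two fractions in the constant are geometric sums, with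
  ratio \<open>2 powr - a\<close> for scales below \<open>dist x z\<close> and
  \<open>2 powr (a - 1)\<close> for scales above it.\<close>

theorem pointwise_interpolation:
  assumes a: "0 < a" "a < 1" and xz: "x \<noteq> z"
    and lp: "lebesgue_point u x" "lebesgue_point u z"
    and gx: "\<And>i R. R > 0 \<Longrightarrow> (\<integral>\<^sup>+y. ennreal \<bar>v i y\<bar> * indicator (cball x R) y \<partial>lborel) \<le> ennreal (R ^ CARD('n) * gx)"
    and gz: "\<And>i R. R > 0 \<Longrightarrow> (\<integral>\<^sup>+y. ennreal \<bar>v i y\<bar> * indicator (cball z R) y \<partial>lborel) \<le> ennreal (R ^ CARD('n) * gz)"
    and nonneg: "gx \<ge> 0" "gz \<ge> 0"
  shows "\<bar>u x - u z\<bar> \<le> osc_const * (1 / (1 - 2 powr - a) + 1 / (1 - 2 powr (a - 1))) *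
     (dist x z powr a * (B powr (1 - a / m) * (gx + gz) powr (a / m)))"
proof -
  define r where "r = dist x z"
  have r: "r > 0" using xz by (simp add: r_def)
  define W where "W = B powr (1 - a / m) * (gx + gz) powr (a / m)"
  have W: "W \<ge> 0" by (simp add: W_def)
  have th: "0 < a / m" "a / m < 1"
  proof -
    have "real m \<ge> 1" using m by simp
    then show "0 < a / m" "a / m < 1" using a by (auto simp: divide_less_eq)
  qed
  have step: "\<bar>osc x z \<rho> - osc x z (2 * \<rho>)\<bar> \<le> osc_const * min 1 (r / \<rho>) * (\<rho> powr a * W)" if \<rho>: "\<rho> > 0" for \<rho>
  proof -
    have "r / \<rho> > 0" using r \<rho> by simp
    then have "osc_const * min 1 (r / \<rho>) > 0" using osc_const_pos by simp
    then have "\<bar>osc x z \<rho> - osc x z (2 * \<rho>)\<bar> \<le>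
       osc_const * min 1 (r / \<rho>) * (B powr (1 - a / m) * (\<rho> ^ m * (gx + gz)) powr (a / m))"
      using osc_step_bmo[OF \<rho>, of x z] osc_step_sobolev[OF \<rho> gx gz nonneg] th
      unfolding r_def by (intro interpolate_bounds) auto
    also have "(\<rho> ^ m * (gx + gz)) powr (a / m) = \<rho> powr a * (gx + gz) powr (a / m)"
    proof -
      have "(\<rho> ^ m) powr (a / m) = \<rho> powr a"
        using \<rho> m by (simp add: powr_realpow[symmetric] powr_powr)
      then show ?thesis using \<rho> nonneg by (simp add: powr_mult)
    qed
    finally show ?thesis by (simp add: W_def mult_ac)
  qed
  \<comment> \<open>Scales shrink from \<open>r\<close> to 0, where the Lebesgue points identify the
    limit; the minimum is simply bounded by 1.\<close>
  have down: "\<bar>osc x z r - (u x - u z)\<bar> \<le> osc_const * (r powr a * W) / (1 - 2 powr - a)"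
  proof -
    let ?d = "\<lambda>n. osc x z (r * (1 / 2) ^ n)"
    have "\<bar>?d 0 - (u x - u z)\<bar> \<le> osc_const * (r powr a * W) / (1 - 2 powr - a)"
    proof (rule geometric_telescope)
      fix n
      \<comment> \<open>A step between consecutive scales is measured at the smaller one, hence
        \<open>Suc n\<close>; the extra power of the ratio is discarded below.\<close>
      let ?\<rho> = "r * (1 / 2) ^ Suc n"
      have \<rho>: "?\<rho> > 0" using r by simp
      have "\<bar>?d (Suc n) - ?d n\<bar> = \<bar>osc x z ?\<rho> - osc x z (2 * ?\<rho>)\<bar>" by simp
      also have "\<dots> \<le> osc_const * min 1 (r / ?\<rho>) * (?\<rho> powr a * W)" by (rule step[OF \<rho>])
      also have "\<dots> \<le> osc_const * 1 * (?\<rho> powr a * W)"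
        using osc_const_pos W by (intro mult_right_mono mult_left_mono) auto
      also have "?\<rho> powr a = r powr a * (2 powr - a) ^ Suc n"
      proof -
        have "((1 / 2) ^ Suc n) powr a = (2 powr - a) ^ Suc n"
          by (simp only: powr_realpow[symmetric] powr_powr zero_less_divide_1_iff zero_less_numeral powr_gt_zero)
             (simp add: powr_realpow[symmetric] powr_powr powr_minus powr_divide field_simps flip: powr_minus_divide)
        then show ?thesis using r by (simp only: powr_mult)
      qed
      also have "osc_const * 1 * (r powr a * (2 powr - a) ^ Suc n * W)
          \<le> osc_const * (r powr a * W) * (2 powr - a) ^ n"
      proof -
        have "(2 powr - a) ^ Suc n \<le> (2 powr - a) ^ n"
          using a by (intro power_decreasing) (auto intro!: two_powr_le_one)
        then have "osc_const * (r powr a * W) * (2 powr - a) ^ Suc n \<le> osc_const * (r powr a * W) * (2 powr - a) ^ n"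
          using osc_const_pos W by (intro mult_left_mono mult_nonneg_nonneg) auto
        then show ?thesis by (simp only: mult_ac mult_1_right mult_1_left)
      qed
      finally show "\<bar>?d (Suc n) - ?d n\<bar> \<le> osc_const * (r powr a * W) * (2 powr - a) ^ n" .
    next
      have K: "((\<lambda>\<rho>. pairing (mixed {}) \<rho> u y) \<longlongrightarrow> u y) (at_right 0)" if "lebesgue_point u y" for y
      proof (rule pairing_tendsto[OF u that bounded_kernel_mixed M integral_mixed])
        fix w assume "mixed {} w \<noteq> 0"
        then have "profile m (w $ j) \<noteq> 0" for j by (auto simp: mixed_def tensor_def)
        then have "w $ j \<in> {1..2}" for j using profile_eq_0[OF m, of "w $ j"] by blast
        then have "w $ j \<in> {0..2}" for j by (meson atLeastatMost_subset_iff order_refl subsetD zero_le_one)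
        then show "w \<in> cbox 0 (2 *\<^sub>R One)"
        proof (unfold mem_box, intro ballI)
          fix b :: "real ^ 'n" assume b: "b \<in> Basis"
          then obtain j where j: "b = axis j 1" by (auto simp: Basis_vec_def)
          have "w \<bullet> b = w $ j" by (simp add: j inner_axis)
          moreover have "(2 *\<^sub>R One) \<bullet> b = 2" using b by simp
          ultimately show "0 \<bullet> b \<le> w \<bullet> b \<and> w \<bullet> b \<le> (2 *\<^sub>R One) \<bullet> b"
            using \<open>w $ j \<in> {0..2}\<close> by simp
        qed
      qed
      have "(\<lambda>n. r * (1 / 2) ^ n) \<longlonglongrightarrow> r * 0"
        by (intro tendsto_mult tendsto_const LIMSEQ_realpow_zero) auto
      then have "filterlim (\<lambda>n. r * (1 / 2) ^ n) (at_right 0) sequentially"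
        using r by (auto simp: filterlim_at)
      from filterlim_compose[OF K[OF lp(1)] this] filterlim_compose[OF K[OF lp(2)] this]
      show "?d \<longlonglongrightarrow> u x - u z" unfolding osc_def by (rule tendsto_diff)
    qed (use a in \<open>auto intro!: two_powr_less_one\<close>)
    then show ?thesis by simp
  qed
  \<comment> \<open>Scales grow from \<open>r\<close>. The minimum supplies
    \<open>1 / 2 ^ n\<close>, outweighing the growth of \<open>\<rho> powr a\<close>, and the BMO
    bound forces the oscillation to 0, so no contribution remains at infinity.\<close>
  have up: "\<bar>osc x z r\<bar> \<le> osc_const * (r powr a * W) / (1 - 2 powr (a - 1))"
  proof -
    let ?d = "\<lambda>n. osc x z (r * 2 ^ n)"
    have "\<bar>?d 0 - 0\<bar> \<le> osc_const * (r powr a * W) / (1 - 2 powr (a - 1))"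
    proof (rule geometric_telescope)
      fix n
      let ?\<rho> = "r * 2 ^ n"
      have \<rho>: "?\<rho> > 0" using r by simp
      have "\<bar>?d (Suc n) - ?d n\<bar> = \<bar>osc x z ?\<rho> - osc x z (2 * ?\<rho>)\<bar>" by (simp add: mult_ac abs_minus_commute)
      also have "\<dots> \<le> osc_const * min 1 (r / ?\<rho>) * (?\<rho> powr a * W)" by (rule step[OF \<rho>])
      also have "\<dots> \<le> osc_const * (1 / 2 ^ n) * (?\<rho> powr a * W)"
        using osc_const_pos W r by (intro mult_right_mono mult_left_mono) auto
      also have "?\<rho> powr a = r powr a * (2 powr a) ^ n"
        using r by (simp add: powr_mult powr_realpow[symmetric] powr_powr mult.commute)
      also have "osc_const * (1 / 2 ^ n) * (r powr a * (2 powr a) ^ n * W) = osc_const * (r powr a * W) * ((2 powr a) / 2) ^ n"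
        by (simp add: power_divide)
      also have "(2 powr a) / 2 = (2::real) powr (a - 1)" by (simp add: powr_diff)
      finally show "\<bar>?d (Suc n) - ?d n\<bar> \<le> osc_const * (r powr a * W) * (2 powr (a - 1)) ^ n" .
    next
      let ?K = "M * (10 * real CARD('n)) ^ CARD('n) * B"
      have "\<bar>?d n\<bar> \<le> ?K * (1 / 2) ^ n" for n
      proof -
        have "r * 1 \<le> r * 2 ^ n" using r by (intro mult_left_mono) auto
        then have "dist x z \<le> r * 2 ^ n" by (simp add: r_def)
        from mixed_oscillation_bmo[OF _ this, of "{}"] show ?thesis
          using r unfolding osc_def r_def[symmetric] by (simp add: power_divide mult_ac)
      qed
      moreover have "(\<lambda>n. ?K * (1 / 2) ^ n) \<longlonglongrightarrow> ?K * 0"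
        by (intro tendsto_mult tendsto_const LIMSEQ_realpow_zero) auto
      ultimately show "?d \<longlonglongrightarrow> 0"
        by (intro Lim_null_comparison[of ?d "\<lambda>n. ?K * (1 / 2) ^ n"]) auto
    qed (use a in \<open>auto intro!: two_powr_less_one\<close>)
    then show ?thesis by simp
  qed
  have "\<bar>u x - u z\<bar> \<le> osc_const * (r powr a * W) / (1 - 2 powr - a) + osc_const * (r powr a * W) / (1 - 2 powr (a - 1))"
    using down up by linarith
  also have "\<dots> = osc_const * (1 / (1 - 2 powr - a) + 1 / (1 - 2 powr (a - 1))) * (r powr a * W)"
    by (simp add: algebra_simps)
  finally show ?thesis by (simp only: r_def W_def)
qed

end

section \<open>Integrals of powers of the norm\<close>

definition annulus :: "real \<Rightarrow> 'a::euclidean_space set" where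
  "annulus t = {y. t / 2 < norm y \<and> norm y \<le> t}"

lemma annulus_in_sets [measurable]: "annulus t \<in> sets borel"
  unfolding annulus_def by measurable

text \<open>On the annulus \<open>norm y / t\<close> lies between 1/2 and 1, so the integrand is
  comparable to a constant; the absolute value of \<open>e\<close> makes one constant fit both
  signs.\<close>

lemma nn_integral_powr_annulus:
  fixes t e :: real
  assumes t: "t > 0"
  shows "(\<integral>\<^sup>+y. ennreal (norm (y :: 'a::euclidean_space) powr (e - DIM('a))) * indicator (annulus t) y \<partial>lborel)
     \<le> ennreal (2 powr (\<bar>e\<bar> + DIM('a)) * unit_ball_vol (real DIM('a)) * t powr e)"
proof -
  let ?N = "real DIM('a)"
  let ?c = "2 powr (\<bar>e\<bar> + ?N) * t powr (e - ?N)"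
  have "norm y powr (e - ?N) \<le> ?c" if "y \<in> annulus t" for y :: 'a
  proof -
    define s where "s = norm y / t"
    have s: "s > 1 / 2" "s \<le> 1" "norm y = s * t"
      using that t by (auto simp: s_def annulus_def field_simps)
    have "s powr (e - ?N) \<le> s powr - (\<bar>e\<bar> + ?N)"
      using s by (intro powr_mono') auto
    also have "\<dots> \<le> (1 / 2) powr - (\<bar>e\<bar> + ?N)"
      using s by (intro powr_mono2') auto
    also have "\<dots> = 2 powr (\<bar>e\<bar> + ?N)" by (simp only: powr_minus powr_divide powr_one_eq_one) simp
    finally have "s powr (e - ?N) * t powr (e - ?N) \<le> ?c" by (intro mult_right_mono) auto
    then show ?thesis using s t by (simp add: powr_mult)
  qed
  then have "(\<integral>\<^sup>+y. ennreal (norm (y :: 'a) powr (e - ?N)) * indicator (annulus t) y \<partial>lborel)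
      \<le> (\<integral>\<^sup>+y. ennreal ?c * indicator (cball (0 :: 'a) t) y \<partial>lborel)"
    by (intro nn_integral_mono) (auto simp: indicator_def annulus_def intro!: ennreal_leI)
  also have "\<dots> = ennreal ?c * emeasure lborel (cball (0 :: 'a) t)"
    by (rule nn_integral_cmult_indicator) measurable
  also have "\<dots> = ennreal (?c * (unit_ball_vol ?N * t powr ?N))"
    using t by (simp add: emeasure_cball powr_realpow ennreal_mult)
  also have "?c * (unit_ball_vol ?N * t powr ?N) = 2 powr (\<bar>e\<bar> + ?N) * unit_ball_vol ?N * t powr e"
    using t by (simp add: powr_diff)
  finally show ?thesis .
qed

text \<open>Covering is required only where \<open>f\<close> is non-zero: the origin lies in no
  annulus of positive radius, but negative powers of the norm take the value 0 there.\<close>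

lemma nn_integral_annuli:
  fixes T :: "nat \<Rightarrow> real" and f :: "'a::euclidean_space \<Rightarrow> ennreal"
  assumes [measurable]: "f \<in> borel_measurable borel"
    and cover: "\<And>y. f y \<noteq> 0 \<Longrightarrow> y \<in> S \<Longrightarrow> \<exists>n. y \<in> annulus (T n)"
    and le: "\<And>n. (\<integral>\<^sup>+y. f y * indicator (annulus (T n)) y \<partial>lborel) \<le> ennreal (c * q ^ n)"
    and q: "0 \<le> q" "q < 1" and c: "c \<ge> 0"
  shows "(\<integral>\<^sup>+y. f y * indicator S y \<partial>lborel) \<le> ennreal (c / (1 - q))"
proof -
  have "(\<integral>\<^sup>+y. f y * indicator S y \<partial>lborel) \<le>
     (\<integral>\<^sup>+y. (\<integral>\<^sup>+n. f y * indicator (annulus (T n)) y \<partial>count_space UNIV) \<partial>lborel)"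
  proof (rule nn_integral_mono)
    fix y
    show "f y * indicator S y \<le> (\<integral>\<^sup>+n. f y * indicator (annulus (T n)) y \<partial>count_space UNIV)"
    proof (cases "f y \<noteq> 0 \<and> y \<in> S")
      case True
      then obtain n where "y \<in> annulus (T n)" using cover by blast
      then have "f y * indicator S y = f y * indicator (annulus (T n)) y" using True by simp
      also have "\<dots> \<le> (\<integral>\<^sup>+n. f y * indicator (annulus (T n)) y \<partial>count_space UNIV)"
        by (rule nn_integral_ge_point) simp
      finally show ?thesis .
    qed auto
  qed
  also have "\<dots> = (\<integral>\<^sup>+n. (\<integral>\<^sup>+y. f y * indicator (annulus (T n)) y \<partial>lborel) \<partial>count_space UNIV)"
    by (rule nn_integral_count_space_nn_integral) (auto intro!: borel_measurable_times_ennreal borel_measurable_indicator)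
  also have "\<dots> \<le> (\<integral>\<^sup>+n. ennreal (c * q ^ n) \<partial>count_space UNIV)"
    by (intro nn_integral_mono le)
  also have "\<dots> = (\<Sum>n. ennreal (c * q ^ n))" by (rule nn_integral_count_space_nat)
  also have "\<dots> = ennreal (c * (1 / (1 - q)))"
    using q c by (intro suminf_ennreal_eq sums_mult geometric_sums) auto
  finally show ?thesis by simp
qed

lemma nn_integral_powr_inside:
  assumes e: "(e::real) > 0"
  shows "\<exists>C>0. \<forall>R>0. (\<integral>\<^sup>+y. ennreal (norm (y :: 'a::euclidean_space) powr (e - DIM('a))) * indicator (cball 0 R) y \<partial>lborel)
     \<le> ennreal (C * R powr e)"
proof -
  define K where "K = 2 powr (\<bar>e\<bar> + DIM('a)) * unit_ball_vol (real DIM('a))"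
  have K: "K > 0" by (simp add: K_def)
  let ?q = "(2::real) powr - e"
  have q: "0 \<le> ?q" "?q < 1" using e by (auto intro!: two_powr_less_one)
  have "(\<integral>\<^sup>+y. ennreal (norm (y :: 'a) powr (e - DIM('a))) * indicator (cball 0 R) y \<partial>lborel)
     \<le> ennreal (K / (1 - ?q) * R powr e)" if R: "R > 0" for R
  proof -
    have "(\<integral>\<^sup>+y. ennreal (norm (y :: 'a) powr (e - DIM('a))) * indicator (cball 0 R) y \<partial>lborel)
      \<le> ennreal (K * R powr e / (1 - ?q))"
    proof (rule nn_integral_annuli[where T = "\<lambda>n. R / 2 ^ n"])
      fix y :: 'a assume y: "ennreal (norm y powr (e - DIM('a))) \<noteq> 0" "y \<in> cball 0 R"
      then have y0: "norm y > 0" by auto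
      then obtain n0 where n0: "(1 / 2) ^ n0 < norm y / R"
        using real_arch_pow_inv[of "norm y / R" "1 / 2"] R by auto
      have ex: "R / 2 ^ Suc n0 < norm y"
      proof -
        have "(1 / 2) ^ n0 * R < norm y" using n0 R by (simp add: pos_less_divide_eq)
        moreover have "R / 2 ^ Suc n0 \<le> (1 / 2) ^ n0 * R" using R by (simp add: power_divide field_simps)
        ultimately show ?thesis by linarith
      qed
      \<comment> \<open>Minimality of the index provides the outer bound of the annulus, the
        defining property its inner bound.\<close>
      define n where "n = (LEAST n. R / 2 ^ Suc n < norm y)"
      have 1: "R / 2 ^ Suc n < norm y" unfolding n_def by (rule LeastI[of _ n0]) (rule ex)
      have 2: "norm y \<le> R / 2 ^ n"
      proof (cases n)
        case 0
        then show ?thesis using y by simp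
      next
        case (Suc k)
        then have "\<not> R / 2 ^ Suc k < norm y" using not_less_Least[of k "\<lambda>n. R / 2 ^ Suc n < norm y"] n_def by simp
        then show ?thesis using Suc by simp
      qed
      show "\<exists>n. y \<in> annulus (R / 2 ^ n)"
        using 1 2 by (intro exI[of _ n]) (simp add: annulus_def mult.commute)
    next
      fix n
      have "(\<integral>\<^sup>+y. ennreal (norm (y :: 'a) powr (e - DIM('a))) * indicator (annulus (R / 2 ^ n)) y \<partial>lborel)
        \<le> ennreal (K * (R / 2 ^ n) powr e)"
        unfolding K_def using R by (intro nn_integral_powr_annulus) auto
      also have "(R / 2 ^ n) powr e = R powr e * ?q ^ n"
      proof -
        have 1: "(2 ^ n) powr e = (2::real) powr (real n * e)" by (simp add: powr_realpow[symmetric] powr_powr)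
        have 2: "?q ^ n = (2::real) powr (- (real n * e))" by (simp add: powr_realpow[symmetric] powr_powr mult.commute)
        have 3: "(R / 2 ^ n) powr e = R powr e / (2 ^ n) powr e" by (rule powr_divide)
        show ?thesis unfolding 1 2 3 by (simp add: powr_minus divide_inverse)
      qed
      finally show "(\<integral>\<^sup>+y. ennreal (norm (y :: 'a) powr (e - DIM('a))) * indicator (annulus (R / 2 ^ n)) y \<partial>lborel)
        \<le> ennreal (K * R powr e * ?q ^ n)" by (simp add: mult_ac)
    qed (use q K R in auto)
    then show ?thesis by (simp add: mult_ac)
  qed
  moreover have "K / (1 - ?q) > 0" using K q by simp
  ultimately show ?thesis by blast
qed

lemma nn_integral_powr_outside:
  assumes e: "(e::real) > 0"
  shows "\<exists>C>0. \<forall>R>0. (\<integral>\<^sup>+y. ennreal (norm (y :: 'a::euclidean_space) powr (- e - DIM('a))) * indicator (- cball 0 R) y \<partial>lborel)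
     \<le> ennreal (C * R powr - e)"
proof -
  define K where "K = 2 powr (\<bar>- e\<bar> + DIM('a)) * unit_ball_vol (real DIM('a))"
  have K: "K > 0" by (simp add: K_def)
  let ?q = "(2::real) powr - e"
  have q: "0 \<le> ?q" "?q < 1" using e by (auto intro!: two_powr_less_one)
  have "(\<integral>\<^sup>+y. ennreal (norm (y :: 'a) powr (- e - DIM('a))) * indicator (- cball 0 R) y \<partial>lborel)
     \<le> ennreal (K / (1 - ?q) * R powr - e)" if R: "R > 0" for R
  proof -
    have "(\<integral>\<^sup>+y. ennreal (norm (y :: 'a) powr (- e - DIM('a))) * indicator (- cball 0 R) y \<partial>lborel)
      \<le> ennreal (K * R powr - e / (1 - ?q))"
    \<comment> \<open>An annulus is named by its outer radius, so \<open>Suc n\<close> makes the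
      innermost one begin at \<open>R\<close>.\<close>
    proof (rule nn_integral_annuli[where T = "\<lambda>n. R * 2 ^ Suc n"])
      fix y :: 'a assume y: "y \<in> - cball 0 R"
      obtain n0 where n0: "norm y / R < 2 ^ n0"
        using real_arch_pow[of 2 "norm y / R"] by auto
      have ex: "norm y \<le> R * 2 ^ Suc n0"
      proof -
        have "norm y < 2 ^ n0 * R" using n0 R by (simp add: pos_divide_less_eq)
        moreover have "2 ^ n0 * R \<le> R * 2 ^ Suc n0" using R by simp
        ultimately show ?thesis by linarith
      qed
      define n where "n = (LEAST n. norm y \<le> R * 2 ^ Suc n)"
      have 1: "norm y \<le> R * 2 ^ Suc n" unfolding n_def by (rule LeastI[of _ n0]) (rule ex)
      have 2: "R * 2 ^ n < norm y"
      proof (cases n)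
        case 0
        then show ?thesis using y by simp
      next
        case (Suc k)
        then have "\<not> norm y \<le> R * 2 ^ Suc k" using not_less_Least[of k "\<lambda>n. norm y \<le> R * 2 ^ Suc n"] n_def by simp
        then show ?thesis using Suc by simp
      qed
      show "\<exists>n. y \<in> annulus (R * 2 ^ Suc n)"
        using 1 2 by (intro exI[of _ n]) (simp add: annulus_def)
    next
      fix n
      have "(\<integral>\<^sup>+y. ennreal (norm (y :: 'a) powr (- e - DIM('a))) * indicator (annulus (R * 2 ^ Suc n)) y \<partial>lborel)
        \<le> ennreal (K * (R * 2 ^ Suc n) powr - e)"
        unfolding K_def using R by (intro nn_integral_powr_annulus) auto
      also have "(R * 2 ^ Suc n) powr - e = R powr - e * ?q ^ Suc n"
      proof -
        have "(2 ^ Suc n) powr - e = (2::real) powr (real (Suc n) * - e)"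
          by (simp only: powr_realpow[symmetric] powr_powr zero_less_numeral)
        moreover have "?q ^ Suc n = (2::real) powr (real (Suc n) * - e)"
          by (simp only: powr_realpow[symmetric] powr_powr powr_gt_zero mult.commute)
        ultimately show ?thesis using R by (simp only: powr_mult)
      qed
      also have "ennreal (K * (R powr - e * ?q ^ Suc n)) \<le> ennreal (K * R powr - e * ?q ^ n)"
      proof (intro ennreal_leI)
        have "?q ^ Suc n \<le> ?q ^ n" using q by (intro power_decreasing) auto
        then have "K * R powr - e * ?q ^ Suc n \<le> K * R powr - e * ?q ^ n"
          using K by (intro mult_left_mono) auto
        then show "K * (R powr - e * ?q ^ Suc n) \<le> K * R powr - e * ?q ^ n" by (simp only: mult.assoc)
      qed
      finally show "(\<integral>\<^sup>+y. ennreal (norm (y :: 'a) powr (- e - DIM('a))) * indicator (annulus (R * 2 ^ Suc n)) y \<partial>lborel)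
        \<le> ennreal (K * R powr - e * ?q ^ n)" .
    qed (use q K R in auto)
    then show ?thesis by (simp add: mult_ac)
  qed
  moreover have "K / (1 - ?q) > 0" using K q by simp
  ultimately show ?thesis by blast
qed

text \<open>The pointwise bounds for two exponents at once: the exponent above \<sigma> will serve
  near the diagonal and the one below \<sigma> far from it.\<close>

definition majorant :: "real \<Rightarrow> real \<Rightarrow> real \<Rightarrow> real \<Rightarrow> real \<Rightarrow> real \<Rightarrow> real" where
  "majorant m a b B r G =
     min (r powr a * (B powr (1 - a / m) * G powr (a / m))) (r powr b * (B powr (1 - b / m) * G powr (b / m)))"

lemma majorant_nonneg: "majorant m a b B r G \<ge> 0"
  by (simp add: majorant_def)

lemma majorant_mono:
  "0 \<le> G \<Longrightarrow> G \<le> G' \<Longrightarrow> 0 \<le> a / m \<Longrightarrow> 0 \<le> b / m \<Longrightarrow> majorant m a b B r G \<le> majorant m a b B r G'"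
  unfolding majorant_def by (intro min.mono mult_left_mono powr_mono2) auto

text \<open>The integral is split at the radius where the two bounds coincide; the larger exponent
  makes the inner part converge and the smaller one the outer part.\<close>

lemma nn_integral_majorant:
  assumes par: "m > 0" "0 < b" "b < \<sigma>" "\<sigma> < a" "p > 0"
  shows "\<exists>C>0. \<forall>B>0. \<forall>G\<ge>0.
    (\<integral>\<^sup>+y. ennreal (majorant m a b B (norm (y :: 'a::euclidean_space)) G powr p / norm y powr (\<sigma> * p + DIM('a))) \<partial>lborel)
      \<le> ennreal (C * (B powr (p - \<sigma> * p / m) * G powr (\<sigma> * p / m)))"
proof -
  let ?N = "real DIM('a)"
  define e1 where "e1 = (a - \<sigma>) * p"
  define e2 where "e2 = (\<sigma> - b) * p"
  have e: "e1 > 0" "e2 > 0" using par by (auto simp: e1_def e2_def)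
  obtain C1 where C1: "C1 > 0" "\<And>R. R > 0 \<Longrightarrow>
     (\<integral>\<^sup>+y. ennreal (norm (y :: 'a) powr (e1 - ?N)) * indicator (cball 0 R) y \<partial>lborel) \<le> ennreal (C1 * R powr e1)"
    using nn_integral_powr_inside[OF e(1), where ?'a = 'a] by blast
  obtain C2 where C2: "C2 > 0" "\<And>R. R > 0 \<Longrightarrow>
     (\<integral>\<^sup>+y. ennreal (norm (y :: 'a) powr (- e2 - ?N)) * indicator (- cball 0 R) y \<partial>lborel) \<le> ennreal (C2 * R powr - e2)"
    using nn_integral_powr_outside[OF e(2), where ?'a = 'a] by blast
  have main: "(\<integral>\<^sup>+y. ennreal (majorant m a b B (norm (y :: 'a)) G powr p / norm y powr (\<sigma> * p + ?N)) \<partial>lborel)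
      \<le> ennreal ((C1 + C2) * (B powr (p - \<sigma> * p / m) * G powr (\<sigma> * p / m)))" if B: "B > 0" and G: "G \<ge> 0" for B G
  proof (cases "G = 0")
    case True
    then have "majorant m a b B r G = 0" for r
      using par by (simp add: majorant_def)
    then show ?thesis using par by simp
  next
    case False
    then have G: "G > 0" using G by simp
    \<comment> \<open>At this radius \<open>R powr c * B powr (1 - c / m) * G powr (c / m)\<close>
      equals \<open>B\<close> for every exponent \<open>c\<close>.\<close>
    define R where "R = (B / G) powr (1 / m)"
    have R: "R > 0" using B G by (simp add: R_def)
    define X where "X c = B powr (1 - c / m) * G powr (c / m)" for c
    have X: "X c > 0" for c using B G by (simp add: X_def)
    \<comment> \<open>Independent of \<open>c\<close>, so the inner and outer parts carry the same
      powers of \<open>B\<close> and \<open>G\<close> and only \<open>C1 + C2\<close>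
      remains.\<close>
    have balance: "X c powr p * R powr ((c - \<sigma>) * p) = B powr (p - \<sigma> * p / m) * G powr (\<sigma> * p / m)" for c
    proof -
      have "X c powr p * R powr ((c - \<sigma>) * p) =
        (B powr ((1 - c / m) * p) * G powr (c / m * p)) * (B powr (1 / m * ((c - \<sigma>) * p)) / G powr (1 / m * ((c - \<sigma>) * p)))"
        using B G by (simp add: X_def R_def powr_mult powr_powr powr_divide)
      also have "\<dots> = (B powr ((1 - c / m) * p) * B powr (1 / m * ((c - \<sigma>) * p))) * (G powr (c / m * p) / G powr (1 / m * ((c - \<sigma>) * p)))"
        by simp
      also have "\<dots> = B powr ((1 - c / m) * p + 1 / m * ((c - \<sigma>) * p)) * G powr (c / m * p - 1 / m * ((c - \<sigma>) * p))"
        by (simp only: powr_add powr_diff)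
      also have "(1 - c / m) * p + 1 / m * ((c - \<sigma>) * p) = p - \<sigma> * p / m"
        using par by (simp add: field_simps)
      also have "c / m * p - 1 / m * ((c - \<sigma>) * p) = \<sigma> * p / m"
        using par by (simp add: field_simps)
      finally show ?thesis .
    qed
    have pw: "majorant m a b B (norm y) G powr p / norm y powr (\<sigma> * p + ?N) \<le> X c powr p * norm y powr ((c - \<sigma>) * p - ?N)"
      if "c = a \<or> c = b" for c and y :: 'a
    proof (cases "y = 0")
      case False
      have "majorant m a b B (norm y) G \<le> norm y powr c * X c"
        using that by (auto simp: majorant_def X_def)
      then have "majorant m a b B (norm y) G powr p \<le> (norm y powr c * X c) powr p"
        using par by (intro powr_mono2 majorant_nonneg) auto
      also have "\<dots> = norm y powr (c * p) * X c powr p"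
        using X[of c] by (simp add: powr_mult powr_powr less_imp_le)
      finally have "majorant m a b B (norm y) G powr p / norm y powr (\<sigma> * p + ?N)
        \<le> norm y powr (c * p) * X c powr p / norm y powr (\<sigma> * p + ?N)" by (intro divide_right_mono) auto
      also have "\<dots> = X c powr p * norm y powr (c * p - (\<sigma> * p + ?N))"
        using False by (simp add: powr_diff)
      also have "c * p - (\<sigma> * p + ?N) = (c - \<sigma>) * p - ?N" by (simp add: algebra_simps)
      finally show ?thesis .
    qed (simp)
    have "(\<integral>\<^sup>+y. ennreal (majorant m a b B (norm (y :: 'a)) G powr p / norm y powr (\<sigma> * p + ?N)) \<partial>lborel)
      \<le> (\<integral>\<^sup>+y. ennreal (X a powr p) * (ennreal (norm (y :: 'a) powr (e1 - ?N)) * indicator (cball 0 R) y) +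
            ennreal (X b powr p) * (ennreal (norm y powr (- e2 - ?N)) * indicator (- cball 0 R) y) \<partial>lborel)"
    proof (rule nn_integral_mono)
      fix y :: 'a
      have e2': "- e2 = (b - \<sigma>) * p" by (simp add: e2_def algebra_simps)
      show "ennreal (majorant m a b B (norm y) G powr p / norm y powr (\<sigma> * p + ?N)) \<le>
         ennreal (X a powr p) * (ennreal (norm y powr (e1 - ?N)) * indicator (cball 0 R) y) +
         ennreal (X b powr p) * (ennreal (norm y powr (- e2 - ?N)) * indicator (- cball 0 R) y)"
      proof (cases "y \<in> cball 0 R")
        case True
        then show ?thesis using pw[of a y]
          by (simp add: e1_def ennreal_mult[symmetric] ennreal_leI)
      next
        case False
        then show ?thesis using pw[of b y]
          by (simp add: e2' ennreal_mult[symmetric] ennreal_leI)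
      qed
    qed
    also have "\<dots> = ennreal (X a powr p) * (\<integral>\<^sup>+y. ennreal (norm (y :: 'a) powr (e1 - ?N)) * indicator (cball 0 R) y \<partial>lborel) +
       ennreal (X b powr p) * (\<integral>\<^sup>+y. ennreal (norm (y :: 'a) powr (- e2 - ?N)) * indicator (- cball 0 R) y \<partial>lborel)"
    proof -
      have [measurable]: "- cball (0 :: 'a) R \<in> sets borel"
        by (intro borel_open) auto
      define f1 f2 where "f1 y = ennreal (norm (y :: 'a) powr (e1 - ?N)) * indicator (cball 0 R) y"
        and "f2 y = ennreal (norm (y :: 'a) powr (- e2 - ?N)) * indicator (- cball 0 R) y" for y
      have [measurable]: "f1 \<in> borel_measurable borel" "f2 \<in> borel_measurable borel"
        unfolding f1_def[abs_def] f2_def[abs_def] by measurable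
      have "(\<integral>\<^sup>+y. ennreal (X a powr p) * f1 y + ennreal (X b powr p) * f2 y \<partial>lborel) =
         ennreal (X a powr p) * (\<integral>\<^sup>+y. f1 y \<partial>lborel) + ennreal (X b powr p) * (\<integral>\<^sup>+y. f2 y \<partial>lborel)"
        by (simp add: nn_integral_add nn_integral_cmult)
      then show ?thesis unfolding f1_def f2_def .
    qed
    also have "\<dots> \<le> ennreal (X a powr p) * ennreal (C1 * R powr e1) + ennreal (X b powr p) * ennreal (C2 * R powr - e2)"
      by (intro add_mono mult_left_mono C1 C2 R) auto
    also have "\<dots> = ennreal (X a powr p * (C1 * R powr e1) + X b powr p * (C2 * R powr - e2))"
      using C1 C2 by (simp add: ennreal_mult[symmetric] ennreal_plus[symmetric] del: ennreal_plus)
    also have "X a powr p * (C1 * R powr e1) + X b powr p * (C2 * R powr - e2) =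
        C1 * (X a powr p * R powr ((a - \<sigma>) * p)) + C2 * (X b powr p * R powr ((b - \<sigma>) * p))"
    proof -
      have "- e2 = (b - \<sigma>) * p" by (simp add: e2_def algebra_simps)
      then show ?thesis by (simp add: e1_def mult_ac)
    qed
    also have "\<dots> = (C1 + C2) * (B powr (p - \<sigma> * p / m) * G powr (\<sigma> * p / m))"
      unfolding balance by (simp add: distrib_right)
    finally show ?thesis .
  qed
  then show ?thesis using C1(1) C2(1) by (intro exI[of _ "C1 + C2"]) auto
qed

lemma nn_integral_lborel_translate:
  fixes f :: "'a::euclidean_space \<Rightarrow> ennreal"
  assumes [measurable]: "f \<in> borel_measurable borel"
  shows "(\<integral>\<^sup>+x. f (x - z) \<partial>lborel) = (\<integral>\<^sup>+y. f y \<partial>lborel)"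
proof -
  have "(\<integral>\<^sup>+y. f y \<partial>lborel) = (\<integral>\<^sup>+y. f y \<partial>distr lborel borel ((+) (- z)))"
    by (simp add: lborel_distr_plus)
  also have "\<dots> = (\<integral>\<^sup>+x. f (- z + x) \<partial>lborel)"
    by (rule nn_integral_distr) auto
  finally show ?thesis by simp
qed

section \<open>The Gagliardo integral\<close>

text \<open>Replacing \<open>g x + g z\<close> by twice the larger value splits the integrand into
  two terms, each involving \<open>g\<close> at one end point only. The other variable is integrated
  out by translation invariance, and Fubini with symmetry reduces one term to the other. The
  predicate \<open>E\<close> marks the points of full measure at which the pointwise bound is
  available.\<close>

lemma double_integral_le:
  fixes m \<sigma> a b p :: real
  assumes par: "m > 0" "0 < b" "b < \<sigma>" "\<sigma> < a" "p > 0"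
  shows "\<exists>C>0. \<forall>(u :: 'a::euclidean_space \<Rightarrow> real) g B K E. B > 0 \<longrightarrow> K \<ge> 0 \<longrightarrow>
     u \<in> borel_measurable borel \<longrightarrow> g \<in> borel_measurable borel \<longrightarrow> (\<forall>x. g x \<ge> 0) \<longrightarrow> (AE x in lborel. E x) \<longrightarrow>
     (\<forall>x z. E x \<longrightarrow> E z \<longrightarrow> x \<noteq> z \<longrightarrow> \<bar>u x - u z\<bar> \<le> K * majorant m a b B (dist x z) (g x + g z)) \<longrightarrow>
     (\<integral>\<^sup>+z. (\<integral>\<^sup>+x. ennreal (\<bar>u x - u z\<bar> powr p / norm (x - z) powr (\<sigma> * p + DIM('a))) \<partial>lborel) \<partial>lborel)
       \<le> ennreal (C * K powr p * B powr (p - \<sigma> * p / m)) * (\<integral>\<^sup>+x. ennreal (g x powr (\<sigma> * p / m)) \<partial>lborel)"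
proof -
  let ?N = "real DIM('a)" and ?q = "\<sigma> * p / m"
  obtain C where C: "C > 0" "\<And>B G. B > 0 \<Longrightarrow> G \<ge> 0 \<Longrightarrow>
      (\<integral>\<^sup>+y. ennreal (majorant m a b B (norm (y :: 'a)) G powr p / norm y powr (\<sigma> * p + ?N)) \<partial>lborel)
      \<le> ennreal (C * (B powr (p - ?q) * G powr ?q))"
    using nn_integral_majorant[OF par, where ?'a = 'a] by blast
  have "(\<integral>\<^sup>+z. (\<integral>\<^sup>+x. ennreal (\<bar>u x - u z\<bar> powr p / norm (x - z) powr (\<sigma> * p + ?N)) \<partial>lborel) \<partial>lborel)
       \<le> ennreal (2 * C * 2 powr ?q * K powr p * B powr (p - ?q)) * (\<integral>\<^sup>+x. ennreal (g x powr ?q) \<partial>lborel)"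
    if B: "B > 0" and K: "K \<ge> 0" and [measurable]: "u \<in> borel_measurable borel" "g \<in> borel_measurable borel"
      and g: "\<forall>x. g x \<ge> 0" and E: "AE x in lborel. E x"
      and pw: "\<forall>x z. E x \<longrightarrow> E z \<longrightarrow> x \<noteq> z \<longrightarrow> \<bar>u x - u z\<bar> \<le> K * majorant m a b B (dist x z) (g x + g z)"
    for u :: "'a \<Rightarrow> real" and g B K E
  proof -
    define \<Psi> where "\<Psi> y G = ennreal (majorant m a b B (norm (y :: 'a)) G powr p / norm y powr (\<sigma> * p + ?N))" for y G
    have [measurable]: "case_prod \<Psi> \<in> borel_measurable (borel \<Otimes>\<^sub>M borel)"
      unfolding \<Psi>_def[abs_def] majorant_def by measurable
    have \<Psi>m: "(\<lambda>y. \<Psi> y G) \<in> borel_measurable borel" for G by measurable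
    have point: "ennreal (\<bar>u x - u z\<bar> powr p / norm (x - z) powr (\<sigma> * p + ?N))
        \<le> ennreal (K powr p) * (\<Psi> (x - z) (2 * g x) + \<Psi> (x - z) (2 * g z))" if "E x" "E z" for x z
    proof (cases "x = z")
      case False
      let ?H = "\<lambda>G. majorant m a b B (norm (x - z)) G"
      let ?D = "norm (x - z) powr (\<sigma> * p + ?N)"
      have "\<bar>u x - u z\<bar> \<le> K * ?H (g x + g z)" using pw that False by (simp add: dist_norm)
      also have "\<dots> \<le> K * ?H (2 * max (g x) (g z))"
        using K g par by (intro mult_left_mono majorant_mono) (auto simp: max_def add_increasing)
      finally have "\<bar>u x - u z\<bar> powr p \<le> (K * ?H (2 * max (g x) (g z))) powr p"
        using par by (intro powr_mono2) auto
      also have "\<dots> = K powr p * ?H (2 * max (g x) (g z)) powr p"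
        using K by (simp add: powr_mult majorant_nonneg)
      \<comment> \<open>The maximum is one of its two arguments and the term for the other is
        non-negative.\<close>
      also have "\<dots> \<le> K powr p * (?H (2 * g x) powr p + ?H (2 * g z) powr p)"
        by (intro mult_left_mono) (auto simp: max_def)
      finally have "\<bar>u x - u z\<bar> powr p / ?D \<le> K powr p * (?H (2 * g x) powr p + ?H (2 * g z) powr p) / ?D"
        by (intro divide_right_mono) auto
      also have "\<dots> = K powr p * (?H (2 * g x) powr p / ?D + ?H (2 * g z) powr p / ?D)"
        by (simp only: add_divide_distrib times_divide_eq_right distrib_left)
      finally have "ennreal (\<bar>u x - u z\<bar> powr p / ?D) \<le> ennreal (K powr p * (?H (2 * g x) powr p / ?D + ?H (2 * g z) powr p / ?D))"
        by (rule ennreal_leI)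
      also have "\<dots> = ennreal (K powr p) * (\<Psi> (x - z) (2 * g x) + \<Psi> (x - z) (2 * g z))"
        unfolding \<Psi>_def by (simp add: ennreal_mult)
      finally show ?thesis .
    qed simp
    have G: "(\<integral>\<^sup>+y. \<Psi> y (2 * g z) \<partial>lborel) \<le> ennreal (C * 2 powr ?q * B powr (p - ?q)) * ennreal (g z powr ?q)" for z
    proof -
      have "(\<integral>\<^sup>+y. \<Psi> y (2 * g z) \<partial>lborel) \<le> ennreal (C * (B powr (p - ?q) * (2 * g z) powr ?q))"
        unfolding \<Psi>_def using B g by (intro C(2)) auto
      also have "C * (B powr (p - ?q) * (2 * g z) powr ?q) = (C * 2 powr ?q * B powr (p - ?q)) * g z powr ?q"
        using g by (simp add: powr_mult)
      finally show ?thesis using C(1) by (simp add: ennreal_mult)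
    qed
    let ?I = "\<integral>\<^sup>+x. ennreal (g x powr ?q) \<partial>lborel" and ?c = "ennreal (C * 2 powr ?q * B powr (p - ?q))"
    have I2: "(\<integral>\<^sup>+z. (\<integral>\<^sup>+x. \<Psi> (x - z) (2 * g z) \<partial>lborel) \<partial>lborel) \<le> ?c * ?I"
    proof -
      have "(\<integral>\<^sup>+z. (\<integral>\<^sup>+x. \<Psi> (x - z) (2 * g z) \<partial>lborel) \<partial>lborel) = (\<integral>\<^sup>+z. (\<integral>\<^sup>+y. \<Psi> y (2 * g z) \<partial>lborel) \<partial>lborel)"
        by (intro nn_integral_cong nn_integral_lborel_translate \<Psi>m)
      also have "\<dots> \<le> (\<integral>\<^sup>+z. ?c * ennreal (g z powr ?q) \<partial>lborel)"
        by (intro nn_integral_mono G)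
      also have "\<dots> = ?c * ?I" by (rule nn_integral_cmult) measurable
      finally show ?thesis .
    qed
    have I1: "(\<integral>\<^sup>+z. (\<integral>\<^sup>+x. \<Psi> (x - z) (2 * g x) \<partial>lborel) \<partial>lborel) \<le> ?c * ?I"
    proof -
      have "(\<integral>\<^sup>+z. (\<integral>\<^sup>+x. \<Psi> (x - z) (2 * g x) \<partial>lborel) \<partial>lborel) = (\<integral>\<^sup>+x. (\<integral>\<^sup>+z. \<Psi> (x - z) (2 * g x) \<partial>lborel) \<partial>lborel)"
        by (rule lborel_pair.Fubini') measurable
      also have "\<dots> = (\<integral>\<^sup>+z. (\<integral>\<^sup>+x. \<Psi> (x - z) (2 * g z) \<partial>lborel) \<partial>lborel)"
        by (simp add: \<Psi>_def norm_minus_commute)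
      finally show ?thesis using I2 by simp
    qed
    have "(\<integral>\<^sup>+z. (\<integral>\<^sup>+x. ennreal (\<bar>u x - u z\<bar> powr p / norm (x - z) powr (\<sigma> * p + ?N)) \<partial>lborel) \<partial>lborel)
      \<le> (\<integral>\<^sup>+z. (\<integral>\<^sup>+x. ennreal (K powr p) * (\<Psi> (x - z) (2 * g x) + \<Psi> (x - z) (2 * g z)) \<partial>lborel) \<partial>lborel)"
    proof (rule nn_integral_mono_AE, use E in eventually_elim)
      fix z assume z: "E z"
      show "(\<integral>\<^sup>+x. ennreal (\<bar>u x - u z\<bar> powr p / norm (x - z) powr (\<sigma> * p + ?N)) \<partial>lborel)
        \<le> (\<integral>\<^sup>+x. ennreal (K powr p) * (\<Psi> (x - z) (2 * g x) + \<Psi> (x - z) (2 * g z)) \<partial>lborel)"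
        by (rule nn_integral_mono_AE, use E in eventually_elim) (rule point[OF _ z])
    qed
    also have "\<dots> = ennreal (K powr p) * ((\<integral>\<^sup>+z. (\<integral>\<^sup>+x. \<Psi> (x - z) (2 * g x) \<partial>lborel) \<partial>lborel) +
         (\<integral>\<^sup>+z. (\<integral>\<^sup>+x. \<Psi> (x - z) (2 * g z) \<partial>lborel) \<partial>lborel))"
      by (simp add: nn_integral_cmult nn_integral_add)
    also have "\<dots> \<le> ennreal (K powr p) * (?c * ?I + ?c * ?I)"
      by (intro mult_left_mono add_mono I1 I2) auto
    also have "\<dots> = ennreal (2 * C * 2 powr ?q * K powr p * B powr (p - ?q)) * ?I"
    proof -
      have "ennreal (2 * C * 2 powr ?q * K powr p * B powr (p - ?q)) = ennreal (K powr p) * (?c + ?c)"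
        using C(1) by (simp add: ennreal_mult[symmetric] ennreal_plus[symmetric] mult_ac del: ennreal_plus)
      then show ?thesis by (simp add: distrib_right mult.assoc)
    qed
    finally show ?thesis .
  qed
  then show ?thesis using C(1) by (intro exI[of _ "2 * C * 2 powr ?q"]) (auto simp: mult_ac)
qed

text \<open>The sum is at most the number of terms times its largest term, whose power is one of the
  summands on the right.\<close>

lemma sum_powr_le:
  fixes c :: "'i \<Rightarrow> real"
  assumes "finite I" "\<And>i. i \<in> I \<Longrightarrow> c i \<ge> 0" "q \<ge> 0"
  shows "(\<Sum>i\<in>I. c i) powr q \<le> real (card I) powr q * (\<Sum>i\<in>I. c i powr q)"
proof (cases "I = {}")
  case False
  define M where "M = Max (c ` I)"
  obtain k where k: "k \<in> I" "M = c k"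
  proof -
    have "Max (c ` I) \<in> c ` I" using assms(1) False by (intro Max_in) auto
    then show ?thesis using that unfolding M_def by blast
  qed
  have "(\<Sum>i\<in>I. c i) \<le> (\<Sum>i\<in>I. M)"
    unfolding M_def using assms(1) by (intro sum_mono Max_ge) auto
  then have "(\<Sum>i\<in>I. c i) powr q \<le> (real (card I) * M) powr q"
    using assms by (intro powr_mono2 sum_nonneg) auto
  also have "\<dots> = real (card I) powr q * c k powr q"
    using k assms by (simp add: powr_mult)
  also have "\<dots> \<le> real (card I) powr q * (\<Sum>i\<in>I. c i powr q)"
    using k assms by (intro mult_left_mono member_le_sum) auto
  finally show ?thesis .
qed simp

text \<open>The estimate for Borel data, before roots are taken. The constant is fixed ahead of
  \<open>u\<close>, \<open>v\<close> and \<open>B\<close>, so every constant produced inside the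
  locale must be made explicit beforehand.\<close>

theorem gagliardo_bmo_sobolev:
  fixes m :: nat and s p :: real
  assumes m: "m \<ge> 1" and s: "0 < s" "s < 1 / real m" and p: "1 \<le> p" "1 < s * p"
  shows "\<exists>C>0. \<forall>(u :: real ^ 'n::finite \<Rightarrow> real) v B. B > 0 \<longrightarrow> ball_integrable u \<longrightarrow> (\<forall>i. ball_integrable (v i)) \<longrightarrow>
    bmo_bounded B u \<longrightarrow>
    (\<forall>i f a b. (\<forall>j. smooth1 (f j)) \<longrightarrow> (\<forall>j t. t \<notin> {a $ j..b $ j} \<longrightarrow> f j t = 0) \<longrightarrow>
      (LINT y|lborel. u y * tensor (f(i := (deriv ^^ m) (f i))) y) = (-1) ^ m * (LINT y|lborel. v i y * tensor f y)) \<longrightarrow>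
    (\<forall>i. (\<integral>\<^sup>+x. ennreal (\<bar>v i x\<bar> powr (s * p)) \<partial>lborel) < \<infinity>) \<longrightarrow>
    (\<integral>\<^sup>+z. (\<integral>\<^sup>+x. ennreal (\<bar>u x - u z\<bar> powr p / norm (x - z) powr (real m * s * p + real CARD('n))) \<partial>lborel) \<partial>lborel)
      \<le> ennreal (C * B powr (p - s * p)) * (\<Sum>i\<in>UNIV. \<integral>\<^sup>+x. ennreal (\<bar>v i x\<bar> powr (s * p)) \<partial>lborel)"
proof -
  let ?N = "CARD('n)" and ?q = "s * p"
  define \<sigma> where "\<sigma> = real m * s"
  \<comment> \<open>The midpoints of the intervals from \<sigma> to 1 and from 0 to \<sigma> are
    convenient choices for the two exponents.\<close>
  define a where "a = (1 + \<sigma>) / 2"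
  define b where "b = \<sigma> / 2"
  have \<sigma>: "0 < \<sigma>" "\<sigma> < 1" using m s by (auto simp: \<sigma>_def field_simps)
  have ab: "0 < b" "b < \<sigma>" "\<sigma> < a" "a < 1" "b < 1" "0 < a" using \<sigma> by (auto simp: a_def b_def)
  have mpos: "real m > 0" using m by simp
  have p0: "p > 0" using p by simp
  have q: "\<sigma> * p / real m = ?q" using m by (simp add: \<sigma>_def)
  obtain M where M: "M > 0" "\<And>f :: 'n \<Rightarrow> real \<Rightarrow> real. (\<And>j. f j \<in> {profile m, profile2 m, profile_diff m}) \<Longrightarrow> bounded_kernel M (tensor f)"
    using exists_kernel_bound[OF m, where ?'n = 'n] by blast
  obtain C1 where C1: "C1 > 0" and C1': "\<And>(u :: real ^ 'n \<Rightarrow> real) g B K E. B > 0 \<Longrightarrow> K \<ge> 0 \<Longrightarrow>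
     u \<in> borel_measurable borel \<Longrightarrow> g \<in> borel_measurable borel \<Longrightarrow> (\<forall>x. g x \<ge> 0) \<Longrightarrow> (AE x in lborel. E x) \<Longrightarrow>
     (\<forall>x z. E x \<longrightarrow> E z \<longrightarrow> x \<noteq> z \<longrightarrow> \<bar>u x - u z\<bar> \<le> K * majorant (real m) a b B (dist x z) (g x + g z)) \<Longrightarrow>
     (\<integral>\<^sup>+z. (\<integral>\<^sup>+x. ennreal (\<bar>u x - u z\<bar> powr p / norm (x - z) powr (\<sigma> * p + real ?N)) \<partial>lborel) \<partial>lborel)
       \<le> ennreal (C1 * K powr p * B powr (p - ?q)) * (\<integral>\<^sup>+x. ennreal (g x powr ?q) \<partial>lborel)"
    using double_integral_le[OF mpos ab(1,2,3) p0, where ?'a = "real ^ 'n"] unfolding q by auto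
  define A where "A = 2 * 5 ^ ?N * unit_ball_vol (real ?N) * ?q * (2 * unit_ball_vol (real ?N)) powr (?q - 1) / (?q - 1)"
  have A: "A > 0"
  proof -
    have w: "unit_ball_vol (real ?N) > 0" by simp
    then have pw: "(2 * unit_ball_vol (real ?N)) powr (?q - 1) > 0" by (subst powr_gt_zero) linarith
    show ?thesis unfolding A_def using s p by (intro divide_pos_pos mult_pos_pos pw w) auto
  qed
  have maxfun_le: "(\<integral>\<^sup>+x. ennreal (enn2real (maxfun f x) powr ?q) \<partial>lborel) \<le> ennreal A * (\<integral>\<^sup>+x. ennreal (\<bar>f x\<bar> powr ?q) \<partial>lborel)"
    if "f \<in> borel_measurable borel" for f :: "real ^ 'n \<Rightarrow> real"
    using maxfun_strong_type[OF that p(2)] by (simp add: A_def)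
  \<comment> \<open>This is the value of \<open>osc_const\<close>, written out because
    \<open>smoothing\<close> is interpreted only after \<open>u\<close> is fixed; it depends on
    nothing but the dimension and \<open>M\<close>.\<close>
  define c0 where "c0 = 4 * real ?N * M * (10 * real ?N) ^ ?N"
  define h where "h e = c0 * (1 / (1 - 2 powr - e) + 1 / (1 - 2 powr (e - 1)))" for e :: real
  have h: "h e > 0" if "0 < e" "e < 1" for e
    using that M(1) two_powr_less_one[of "- e"] two_powr_less_one[of "e - 1"] by (simp add: h_def c0_def add_pos_pos)
  define K where "K = max (h a) (h b)"
  have K: "K > 0" "h a \<le> K" "h b \<le> K" using h[of a] ab by (auto simp: K_def)
  define C where "C = C1 * K powr p * ((real ?N powr ?q * (2 ^ ?N) powr ?q) * A)"
  have "C > 0" using C1 K A by (simp add: C_def)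
  moreover have "(\<integral>\<^sup>+z. (\<integral>\<^sup>+x. ennreal (\<bar>u x - u z\<bar> powr p / norm (x - z) powr (\<sigma> * p + real ?N)) \<partial>lborel) \<partial>lborel)
      \<le> ennreal (C * B powr (p - ?q)) * (\<Sum>i\<in>UNIV. \<integral>\<^sup>+x. ennreal (\<bar>v i x\<bar> powr ?q) \<partial>lborel)"
    if B: "B > 0" and u: "ball_integrable u" and v: "\<forall>i. ball_integrable (v i)" and bmo: "bmo_bounded B u"
      and weak: "\<forall>i f a b. (\<forall>j. smooth1 (f j)) \<longrightarrow> (\<forall>j t. t \<notin> {a $ j..b $ j} \<longrightarrow> f j t = 0) \<longrightarrow>
      (LINT y|lborel. u y * tensor (f(i := (deriv ^^ m) (f i))) y) = (-1) ^ m * (LINT y|lborel. v i y * tensor f y)"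
      and fin: "\<forall>i. (\<integral>\<^sup>+x. ennreal (\<bar>v i x\<bar> powr ?q) \<partial>lborel) < \<infinity>"
    for u :: "real ^ 'n \<Rightarrow> real" and v B
  proof -
    interpret smoothing m M B u v
      by unfold_locales (use m M u v bmo weak in blast)+
    have [measurable]: "u \<in> borel_measurable borel" "v i \<in> borel_measurable borel" for i
      using u v by (auto simp: ball_integrable_def)
    \<comment> \<open>Summing over directions gives one function dominating the averages of all
      \<open>v i\<close>; \<open>2 ^ N\<close> is the cost of dyadic radii from
      \<open>ball_integral_le_maxfun\<close>.\<close>
    define g where "g x = (\<Sum>i\<in>UNIV. 2 ^ ?N * enn2real (maxfun (v i) x))" for x
    define E where "E x \<longleftrightarrow> lebesgue_point u x \<and> (\<forall>i. maxfun (v i) x < \<infinity>)" for x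
    have g0: "g x \<ge> 0" for x by (simp add: g_def sum_nonneg)
    have [measurable]: "g \<in> borel_measurable borel" unfolding g_def[abs_def] by measurable
    have E: "AE x in lborel. E x"
    proof -
      have "AE x in lborel. \<forall>i\<in>UNIV. maxfun (v i) x < \<infinity>"
        using fin p by (intro AE_finite_allI maxfun_finite_AE[where q = ?q]) auto
      with AE_lebesgue_point[OF u] show ?thesis
        by eventually_elim (auto simp: E_def)
    qed
    have ball: "(\<integral>\<^sup>+y. ennreal \<bar>v i y\<bar> * indicator (cball x R) y \<partial>lborel) \<le> ennreal (R ^ ?N * g x)"
      if "E x" "R > 0" for x i R
    proof -
      have fi: "maxfun (v i) x = ennreal (enn2real (maxfun (v i) x))"
        using that(1) by (simp add: E_def)
      have "(\<integral>\<^sup>+y. ennreal \<bar>v i y\<bar> * indicator (cball x R) y \<partial>lborel) \<le> ennreal ((2 * R) ^ ?N) * maxfun (v i) x"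
        using ball_integral_le_maxfun[OF that(2), of "v i" x] by simp
      also have "\<dots> = ennreal (R ^ ?N * (2 ^ ?N * enn2real (maxfun (v i) x)))"
        using that(2) by (subst fi) (simp add: ennreal_mult[symmetric] power_mult_distrib mult_ac)
      also have "\<dots> \<le> ennreal (R ^ ?N * g x)"
        unfolding g_def using that(2) by (intro ennreal_leI mult_left_mono member_le_sum) auto
      finally show ?thesis .
    qed
    have "\<forall>x z. E x \<longrightarrow> E z \<longrightarrow> x \<noteq> z \<longrightarrow> \<bar>u x - u z\<bar> \<le> K * majorant (real m) a b B (dist x z) (g x + g z)"
    proof (intro allI impI)
      fix x z assume xz: "E x" "E z" "x \<noteq> z"
      have *: "\<bar>u x - u z\<bar> \<le> K * (dist x z powr e * (B powr (1 - e / real m) * (g x + g z) powr (e / real m)))"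
        if "0 < e" "e < 1" "h e \<le> K" for e
      proof -
        have "\<bar>u x - u z\<bar> \<le> h e * (dist x z powr e * (B powr (1 - e / real m) * (g x + g z) powr (e / real m)))"
          using pointwise_interpolation[OF that(1,2) xz(3) _ _ ball[OF xz(1)] ball[OF xz(2)] g0 g0] xz
          by (simp add: E_def h_def c0_def osc_const_def)
        also have "\<dots> \<le> K * (dist x z powr e * (B powr (1 - e / real m) * (g x + g z) powr (e / real m)))"
          using that(3) by (intro mult_right_mono) auto
        finally show ?thesis .
      qed
      show "\<bar>u x - u z\<bar> \<le> K * majorant (real m) a b B (dist x z) (g x + g z)"
        unfolding majorant_def using *[of a] *[of b] ab K by (simp add: min_def)
    qed
    from C1'[OF B _ _ _ _ E this]
    have "(\<integral>\<^sup>+z. (\<integral>\<^sup>+x. ennreal (\<bar>u x - u z\<bar> powr p / norm (x - z) powr (\<sigma> * p + real ?N)) \<partial>lborel) \<partial>lborel)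
       \<le> ennreal (C1 * K powr p * B powr (p - ?q)) * (\<integral>\<^sup>+x. ennreal (g x powr ?q) \<partial>lborel)"
      using K g0 by simp
    also have "(\<integral>\<^sup>+x. ennreal (g x powr ?q) \<partial>lborel) \<le>
        (\<integral>\<^sup>+x. (\<Sum>i\<in>UNIV. ennreal (real ?N powr ?q * (2 ^ ?N) powr ?q) * ennreal (enn2real (maxfun (v i) x) powr ?q)) \<partial>lborel)"
    proof (rule nn_integral_mono)
      fix x
      have "g x powr ?q \<le> real ?N powr ?q * (\<Sum>i\<in>UNIV. (2 ^ ?N * enn2real (maxfun (v i) x)) powr ?q)"
        unfolding g_def using p by (intro sum_powr_le) auto
      also have "\<dots> = (\<Sum>i\<in>UNIV. (real ?N powr ?q * (2 ^ ?N) powr ?q) * enn2real (maxfun (v i) x) powr ?q)"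
        by (simp add: powr_mult sum_distrib_left mult.assoc)
      finally have "ennreal (g x powr ?q) \<le> ennreal (\<Sum>i\<in>UNIV. (real ?N powr ?q * (2 ^ ?N) powr ?q) * enn2real (maxfun (v i) x) powr ?q)"
        by (rule ennreal_leI)
      also have "\<dots> = (\<Sum>i\<in>UNIV. ennreal (real ?N powr ?q * (2 ^ ?N) powr ?q) * ennreal (enn2real (maxfun (v i) x) powr ?q))"
        by (subst sum_ennreal[symmetric]) (auto simp: ennreal_mult)
      finally show "ennreal (g x powr ?q) \<le> (\<Sum>i\<in>UNIV. ennreal (real ?N powr ?q * (2 ^ ?N) powr ?q) * ennreal (enn2real (maxfun (v i) x) powr ?q))" .
    qed
    also have "\<dots> = (\<Sum>i\<in>UNIV. ennreal (real ?N powr ?q * (2 ^ ?N) powr ?q) * (\<integral>\<^sup>+x. ennreal (enn2real (maxfun (v i) x) powr ?q) \<partial>lborel))"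
      by (simp add: nn_integral_sum nn_integral_cmult)
    also have "\<dots> \<le> (\<Sum>i\<in>UNIV. ennreal (real ?N powr ?q * (2 ^ ?N) powr ?q) * (ennreal A * (\<integral>\<^sup>+x. ennreal (\<bar>v i x\<bar> powr ?q) \<partial>lborel)))"
      by (intro sum_mono mult_left_mono maxfun_le) auto
    also have "\<dots> = ennreal ((real ?N powr ?q * (2 ^ ?N) powr ?q) * A) * (\<Sum>i\<in>UNIV. \<integral>\<^sup>+x. ennreal (\<bar>v i x\<bar> powr ?q) \<partial>lborel)"
      using A by (simp add: ennreal_mult mult.assoc sum_distrib_left)
    finally have "(\<integral>\<^sup>+z. (\<integral>\<^sup>+x. ennreal (\<bar>u x - u z\<bar> powr p / norm (x - z) powr (\<sigma> * p + real ?N)) \<partial>lborel) \<partial>lborel)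
       \<le> ennreal (C1 * K powr p * B powr (p - ?q)) * (ennreal ((real ?N powr ?q * (2 ^ ?N) powr ?q) * A) *
           (\<Sum>i\<in>UNIV. \<integral>\<^sup>+x. ennreal (\<bar>v i x\<bar> powr ?q) \<partial>lborel))"
      by (simp add: mult_left_mono)
    also have "\<dots> = ennreal (C * B powr (p - ?q)) * (\<Sum>i\<in>UNIV. \<integral>\<^sup>+x. ennreal (\<bar>v i x\<bar> powr ?q) \<partial>lborel)"
    proof -
      have "ennreal (C1 * K powr p * B powr (p - ?q)) * ennreal ((real ?N powr ?q * (2 ^ ?N) powr ?q) * A) = ennreal (C * B powr (p - ?q))"
        using C1 A by (subst ennreal_mult[symmetric]) (auto simp: C_def mult_ac)
      then show ?thesis by (simp only: mult.assoc[symmetric])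
    qed
    finally show ?thesis .
  qed
  ultimately show ?thesis unfolding \<sigma>_def by (intro exI[of _ C]) blast
qed

section \<open>Passing to Borel representatives\<close>

lemma ennpowr_mono: "x \<le> y \<Longrightarrow> 0 \<le> a \<Longrightarrow> ennpowr x a \<le> ennpowr y a"
  by (auto simp: ennpowr_def top_unique less_top intro!: ennreal_leI powr_mono2 enn2real_mono)

lemma ennpowr_ennreal: "0 \<le> x \<Longrightarrow> ennpowr (ennreal x) a = ennreal (x powr a)"
  by (simp add: ennpowr_def)

lemma ennpowr_ennpowr_inverse: "a \<noteq> 0 \<Longrightarrow> ennpowr (ennpowr x (1 / a)) a = x"
  by (cases x) (auto simp: ennpowr_def powr_powr)

lemma locally_integrable_measurable:
  assumes "locally_integrable u"
  shows "u \<in> borel_measurable lebesgue"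
proof (rule borel_measurable_LIMSEQ_real)
  show "(\<lambda>x. indicator (cball 0 (real n)) x *\<^sub>R u x) \<in> borel_measurable lebesgue" for n
    using assms unfolding locally_integrable_def set_integrable_def by (blast intro: borel_measurable_integrable compact_cball)
  fix x :: "real ^ 'a"
  obtain k :: nat where k: "norm x \<le> real k" using real_arch_simple by blast
  have "eventually (\<lambda>n. indicator (cball 0 (real n)) x *\<^sub>R u x = u x) sequentially"
    by (rule eventually_sequentiallyI[of k]) (use k in auto)
  then show "(\<lambda>n. indicator (cball 0 (real n)) x *\<^sub>R u x) \<longlonglongrightarrow> u x"
    by (rule tendsto_eventually)
qed

text \<open>A Lebesgue measurable function agrees almost everywhere with a Borel one, and
  integrability on balls survives the change.\<close>

lemma locally_integrable_borel_version:
  fixes u :: "real ^ 'n::finite \<Rightarrow> real"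
  assumes u: "locally_integrable u"
  shows "\<exists>u'. ball_integrable u' \<and> (AE x in lborel. u x = u' x)"
proof -
  have um[measurable]: "u \<in> borel_measurable lebesgue" by (rule locally_integrable_measurable[OF u])
  then obtain u' where u'[measurable]: "u' \<in> borel_measurable lborel" and ae: "AE x in lborel. u x = u' x"
    using completion_ex_borel_measurable_real[of u lborel] by blast
  have [measurable]: "u' \<in> borel_measurable lebesgue" using u' by (rule measurable_completion)
  have "integrable lborel (\<lambda>y. indicator (cball x R) y *\<^sub>R u' y)" for x R
  proof -
    have iu: "integrable lebesgue (\<lambda>y. indicator (cball x R) y *\<^sub>R u y)"
      using u compact_cball[of x R] unfolding locally_integrable_def set_integrable_def by simp
    have ae': "AE y in lebesgue. indicator (cball x R) y *\<^sub>R u y = indicator (cball x R) y *\<^sub>R u' y"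
      using ae by (intro AE_completion) auto
    have m: "(\<lambda>y. indicator (cball x R) y *\<^sub>R u' y) \<in> borel_measurable lborel"
      by measurable
    have "integrable lebesgue (\<lambda>y. indicator (cball x R) y *\<^sub>R u' y)"
      using integrable_cong_AE[OF borel_measurable_integrable[OF iu] measurable_completion[OF m] ae'] iu
      by (rule iffD1)
    then show ?thesis using m by (subst (asm) integrable_completion)
  qed
  then have "ball_integrable u'" using u' by (simp add: ball_integrable_def set_integrable_def)
  then show ?thesis using ae by blast
qed

lemma integral_lebesgue_cong_borel:
  fixes u u' \<phi> :: "real ^ 'n::finite \<Rightarrow> real"
  assumes "u \<in> borel_measurable lebesgue" and [measurable]: "u' \<in> borel_measurable borel" "\<phi> \<in> borel_measurable borel"
    and ae: "AE x in lborel. u x = u' x"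
  shows "(LINT x|lebesgue. u x * \<phi> x) = (LINT x|lborel. u' x * \<phi> x)"
proof -
  have [measurable]: "u' \<in> borel_measurable lebesgue" "\<phi> \<in> borel_measurable lebesgue"
    by (auto intro!: measurable_completion)
  note [measurable] = assms(1)
  have "(LINT x|lebesgue. u x * \<phi> x) = (LINT x|lebesgue. u' x * \<phi> x)"
    using ae by (intro integral_cong_AE AE_completion) auto
  also have "\<dots> = (LINT x|lborel. u' x * \<phi> x)"
    by (rule integral_completion) measurable
  finally show ?thesis .
qed

text \<open>Supplies the hypothesis \<open>weak\<close> of the locale: the list
  \<open>replicate m i\<close> realises the multi-index concentrated at \<open>i\<close>, and
  differentiating a tensor product along it changes the \<open>i\<close>-th factor alone.\<close>

lemma weak_deriv_tensor:
  fixes u u' v v' :: "real ^ 'n::finite \<Rightarrow> real"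
  assumes w: "has_weak_deriv u (\<lambda>j. if j = i then m else 0) v"
    and u': "ball_integrable u'" "AE x in lborel. u x = u' x"
    and v': "ball_integrable v'" "AE x in lborel. v x = v' x"
    and f: "\<And>j. smooth1 (f j)" "\<And>j t. t \<notin> {a $ j..b $ j} \<Longrightarrow> f j t = 0"
  shows "(LINT y|lborel. u' y * tensor (f(i := (deriv ^^ m) (f i))) y) = (-1) ^ m * (LINT y|lborel. v' y * tensor f y)"
proof -
  let ?g = "f(i := (deriv ^^ m) (f i))"
  have g: "smooth1 (?g j)" for j using f(1) by (simp add: smooth1_higher_deriv)
  have count: "count_list (replicate m i) j = (if j = i then m else 0)" for j
    by (induction m) auto
  have "(\<lambda>j. (deriv ^^ count_list (replicate m i) j) (f j)) = ?g"
    by (auto simp: count)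
  then have "iter_partial_deriv (replicate m i) (tensor f) = tensor ?g"
    by (simp add: iter_partial_deriv_tensor[OF f(1)])
  moreover have "test_function (tensor f)" by (rule test_function_tensor[OF f])
  moreover have "(\<Sum>j\<in>UNIV. if j = i then m else 0) = m" by simp
  ultimately have "(LINT y|lebesgue. u y * tensor ?g y) = (-1) ^ m * (LINT y|lebesgue. v y * tensor f y)"
    using w count unfolding has_weak_deriv_def by metis
  moreover have "(LINT y|lebesgue. u y * tensor ?g y) = (LINT y|lborel. u' y * tensor ?g y)"
    using w u' by (intro integral_lebesgue_cong_borel locally_integrable_measurable borel_measurable_tensor g)
      (auto simp: has_weak_deriv_def ball_integrable_def)
  moreover have "(LINT y|lebesgue. v y * tensor f y) = (LINT y|lborel. v' y * tensor f y)"
    using w v' by (intro integral_lebesgue_cong_borel locally_integrable_measurable borel_measurable_tensor f(1))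
      (auto simp: has_weak_deriv_def ball_integrable_def)
  ultimately show ?thesis by simp
qed

text \<open>The integrand is a general \<open>F\<close> because the Gagliardo integral and the mean
  oscillation over a cube are both transferred in this way, one variable at a time.\<close>

lemma nn_integral_double_cong_borel:
  assumes ae: "AE x in lborel. u x = u' x"
  shows "(\<integral>\<^sup>+z. (\<integral>\<^sup>+x. F x z (u x) (u z) \<partial>lebesgue) \<partial>lebesgue) =
    (\<integral>\<^sup>+z. (\<integral>\<^sup>+x. F x z (u' x) (u' z) \<partial>lborel) \<partial>lborel)"
proof -
  have "(\<integral>\<^sup>+z. (\<integral>\<^sup>+x. F x z (u x) (u z) \<partial>lborel) \<partial>lborel) = (\<integral>\<^sup>+z. (\<integral>\<^sup>+x. F x z (u' x) (u' z) \<partial>lborel) \<partial>lborel)"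
  proof (rule nn_integral_cong_AE, use ae in eventually_elim)
    fix z assume z: "u z = u' z"
    show "(\<integral>\<^sup>+x. F x z (u x) (u z) \<partial>lborel) = (\<integral>\<^sup>+x. F x z (u' x) (u' z) \<partial>lborel)"
      by (rule nn_integral_cong_AE, use ae in eventually_elim) (simp add: z)
  qed
  then show ?thesis by (simp add: nn_integral_completion)
qed

lemma emeasure_cube:
  fixes Q :: "(real ^ 'n::finite) set"
  assumes "is_cube Q"
  shows "Q \<in> sets borel" "0 < emeasure lborel Q" "emeasure lborel Q < \<infinity>"
proof -
  obtain a l where l: "l > 0" and Q: "Q = cbox a (\<chi> i. a $ i + l)"
    using assms by (auto simp: is_cube_def)
  have "(\<chi> i. (\<chi> i. a $ i + l / 2) $ i - l / 2) = a" by (simp add: vec_eq_iff)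
  then have "Q = centered_cube (\<chi> i. a $ i + l / 2) (l / 2)"
    unfolding centered_cube_def Q by simp
  then have "emeasure lborel Q = ennreal ((2 * (l / 2)) ^ CARD('n))"
    using l by (simp only: emeasure_centered_cube half_gt_zero)
  then show "0 < emeasure lborel Q" "emeasure lborel Q < \<infinity>" using l by auto
  show "Q \<in> sets borel" unfolding Q by (intro borel_closed closed_cbox)
qed

text \<open>Clearing the denominator in \<open>ennreal\<close> is legitimate because cubes have
  positive finite measure.\<close>

lemma bmo_bounded_borel_version:
  fixes u u' :: "real ^ 'n::finite \<Rightarrow> real"
  assumes ae: "AE x in lborel. u x = u' x" and B: "bmo_norm u = ennreal B" "B \<ge> 0"
  shows "bmo_bounded B u'"
  unfolding bmo_bounded_def
proof (intro conjI allI impI)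
  show "B \<ge> 0" by fact
  fix Q :: "(real ^ 'n) set" assume Q: "is_cube Q"
  let ?X = "\<integral>\<^sup>+x\<in>Q. (\<integral>\<^sup>+z\<in>Q. ennreal \<bar>u z - u x\<bar> \<partial>lebesgue) \<partial>lebesgue"
  let ?e = "emeasure lborel Q"
  note eQ = emeasure_cube[OF Q]
  have e2: "?e\<^sup>2 \<noteq> 0" "?e\<^sup>2 \<noteq> \<infinity>" using eQ by (auto simp: power2_eq_square ennreal_mult_eq_top_iff)
  have "?X / (emeasure lebesgue Q)\<^sup>2 \<le> bmo_norm u"
    unfolding bmo_norm_def by (rule SUP_upper) (use Q in simp)
  moreover have "emeasure lebesgue Q = ?e" using eQ by simp
  ultimately have "?X / ?e\<^sup>2 \<le> ennreal B" using B by simp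
  then have "?X / ?e\<^sup>2 * ?e\<^sup>2 \<le> ennreal B * ?e\<^sup>2" by (rule mult_right_mono) simp
  moreover have "?X / ?e\<^sup>2 * ?e\<^sup>2 = ?X"
    using e2 ennreal_divide_self[of "?e\<^sup>2"] by (simp add: ennreal_divide_times less_top)
  moreover have "?X = (\<integral>\<^sup>+x\<in>Q. (\<integral>\<^sup>+z\<in>Q. ennreal \<bar>u' z - u' x\<bar> \<partial>lborel) \<partial>lborel)"
  proof -
    have "?X = (\<integral>\<^sup>+x. (\<integral>\<^sup>+z. ennreal \<bar>u z - u x\<bar> * indicator Q z * indicator Q x \<partial>lebesgue) \<partial>lebesgue)"
      by (intro nn_integral_cong) (auto simp: indicator_def)
    also have "\<dots> = (\<integral>\<^sup>+x. (\<integral>\<^sup>+z. ennreal \<bar>u' z - u' x\<bar> * indicator Q z * indicator Q x \<partial>lborel) \<partial>lborel)"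
      by (rule nn_integral_double_cong_borel[OF ae, where F = "\<lambda>z x uz ux. ennreal \<bar>uz - ux\<bar> * indicator Q z * indicator Q x"])
    also have "\<dots> = (\<integral>\<^sup>+x\<in>Q. (\<integral>\<^sup>+z\<in>Q. ennreal \<bar>u' z - u' x\<bar> \<partial>lborel) \<partial>lborel)"
      by (intro nn_integral_cong) (auto simp: indicator_def)
    finally show ?thesis .
  qed
  ultimately show "(\<integral>\<^sup>+x\<in>Q. (\<integral>\<^sup>+z\<in>Q. ennreal \<bar>u' z - u' x\<bar> \<partial>lborel) \<partial>lborel) \<le> ennreal B * ?e\<^sup>2"
    by simp
qed

text \<open>Treats the degenerate case in which the balancing radius of
  \<open>nn_integral_majorant\<close> collapses. Vanishing oscillation gives equality almost
  everywhere on each cube of an exhausting sequence; the nested form of the conclusion matches the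
  iterated integrals.\<close>

lemma bmo_bounded_0_AE_eq:
  fixes u :: "real ^ 'n::finite \<Rightarrow> real"
  assumes bmo: "bmo_bounded 0 u" and [measurable]: "u \<in> borel_measurable borel"
  shows "AE x in lborel. AE z in lborel. u z = u x"
proof -
  define Q where "Q n = centered_cube (0 :: real ^ 'n) (real (Suc n))" for n
  have Qs [measurable]: "Q n \<in> sets borel" for n
    unfolding Q_def centered_cube_def by (intro borel_closed closed_cbox)
  have "AE x in lborel. x \<in> Q n \<longrightarrow> (AE z in lborel. z \<in> Q n \<longrightarrow> u z = u x)" for n
  proof -
    have "is_cube (Q n)" unfolding Q_def by (rule is_cube_centered_cube) simp
    then have "(\<integral>\<^sup>+x\<in>Q n. (\<integral>\<^sup>+z\<in>Q n. ennreal \<bar>u z - u x\<bar> \<partial>lborel) \<partial>lborel) = 0"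
      using bmo by (simp add: bmo_bounded_def)
    moreover have "(\<lambda>x. (\<integral>\<^sup>+z\<in>Q n. ennreal \<bar>u z - u x\<bar> \<partial>lborel) * indicator (Q n) x) \<in> borel_measurable borel"
      by measurable
    ultimately have "AE x in lborel. (\<integral>\<^sup>+z\<in>Q n. ennreal \<bar>u z - u x\<bar> \<partial>lborel) * indicator (Q n) x = 0"
      by (subst (asm) nn_integral_0_iff_AE) simp_all
    then show ?thesis
    proof eventually_elim
      case (elim x)
      show ?case
      proof
        assume "x \<in> Q n"
        then have "(\<integral>\<^sup>+z\<in>Q n. ennreal \<bar>u z - u x\<bar> \<partial>lborel) = 0" using elim by simp
        moreover have "(\<lambda>z. ennreal \<bar>u z - u x\<bar> * indicator (Q n) z) \<in> borel_measurable borel"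
          by measurable
        ultimately have "AE z in lborel. ennreal \<bar>u z - u x\<bar> * indicator (Q n) z = 0"
          by (subst (asm) nn_integral_0_iff_AE) simp_all
        then show "AE z in lborel. z \<in> Q n \<longrightarrow> u z = u x"
          by eventually_elim (auto simp: indicator_def split: if_splits)
      qed
    qed
  qed
  then have "AE x in lborel. \<forall>n. x \<in> Q n \<longrightarrow> (AE z in lborel. z \<in> Q n \<longrightarrow> u z = u x)"
    by (simp add: AE_all_countable)
  then show ?thesis
  proof eventually_elim
    case (elim x)
    have inQ: "y \<in> Q n" if "norm y \<le> real n" for y n
      unfolding Q_def using that by (intro cball_subset_centered_cube[THEN subsetD]) simp
    have "AE z in lborel. \<forall>n. x \<in> Q n \<longrightarrow> z \<in> Q n \<longrightarrow> u z = u x"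
      unfolding AE_all_countable using elim by (auto intro: AE_I2)
    then show ?case
    proof eventually_elim
      case (elim z)
      obtain n :: nat where "max (norm x) (norm z) \<le> real n" using real_arch_simple by blast
      then show ?case using elim inQ[of x n] inQ[of z n] by simp
    qed
  qed
qed

theorem corollary1p13:
  fixes m :: nat and s p :: real
  assumes "m \<ge> 1" and "0 < s" and "s < 1" and "1 \<le> p"
    and "2 / p \<le> s" and "s < 1 / real m"
  shows "\<exists>C::real. C > 0 \<and>
    (\<forall>u :: real ^ 'n \<Rightarrow> real. u \<in> bmo_space \<inter> sobolev_space m (s * p) \<longrightarrow>
       gagliardo_seminorm (real m * s) p u
         \<le> ennreal C * ennpowr (bmo_norm u) (1 - s) * ennpowr (sobolev_seminorm m (s * p) u) s)"
proof -
  let ?q = "s * p"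
  have p0: "p > 0" using assms by simp
  \<comment> \<open>The lower bound on \<open>s\<close> enters here: it places \<open>s * p\<close>
    in the range where the maximal theorem holds.\<close>
  have q2: "?q \<ge> 2" using assms p0 by (simp add: pos_divide_le_eq)
  then have q1: "1 < ?q" by simp
  obtain C0 where C0: "C0 > 0" and main: "\<And>(u :: real ^ 'n \<Rightarrow> real) v B. B > 0 \<Longrightarrow> ball_integrable u \<Longrightarrow> (\<forall>i. ball_integrable (v i)) \<Longrightarrow>
    bmo_bounded B u \<Longrightarrow>
    (\<forall>i f a b. (\<forall>j. smooth1 (f j)) \<longrightarrow> (\<forall>j t. t \<notin> {a $ j..b $ j} \<longrightarrow> f j t = 0) \<longrightarrow>
      (LINT y|lborel. u y * tensor (f(i := (deriv ^^ m) (f i))) y) = (-1) ^ m * (LINT y|lborel. v i y * tensor f y)) \<Longrightarrow>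
    (\<forall>i. (\<integral>\<^sup>+x. ennreal (\<bar>v i x\<bar> powr ?q) \<partial>lborel) < \<infinity>) \<Longrightarrow>
    (\<integral>\<^sup>+z. (\<integral>\<^sup>+x. ennreal (\<bar>u x - u z\<bar> powr p / norm (x - z) powr (real m * s * p + real CARD('n))) \<partial>lborel) \<partial>lborel)
      \<le> ennreal (C0 * B powr (p - ?q)) * (\<Sum>i\<in>UNIV. \<integral>\<^sup>+x. ennreal (\<bar>v i x\<bar> powr ?q) \<partial>lborel)"
    using gagliardo_bmo_sobolev[OF assms(1,2,6,4) q1, where ?'n = 'n] by blast
  \<comment> \<open>The number of pure derivatives, each bounded by the full seminorm, multiplies
    \<open>C0\<close>; the root undoes the \<open>p\<close>-th power of the Gagliardo
    seminorm.\<close>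
  define C where "C = (C0 * real CARD('n)) powr (1 / p)"
  have C: "C > 0" using C0 by (simp add: C_def)
  have bound: "gagliardo_seminorm (real m * s) p u
         \<le> ennreal C * ennpowr (bmo_norm u) (1 - s) * ennpowr (sobolev_seminorm m ?q u) s"
    if u: "u \<in> bmo_space \<inter> sobolev_space m ?q" for u :: "real ^ 'n \<Rightarrow> real"
  proof -
    define B where "B = enn2real (bmo_norm u)"
    have B: "bmo_norm u = ennreal B" "B \<ge> 0" using u by (auto simp: B_def bmo_space_def less_top)
    have uloc: "locally_integrable u" using u by (simp add: bmo_space_def)
    obtain u' where u': "ball_integrable u'" "AE x in lborel. u x = u' x"
      using locally_integrable_borel_version[OF uloc] by blast
    have bmo: "bmo_bounded B u'" by (rule bmo_bounded_borel_version[OF u'(2) B])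
    define D where "D = (\<integral>\<^sup>+z. (\<integral>\<^sup>+x. ennreal (\<bar>u' x - u' z\<bar> powr p / norm (x - z) powr (real m * s * p + real CARD('n)))
        \<partial>lborel) \<partial>lborel)"
    have gag: "gagliardo_seminorm (real m * s) p u = ennpowr D (1 / p)"
      unfolding gagliardo_seminorm_def D_def
      by (subst nn_integral_double_cong_borel[OF u'(2), where F = "\<lambda>x z ux uz. ennreal (\<bar>ux - uz\<bar> powr p /
        norm (x - z) powr (real m * s * p + real CARD('n)))"]) simp
    show ?thesis
    proof (cases "B = 0")
      \<comment> \<open>With vanishing BMO norm the function is almost everywhere constant, so the
        left side is 0 whatever the right side is.\<close>
      case True
      have "AE x in lborel. AE z in lborel. u' z = u' x"
        using bmo_bounded_0_AE_eq[of u'] bmo True u'(1) by (simp add: ball_integrable_def)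
      then have "D = (\<integral>\<^sup>+z. 0 \<partial>(lborel :: (real ^ 'n) measure))"
        unfolding D_def
      proof (intro nn_integral_cong_AE, eventually_elim)
        case (elim z)
        have "(\<integral>\<^sup>+x. ennreal (\<bar>u' x - u' z\<bar> powr p / norm (x - z) powr (real m * s * p + real CARD('n))) \<partial>lborel)
            = (\<integral>\<^sup>+x. 0 \<partial>(lborel :: (real ^ 'n) measure))"
          by (rule nn_integral_cong_AE, use elim in eventually_elim) simp
        then show ?case by simp
      qed
      then show ?thesis unfolding gag by (simp add: ennpowr_def)
    next
      case False
      then have Bpos: "B > 0" using B by simp
      define \<alpha> where "\<alpha> i = (\<lambda>j. if j = i then m else 0)" for i :: 'n
      have \<alpha>: "(\<Sum>j\<in>UNIV. \<alpha> i j) = m" for i by (simp add: \<alpha>_def)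
      have "has_weak_deriv u (\<alpha> i) (weak_deriv (\<alpha> i) u)" for i
      proof -
        have "\<forall>\<beta>. (\<Sum>j\<in>UNIV. \<beta> j) \<le> m \<longrightarrow> (\<exists>v. has_weak_deriv u \<beta> v \<and> v \<in> Lp_space ?q)"
          using u by (simp add: sobolev_space_def)
        then have "\<exists>v. has_weak_deriv u (\<alpha> i) v" using \<alpha>[of i] by (metis order_refl)
        then show ?thesis unfolding weak_deriv_def by (rule someI_ex)
      qed
      define T where "T = (\<Sum>\<alpha> | (\<Sum>i\<in>UNIV. \<alpha> i) = m. ennpowr (Lp_norm ?q (weak_deriv \<alpha> u)) ?q)"
      have sem: "sobolev_seminorm m ?q u = ennpowr T (1 / ?q)"
        by (simp add: sobolev_seminorm_def T_def)
      show ?thesis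
      proof (cases "T = \<infinity>")
        case True
        \<comment> \<open>Not excluded here: the chosen weak derivatives are not compared with those in \<open>L\<^bsup>sp\<^esup>\<close>.\<close>
        have "ennreal C * ennpowr (bmo_norm u) (1 - s) \<noteq> 0"
          using C Bpos B by (simp add: ennpowr_ennreal)
        then show ?thesis
          unfolding sem True by (simp add: ennpowr_def ennreal_mult_top)
      next
        case False
        \<comment> \<open>A sum over an infinite index set would be 0 by convention; finiteness is
          what lets \<open>T\<close> dominate each of its terms.\<close>
        have fin: "finite {\<beta> :: 'n \<Rightarrow> nat. (\<Sum>i\<in>UNIV. \<beta> i) = m}"
        proof (rule finite_subset)
          show "{\<beta> :: 'n \<Rightarrow> nat. (\<Sum>i\<in>UNIV. \<beta> i) = m} \<subseteq> (\<Pi>\<^sub>E i\<in>UNIV. {..m})"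
            by (auto simp: PiE_def intro: member_le_sum)
          show "finite (\<Pi>\<^sub>E i\<in>(UNIV :: 'n set). {..m})" by (intro finite_PiE) auto
        qed
        define w where "w i = weak_deriv (\<alpha> i) u" for i
        have w: "has_weak_deriv u (\<alpha> i) (w i)" for i unfolding w_def by fact
        have "\<exists>v. ball_integrable v \<and> (AE x in lborel. w i x = v x)" for i
          using w[of i] by (intro locally_integrable_borel_version) (simp add: has_weak_deriv_def)
        then obtain v where v: "\<And>i. ball_integrable (v i)" "\<And>i. AE x in lborel. w i x = v i x"
          by metis
        have vT: "(\<integral>\<^sup>+x. ennreal (\<bar>v i x\<bar> powr ?q) \<partial>lborel) \<le> T" for i
        proof -
          have "(\<integral>\<^sup>+x. ennreal (\<bar>v i x\<bar> powr ?q) \<partial>lborel) = (\<integral>\<^sup>+x. ennreal (\<bar>w i x\<bar> powr ?q) \<partial>lborel)"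
            by (rule nn_integral_cong_AE, use v(2)[of i] in eventually_elim) simp
          also have "\<dots> = ennpowr (Lp_norm ?q (weak_deriv (\<alpha> i) u)) ?q"
            unfolding Lp_norm_def w_def nn_integral_completion
            using q1 by (subst ennpowr_ennpowr_inverse) auto
          also have "\<dots> \<le> T"
            unfolding T_def using \<alpha>[of i] by (intro member_le_sum fin) auto
          finally show ?thesis .
        qed
        have "D \<le> ennreal (C0 * B powr (p - ?q)) * (\<Sum>i\<in>UNIV. \<integral>\<^sup>+x. ennreal (\<bar>v i x\<bar> powr ?q) \<partial>lborel)"
          unfolding D_def
        proof (rule main[OF Bpos u'(1) _ bmo])
          show "\<forall>i. (\<integral>\<^sup>+x. ennreal (\<bar>v i x\<bar> powr ?q) \<partial>lborel) < \<infinity>"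
            using vT False by (metis less_top infinity_ennreal_def le_less_trans)
          show "\<forall>i f a b. (\<forall>j. smooth1 (f j)) \<longrightarrow> (\<forall>j t. t \<notin> {a $ j..b $ j} \<longrightarrow> f j t = 0) \<longrightarrow>
            (LINT y|lborel. u' y * tensor (f(i := (deriv ^^ m) (f i))) y) = (-1) ^ m * (LINT y|lborel. v i y * tensor f y)"
            by (intro allI impI, rule weak_deriv_tensor[OF w[unfolded \<alpha>_def] u' v]) blast+
        qed (use v in auto)
        also have "\<dots> \<le> ennreal (C0 * B powr (p - ?q)) * (\<Sum>i\<in>(UNIV :: 'n set). T)"
          by (intro mult_left_mono sum_mono vT) auto
        finally have D: "D \<le> ennreal (C0 * B powr (p - ?q)) * (of_nat CARD('n) * T)" by simp
        define t where "t = enn2real T"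
        have t: "T = ennreal t" "t \<ge> 0" using False by (auto simp: t_def less_top)
        have "D \<le> ennreal (C0 * real CARD('n) * (B powr (p - ?q) * t))"
        proof -
          have "ennreal (C0 * B powr (p - ?q)) * (of_nat CARD('n) * T) =
              ennreal (C0 * B powr (p - ?q)) * (ennreal (real CARD('n)) * ennreal t)"
            by (simp add: t ennreal_of_nat_eq_real_of_nat)
          also have "\<dots> = ennreal (C0 * B powr (p - ?q) * (real CARD('n) * t))"
            using C0 t by (simp add: ennreal_mult)
          finally show ?thesis using D by (simp add: mult_ac)
        qed
        then have "ennpowr D (1 / p) \<le> ennpowr (ennreal (C0 * real CARD('n) * (B powr (p - ?q) * t))) (1 / p)"
          using p0 by (intro ennpowr_mono) auto
        also have "\<dots> = ennreal ((C0 * real CARD('n) * (B powr (p - ?q) * t)) powr (1 / p))"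
          using C0 t by (intro ennpowr_ennreal) auto
        also have "(C0 * real CARD('n) * (B powr (p - ?q) * t)) powr (1 / p) = C * (B powr (1 - s) * t powr (1 / p))"
        proof -
          have "(p - ?q) * (1 / p) = 1 - s" using p0 by (simp add: field_simps)
          then have "(B powr (p - ?q)) powr (1 / p) = B powr (1 - s)" by (simp only: powr_powr)
          then show ?thesis using C0 t by (simp add: powr_mult C_def)
        qed
        also have "ennreal (C * (B powr (1 - s) * t powr (1 / p))) =
            ennreal C * ennpowr (bmo_norm u) (1 - s) * ennpowr (sobolev_seminorm m ?q u) s"
        proof -
          have "1 / ?q * s = 1 / p" using assms by simp
          then have "ennpowr (sobolev_seminorm m ?q u) s = ennreal (t powr (1 / p))"
            unfolding sem t(1) using t(2) by (simp only: ennpowr_ennreal powr_ge_zero powr_powr)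
          moreover have "ennpowr (bmo_norm u) (1 - s) = ennreal (B powr (1 - s))"
            unfolding B(1) using B(2) by (rule ennpowr_ennreal)
          ultimately show ?thesis using C by (simp add: ennreal_mult mult.assoc)
        qed
        finally show ?thesis unfolding gag .
      qed
    qed
  qed
  show ?thesis
    by (rule exI[of _ C], intro conjI C allI impI, rule bound)
qed

end
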